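(* Let $N\ge2$, $k>0$, $c>0$ and $z\in\mathbb{R}^N$, and let $\delta_z$ be the unit point mass at $z$. (a) $\mathcal{F}_k(c\delta_z)\ne\emptyset$ if and only if $0<c\le c_k(R_k)$. (b) If $0<c\le c_k(R_k)$, then $\mathcal{B}_k(c\delta_z)=m|_{B_r(z)}$, where $r$ is the unique value in $[0,R_k]$ such that $c=c_k(r)$.
   Context: $m$ denotes Lebesgue measure on $\mathbb{R}^N$ and $B_r(z)$ the open ball of centre $z$ and radius $r$. Let $\alpha=(N-2)/2$, let $J_\nu,Y_\nu$ be the Bessel functions of order $\nu$ of the first and second kind, and let $j_{\nu,1}$ be the first positive zero of $J_\nu$. Put $R_k=j_{\alpha,1}/k$ and $c_k(r)=(2\pi r/k)^{N/2}J_{N/2}(kr)$. Let $\Psi_k(x)=-\frac{k^\alpha}{2^{\alpha+2}\pi^\alpha}|x|^{-\alpha}Y_\alpha(k|x|)$ (with value $+\infty$ at $0$), so that $-(\Delta+k^2)\Psi_k=\delta_0$ in the sense of distributions. The $k$-potential of a compactly supported (positive) measure $\mu$ is $U_k^\mu(x)=\int\Psi_k(x-y)\,d\mu(y)$. Define $\mathcal{F}_k(\mu)=\{v\in\mathcal{D}'(\mathbb{R}^N): -(\Delta+k^2)v\le 1,\ v\le U_k^\mu \text{ and } \{v<U_k^\mu\}\text{ is bounded}\}$, where differential inequalities are in the sense of distributions and each such $v$ is identified with its upper semicontinuous representative (whose value at each point $x$ is the limit as $r\to0$ of its means over the balls of centre $x$ and radius $r$). If $\mathcal{F}_k(\mu)\ne\emptyset$,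 this collection has a largest element, denoted $V_k^\mu$, and $\mathcal{B}_k(\mu)=-(\Delta+k^2)V_k^\mu$ (the $k$-partial balayage of $\mu$ onto $m$). *)

theory Defs
  imports "HOL-Probability.Probability"
begin

section \<open>Bessel functions of real order\<close>

text \<open>Only used for \<open>x > 0\<close>, and for \<open>x = 0\<close> when \<open>\<nu> > 0\<close>: since \<open>0 powr 0 = 0\<close>,
  the value of \<open>bessel_J 0\<close> at \<open>0\<close> is not the usual one.  As \<open>rGamma\<close> vanishes at the poles
  of \<open>Gamma\<close>, the formula also covers negative integer orders.\<close>

definition bessel_J :: "real \<Rightarrow> real \<Rightarrow> real" where
  "bessel_J \<nu> x =
     (x / 2) powr \<nu> * (\<Sum>j. (-1) ^ j * rGamma (real j + \<nu> + 1) / fact j * (x / 2) ^ (2 * j))"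

definition bessel_Y :: "real \<Rightarrow> real \<Rightarrow> real" where
  "bessel_Y \<nu> x =
     (let Q = (\<lambda>\<mu>. (bessel_J \<mu> x * cos (\<mu> * pi) - bessel_J (- \<mu>) x) / sin (\<mu> * pi))
      in if \<nu> \<in> \<int> then Lim (at \<nu>) Q else Q \<nu>)"

definition bessel_J_zero1 :: "real \<Rightarrow> real" where
  "bessel_J_zero1 \<nu> = (LEAST x. 0 < x \<and> bessel_J \<nu> x = 0)"


section \<open>Test functions and distributions\<close>

definition partial_deriv :: "'a::euclidean_space \<Rightarrow> ('a \<Rightarrow> real) \<Rightarrow> 'a \<Rightarrow> real" where
  "partial_deriv b f x = frechet_derivative f (at x) b"

definition iter_partial :: "'a::euclidean_space list \<Rightarrow> ('a \<Rightarrow> real) \<Rightarrow> 'a \<Rightarrow> real" where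
  "iter_partial bs f = foldr partial_deriv bs f"

definition laplacian :: "('a::euclidean_space \<Rightarrow> real) \<Rightarrow> 'a \<Rightarrow> real" where
  "laplacian f x = (\<Sum>b\<in>Basis. partial_deriv b (partial_deriv b f) x)"

text \<open>\<open>C\<^sup>\<infinity>\<close>: every iterated partial derivative (the list of directions being arbitrary) is
  differentiable, hence continuous.\<close>

definition smooth :: "('a::euclidean_space \<Rightarrow> real) \<Rightarrow> bool" where
  "smooth f \<longleftrightarrow>
     (\<forall>bs. set bs \<subseteq> Basis \<longrightarrow> (\<forall>x. iter_partial bs f differentiable (at x)))"

definition test_functions :: "('a::euclidean_space \<Rightarrow> real) set" where
  "test_functions = {\<phi>. smooth \<phi> \<and> compact (closure {x. \<phi> x \<noteq> 0})}"

definition test_seminorm :: "nat \<Rightarrow> ('a::euclidean_space \<Rightarrow> real) \<Rightarrow> real" where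
  "test_seminorm m \<phi> =
     (\<Sum>bs\<in>{bs. set bs \<subseteq> Basis \<and> length bs \<le> m}. SUP x. \<bar>iter_partial bs \<phi> x\<bar>)"

text \<open>A distribution is a functional which is \<open>undefined\<close> off the test functions, so
  that equality of distributions is equality in the logic.\<close>

definition distributions :: "(('a::euclidean_space \<Rightarrow> real) \<Rightarrow> real) set" where
  "distributions = {T \<in> extensional test_functions.
     (\<forall>\<phi>\<in>test_functions. \<forall>\<psi>\<in>test_functions. T (\<lambda>x. \<phi> x + \<psi> x) = T \<phi> + T \<psi>) \<and>
     (\<forall>\<phi>\<in>test_functions. \<forall>a. T (\<lambda>x. a * \<phi> x) = a * T \<phi>) \<and>
     (\<forall>K. compact K \<longrightarrow> (\<exists>C m. \<forall>\<phi>\<in>test_functions.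
        {x. \<phi> x \<noteq> 0} \<subseteq> K \<longrightarrow> \<bar>T \<phi>\<bar> \<le> C * test_seminorm m \<phi>))}"

definition distr_le ::
  "(('a::euclidean_space \<Rightarrow> real) \<Rightarrow> real) \<Rightarrow> (('a \<Rightarrow> real) \<Rightarrow> real) \<Rightarrow> bool" where
  "distr_le S T \<longleftrightarrow> (\<forall>\<phi>\<in>test_functions. (\<forall>x. 0 \<le> \<phi> x) \<longrightarrow> S \<phi> \<le> T \<phi>)"

definition locally_integrable :: "('a::euclidean_space \<Rightarrow> ereal) \<Rightarrow> bool" where
  "locally_integrable u \<longleftrightarrow> u \<in> borel_measurable borel \<and>
     (\<forall>K. compact K \<longrightarrow> (\<integral>\<^sup>+x\<in>K. e2ennreal \<bar>u x\<bar> \<partial>lborel) < \<infinity>)"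

text \<open>The distribution of a locally integrable function; such a function is finite almost
  everywhere, so \<open>real_of_ereal\<close> does no harm.\<close>

definition distr_of_fun ::
  "('a::euclidean_space \<Rightarrow> ereal) \<Rightarrow> ('a \<Rightarrow> real) \<Rightarrow> real" where
  "distr_of_fun u = restrict (\<lambda>\<phi>. LINT x|lborel. real_of_ereal (u x) * \<phi> x) test_functions"

definition distr_of_measure ::
  "'a::euclidean_space measure \<Rightarrow> ('a \<Rightarrow> real) \<Rightarrow> real" where
  "distr_of_measure \<mu> = restrict (\<lambda>\<phi>. LINT x|\<mu>. \<phi> x) test_functions"

text \<open>The distribution \<open>- (\<Delta> + k\<^sup>2) T\<close>; the operator is formally self-adjoint.\<close>

definition neg_helmholtz ::
  "real \<Rightarrow> (('a::euclidean_space \<Rightarrow> real) \<Rightarrow> real) \<Rightarrow> ('a \<Rightarrow> real) \<Rightarrow> real" where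
  "neg_helmholtz k T =
     restrict (\<lambda>\<phi>. T (\<lambda>x. - (laplacian \<phi> x + k\<^sup>2 * \<phi> x))) test_functions"

text \<open>\<open>u\<close> is the upper semicontinuous representative, with values in \<open>[-\<infinity>, \<infinity>)\<close>, of the
  distribution \<open>v\<close>.  The limit of means determines \<open>u\<close> uniquely from \<open>v\<close>.\<close>

definition usc_representative ::
  "(('a::euclidean_space \<Rightarrow> real) \<Rightarrow> real) \<Rightarrow> ('a \<Rightarrow> ereal) \<Rightarrow> bool" where
  "usc_representative v u \<longleftrightarrow>
     locally_integrable u \<and> v = distr_of_fun u \<and>
     (\<forall>x. u x < \<infinity>) \<and> (\<forall>a. open {x. u x < a}) \<and>
     (\<forall>x. ((\<lambda>r. ereal ((LINT y:ball x r|lborel. real_of_ereal (u y)) / measure lborel (ball x r)))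
             \<longlongrightarrow> u x) (at_right 0))"


section \<open>Potentials and partial balayage for the Helmholtz operator\<close>

definition helmholtz_kernel :: "real \<Rightarrow> 'a::euclidean_space \<Rightarrow> ereal" where
  "helmholtz_kernel k x =
     (let \<alpha> = (real DIM('a) - 2) / 2
      in if x = 0 then \<infinity>
         else ereal (- (k powr \<alpha> / (2 powr (\<alpha> + 2) * pi powr \<alpha>)
                       * norm x powr (- \<alpha>) * bessel_Y \<alpha> (k * norm x))))"

text \<open>Meaningful for compactly supported finite \<open>\<mu>\<close>: in dimension at least two the kernel is
  bounded below on bounded sets, so that the second integral is finite.\<close>

definition helmholtz_potential ::
  "real \<Rightarrow> 'a::euclidean_space measure \<Rightarrow> 'a \<Rightarrow> ereal" where
  "helmholtz_potential k \<mu> x =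
     enn2ereal (\<integral>\<^sup>+y. e2ennreal (helmholtz_kernel k (x - y)) \<partial>\<mu>)
     - enn2ereal (\<integral>\<^sup>+y. e2ennreal (- helmholtz_kernel k (x - y)) \<partial>\<mu>)"

text \<open>The pointwise conditions on a distribution \<open>v\<close> refer to its upper semicontinuous
  representative \<open>u\<close>, which exists because of the differential inequality.\<close>

definition balayage_class ::
  "real \<Rightarrow> 'a::euclidean_space measure \<Rightarrow> (('a \<Rightarrow> real) \<Rightarrow> real) set" where
  "balayage_class k \<mu> = {v \<in> distributions.
     distr_le (neg_helmholtz k v) (distr_of_fun (\<lambda>_. 1)) \<and>
     (\<exists>u. usc_representative v u \<and>
          (\<forall>x. u x \<le> helmholtz_potential k \<mu> x) \<and>
          bounded {x. u x < helmholtz_potential k \<mu> x})}"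

definition balayage_potential ::
  "real \<Rightarrow> 'a::euclidean_space measure \<Rightarrow> ('a \<Rightarrow> real) \<Rightarrow> real" where
  "balayage_potential k \<mu> =
     (THE v. v \<in> balayage_class k \<mu> \<and> (\<forall>w\<in>balayage_class k \<mu>. distr_le w v))"

definition partial_balayage ::
  "real \<Rightarrow> 'a::euclidean_space measure \<Rightarrow> ('a \<Rightarrow> real) \<Rightarrow> real" where
  "partial_balayage k \<mu> = neg_helmholtz k (balayage_potential k \<mu>)"

definition R_crit :: "nat \<Rightarrow> real \<Rightarrow> real" where
  "R_crit N k = bessel_J_zero1 ((real N - 2) / 2) / k"

definition c_ball :: "nat \<Rightarrow> real \<Rightarrow> real \<Rightarrow> real" where
  "c_ball N k r = (2 * pi * r / k) powr (real N / 2) * bessel_J (real N / 2) (k * r)"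

end

theory Submission
  imports Defs
begin

text \<open>
  Everything is radial about \<open>z\<close>. In the variable \<open>t = k\<^sup>2 |x - z|\<^sup>2 / 4\<close> and with \<open>\<nu> = (N - 2) / 2\<close>, a radial
  function \<open>v\<close> satisfies \<open>(\<Delta> + k\<^sup>2) v = k\<^sup>2 (t v'' + (\<nu> + 1) v' + v)\<close>. The solutions of the homogeneous
  equation are an entire function \<open>entire_J \<nu>\<close>, coming from the Bessel function of the first kind,
  and a singular one \<open>radial_Y \<nu>\<close>, of which the Helmholtz kernel is a negative multiple.

  Existence. Fix \<open>t0\<close> not beyond the first zero of \<open>entire_J \<nu>\<close>, and let \<open>r\<close> be the corresponding
  radius. Let \<open>U\<close> be the potential of \<open>c \<delta>\<^sub>z\<close>, replace it inside the ball of radius \<open>r\<close> by a function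
  \<open>(a entire_J \<nu> - 1) / k\<^sup>2\<close>, on which \<open>- (\<Delta> + k\<^sup>2)\<close> is \<open>1\<close>, and ask that the result \<open>V\<close> be \<open>C\<^sup>1\<close> across the
  sphere. This is a linear system for \<open>a\<close> and \<open>c\<close> whose determinant is the Wronskian of \<open>entire_J \<nu>\<close>
  and \<open>radial_Y \<nu>\<close>; it gives \<open>c = c\<^sub>k(r)\<close>. Then \<open>- (\<Delta> + k\<^sup>2) V\<close> is Lebesgue measure on the ball
  (\<open>V_weak_equation\<close>). The quotient of the gap \<open>w = U - V\<close> by the positive solution \<open>f = entire_J \<nu>\<close> decreases
  to \<open>0\<close> at the sphere, again by a Wronskian computation, even if \<open>f\<close> vanishes there
  (\<open>excess_quotient_decreasing\<close>, \<open>excess_quotient_tendsto\<close>). Hence \<open>V \<le> U\<close>, and \<open>V\<close> belongs to the class.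

  Maximality and non-existence. Let \<open>T \<ge> 1\<close>, let \<open>u\<close> represent a member of the class of \<open>T c\<^sub>k(r) \<delta>\<^sub>z\<close> and
  put \<open>W = u - T V\<close>. Then \<open>W \<le> T w\<close>, and \<open>(\<Delta> + k\<^sup>2) W \<ge> T - 1\<close> in the ball. The maximum principle on the
  concentric ball of radius \<open>s < r\<close>, where \<open>f\<close> is positive, gives
  \<open>W \<le> (f / f(s)) (T w(s) - (T - 1) / k\<^sup>2) + (T - 1) / k\<^sup>2\<close> there (\<open>subsolution_bound\<close>). Now let \<open>s \<rightarrow> r\<close>.
  If \<open>T = 1\<close>, the bound tends to \<open>0\<close> because \<open>w / f\<close> does, so that \<open>u \<le> V\<close> and \<open>V\<close> is largest (\<open>V_largest\<close>).
  If \<open>T > 1\<close> and \<open>f\<close> vanishes on the sphere, then \<open>f(s) \<rightarrow> 0\<close> while \<open>w(s) / f(s) \<rightarrow> 0\<close>, the bound tends to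
  \<open>-\<infinity>\<close>, and \<open>u\<close> would be \<open>-\<infinity>\<close> on a ball: the class is empty (\<open>class_empty_beyond_critical\<close>). Finally
  \<open>c\<^sub>k\<close> increases from \<open>0\<close> on \<open>[0, R\<^sub>k]\<close>, because \<open>t\<^sup>\<nu>\<^sup>+\<^sup>1 entire_J (\<nu> + 1)\<close> has derivative
  \<open>t\<^sup>\<nu> entire_J \<nu>\<close>.

  The function \<open>W\<close> is only upper semicontinuous and its inequality is distributional, so the maximum
  principle is applied to convolutions of \<open>W\<close> with bump functions (\<open>weak_subsolution_upper_bound\<close>). The
  superlevel sets of a bump are balls, so that \<open>u\<close>, the limit of its means over balls, is recovered at
  every point.
\<close>

section \<open>The entire factor of the Bessel functions of the first kind\<close>

lemma rGamma_has_deriv: "(rGamma has_real_derivative deriv rGamma x) (at (x::real))"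
  using has_field_derivative_rGamma[of x UNIV] DERIV_deriv_iff_has_field_derivative by blast

text \<open>The functional equation \<open>z rGamma (z + 1) = rGamma z\<close> and its derivative show that \<open>|rGamma| + |rGamma'|\<close> does not
  grow from \<open>z\<close> to \<open>z + 1\<close> when \<open>z \<ge> 2\<close>; a compact interval of length one therefore controls the half-line
  to its right, and the same equations extend the bound downwards one unit at a time.\<close>

lemma rGamma_and_deriv_bounded:
  obtains C where "\<And>x::real. x \<ge> a \<Longrightarrow> \<bar>rGamma x\<bar> \<le> C" "\<And>x. x \<ge> a \<Longrightarrow> \<bar>deriv rGamma x\<bar> \<le> C"
proof -
  define D :: "real \<Rightarrow> real" where "D = deriv rGamma"
  have D: "(rGamma has_real_derivative D x) (at x)" for x
    unfolding D_def by (rule rGamma_has_deriv)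
  have D_rec: "D x = rGamma (x + 1) + x * D (x + 1)" for x
  proof -
    have "((\<lambda>x. x * rGamma (x + 1)) has_real_derivative (rGamma (x + 1) + x * D (x + 1))) (at x)"
      by (rule derivative_eq_intros DERIV_chain2[OF D] refl | simp)+
    moreover have "(\<lambda>x::real. x * rGamma (x + 1)) = rGamma"
      by (auto simp: rGamma_plus1)
    ultimately show ?thesis using D DERIV_unique by metis
  qed
  (* For x >= 2 the factors 1 / x and 1 / x^2 in the recursion add up to less than 1. *)
  have step: "\<bar>rGamma (x + 1)\<bar> + \<bar>D (x + 1)\<bar> \<le> \<bar>rGamma x\<bar> + \<bar>D x\<bar>" if "x \<ge> 2" for x
  proof -
    have 1: "x * rGamma (x + 1) = rGamma x" by (rule rGamma_plus1)
    have "x * D (x + 1) = D x - rGamma (x + 1)" using D_rec[of x] by simp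
    then have "x * \<bar>D (x + 1)\<bar> = \<bar>D x - rGamma (x + 1)\<bar>"
      using that by (metis abs_mult abs_of_nonneg order_trans zero_le_numeral)
    moreover have "x * \<bar>rGamma (x + 1)\<bar> = \<bar>rGamma x\<bar>"
      using that 1 by (metis abs_mult abs_of_nonneg order_trans zero_le_numeral)
    moreover have "2 * \<bar>D (x + 1)\<bar> \<le> x * \<bar>D (x + 1)\<bar>" "2 * \<bar>rGamma (x + 1)\<bar> \<le> x * \<bar>rGamma (x + 1)\<bar>"
      using that by (auto intro: mult_right_mono)
    ultimately show ?thesis by linarith
  qed
  have "continuous_on {2..3::real} Digamma"
    by (rule continuous_on_Polygamma) (auto elim!: nonpos_Ints_cases)
  then have "continuous_on {2..3::real} (\<lambda>x. - rGamma x * Digamma x)"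
    by (intro continuous_intros)
  then have "compact ((\<lambda>x. - rGamma x * Digamma x) ` {2..3::real})"
    by (rule compact_continuous_image) simp
  moreover have "compact (rGamma ` {2..3::real})"
    by (rule compact_continuous_image[OF continuous_on_rGamma]) simp
  ultimately obtain C1 C2 where C: "\<And>x. x \<in> {2..3::real} \<Longrightarrow> \<bar>- rGamma x * Digamma x\<bar> \<le> C1"
     "\<And>x. x \<in> {2..3::real} \<Longrightarrow> \<bar>rGamma x\<bar> \<le> C2"
    using compact_imp_bounded bounded_iff by (metis (no_types, lifting) imageI real_norm_def)
  have Dd: "D x = - rGamma x * Digamma x" if "x \<ge> 2" for x
  proof -
    have "x \<notin> \<int>\<^sub>\<le>\<^sub>0" using that by (auto elim!: nonpos_Ints_cases)
    then show ?thesis using has_field_derivative_rGamma_no_nonpos_int D DERIV_unique by blast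
  qed
  have base: "\<bar>rGamma x\<bar> + \<bar>D x\<bar> \<le> C1 + C2" if "real n + 2 \<le> x" "x \<le> real n + 3" for n x
    using that
  proof (induction n arbitrary: x)
    case 0
    then show ?case using C[of x] Dd[of x] by auto
  next
    case (Suc n)
    have "\<bar>rGamma (x - 1)\<bar> + \<bar>D (x - 1)\<bar> \<le> C1 + C2" using Suc by (intro Suc.IH) auto
    then show ?case using step[of "x - 1"] Suc.prems by auto
  qed
  have base': "\<bar>rGamma x\<bar> + \<bar>D x\<bar> \<le> C1 + C2" if "x \<ge> 2" for x
    using base[of "nat \<lfloor>x - 2\<rfloor>" x] that by (auto simp: of_nat_nat) linarith
  have down: "\<exists>C. \<forall>x\<ge>2 - real n. \<bar>rGamma x\<bar> + \<bar>D x\<bar> \<le> C" for n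
  proof (induction n)
    case 0
    then show ?case using base' by auto
  next
    case (Suc n)
    then obtain C where C: "\<And>x. x \<ge> 2 - real n \<Longrightarrow> \<bar>rGamma x\<bar> + \<bar>D x\<bar> \<le> C"
      by blast
    have "\<bar>rGamma x\<bar> + \<bar>D x\<bar> \<le> \<bar>C\<bar> + (2 + real n) * \<bar>C\<bar>" if x: "x \<ge> 2 - real (Suc n)" for x
    proof (cases "x \<ge> 2 - real n")
      case True
      then have "\<bar>rGamma x\<bar> + \<bar>D x\<bar> \<le> \<bar>C\<bar>" using C by force
      moreover have "0 \<le> (2 + real n) * \<bar>C\<bar>" by simp
      ultimately show ?thesis by linarith
    next
      case False
      then have ax: "\<bar>x\<bar> \<le> 2 + real n" using x by auto
      have 1: "rGamma x = x * rGamma (x + 1)" by (simp add: rGamma_plus1)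
      have C1: "\<bar>rGamma (x + 1)\<bar> + \<bar>D (x + 1)\<bar> \<le> \<bar>C\<bar>"
        using C[of "x + 1"] x by auto
      have "\<bar>rGamma x\<bar> + \<bar>D x\<bar> \<le> \<bar>x\<bar> * \<bar>rGamma (x + 1)\<bar> + (\<bar>rGamma (x + 1)\<bar> + \<bar>x\<bar> * \<bar>D (x + 1)\<bar>)"
        unfolding 1 by (subst D_rec) (use abs_triangle_ineq[of "rGamma (x+1)" "x * D (x+1)"] in \<open>auto simp: abs_mult\<close>)
      also have "\<dots> = \<bar>rGamma (x + 1)\<bar> + \<bar>x\<bar> * (\<bar>rGamma (x + 1)\<bar> + \<bar>D (x + 1)\<bar>)"
        by (simp add: algebra_simps)
      also have "\<dots> \<le> \<bar>C\<bar> + (2 + real n) * \<bar>C\<bar>"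
        by (intro add_mono mult_mono) (use ax C1 in auto)
      finally show ?thesis .
    qed
    then show ?case by blast
  qed
  obtain n :: nat where n: "2 - a \<le> real n" using real_arch_simple by blast
  obtain C where "\<And>x. x \<ge> 2 - real n \<Longrightarrow> \<bar>rGamma x\<bar> + \<bar>D x\<bar> \<le> C"
    using down by blast
  then have "\<bar>rGamma x\<bar> \<le> C" "\<bar>D x\<bar> \<le> C" if "x \<ge> a" for x
    using n that by (smt (verit) abs_ge_zero)+
  then show ?thesis using that unfolding D_def by blast
qed

text \<open>\<open>J\<^sub>\<nu>(x) = (x / 2)\<^sup>\<nu> entire_J \<nu> (x\<^sup>2 / 4)\<close>; up to the sign of the argument this is the Bessel-Clifford function.
  It is entire in \<open>t\<close> and differentiable in the order, also at integers, which the limit defining \<open>Y\<close>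
  at integer orders requires.\<close>

definition entire_J :: "real \<Rightarrow> real \<Rightarrow> real" where
  "entire_J \<mu> t = (\<Sum>j. rGamma (real j + \<mu> + 1) / fact j * (- t) ^ j)"

lemma summable_bounded_exp_series:
  fixes a :: "nat \<Rightarrow> real"
  assumes "\<And>j. \<bar>a j\<bar> \<le> C"
  shows "summable (\<lambda>j. a j / fact j * t ^ j)"
proof (rule summable_comparison_test)
  show "summable (\<lambda>j. C * (\<bar>t\<bar> ^ j / fact j))"
    using summable_exp[of "\<bar>t\<bar>"] by (intro summable_mult) (simp add: divide_inverse mult.commute)
  have "norm (a j / fact j * t ^ j) \<le> C * (\<bar>t\<bar> ^ j / fact j)" for j
    using mult_right_mono[OF assms[of j], of "\<bar>t\<bar> ^ j / fact j"] by (simp add: abs_mult power_abs)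
  then show "\<exists>N. \<forall>n\<ge>N. norm (a n / fact n * t ^ n) \<le> C * (\<bar>t\<bar> ^ n / fact n)"
    by blast
qed

lemma rGamma_shift_bounded: "\<exists>C. \<forall>j. \<bar>rGamma (real j + \<mu> + 1)\<bar> \<le> C"
proof -
  obtain C where "\<And>x::real. x \<ge> \<mu> + 1 \<Longrightarrow> \<bar>rGamma x\<bar> \<le> C"
    using rGamma_and_deriv_bounded[of "\<mu> + 1"] by metis
  then show ?thesis by (intro exI[of _ C]) auto
qed

lemma summable_entire_J: "summable (\<lambda>j. rGamma (real j + \<mu> + 1) / fact j * t ^ j)"
  using summable_bounded_exp_series[of "\<lambda>j. rGamma (real j + \<mu> + 1)"] rGamma_shift_bounded[of \<mu>]
    by blast

lemma bounded_exp_series_has_derivative: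
  fixes a :: "nat \<Rightarrow> real" and t :: real
  assumes "\<And>j. \<bar>a j\<bar> \<le> C"
  shows "((\<lambda>t. \<Sum>j. a j / fact j * (- t) ^ j) has_real_derivative
     - (\<Sum>j. a (Suc j) / fact j * (- t) ^ j)) (at t within S)"
proof -
  define F where "F s = (\<Sum>j. a j / fact j * s ^ j)" for s
  have "(F has_real_derivative (\<Sum>j. diffs (\<lambda>j. a j / fact j) j * (- t) ^ j)) (at (- t))"
    unfolding F_def[abs_def]
    by (intro termdiffs_strong_converges_everywhere summable_bounded_exp_series[of _ C] assms)
  moreover have "diffs (\<lambda>j. a j / fact j) j = a (Suc j) / fact j" for j
    by (simp add: diffs_def fact_Suc field_simps del: of_nat_Suc)
  ultimately have "((\<lambda>t. F (- t)) has_real_derivative (\<Sum>j. a (Suc j) / fact j * (- t) ^ j) * - 1) (at t)"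
    by (intro DERIV_chain2[of F]) (auto intro!: derivative_eq_intros)
  then show ?thesis unfolding F_def by (auto intro: has_field_derivative_at_within)
qed

lemma entire_J_has_derivative: "(entire_J \<mu> has_real_derivative - entire_J (\<mu> + 1) t) (at t within S)"
proof -
  obtain C where "\<And>j. \<bar>rGamma (real j + \<mu> + 1)\<bar> \<le> C" using rGamma_shift_bounded by blast
  from bounded_exp_series_has_derivative[of "\<lambda>j. rGamma (real j + \<mu> + 1)", OF this, where t=t and S=S] show ?thesis
    by (simp add: entire_J_def[abs_def] algebra_simps)
qed

lemmas entire_J_has_derivative' [derivative_intros] = DERIV_chain2[OF entire_J_has_derivative]

lemma entire_J_recurrence: "entire_J (\<mu> - 1) t = \<mu> * entire_J \<mu> t - t * entire_J (\<mu> + 1) t"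
proof -
  let ?a = "\<lambda>j. rGamma (real j + \<mu> + 1) / fact j * (- t) ^ j"
  have "(\<lambda>j. real j * ?a j) sums (- t * entire_J (\<mu> + 1) t)"
  proof -
    have "(\<lambda>j. - t * (rGamma (real j + (\<mu> + 1) + 1) / fact j * (- t) ^ j)) sums (- t * entire_J (\<mu> + 1) t)"
      unfolding entire_J_def by (intro sums_mult summable_sums summable_entire_J)
    moreover have "- t * (rGamma (real j + (\<mu> + 1) + 1) / fact j * (- t) ^ j) = real (Suc j) * ?a (Suc j)" for j
      by (simp add: field_simps fact_Suc del: of_nat_Suc) (simp add: algebra_simps)
    ultimately have "(\<lambda>j. real (Suc j) * ?a (Suc j)) sums (- t * entire_J (\<mu> + 1) t)"
      by (simp only:)
    then show ?thesis using sums_Suc_iff[of "\<lambda>j. real j * ?a j"] by simp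
  qed
  moreover have "(\<lambda>j. \<mu> * ?a j) sums (\<mu> * entire_J \<mu> t)"
    unfolding entire_J_def by (intro sums_mult summable_sums summable_entire_J)
  ultimately have "(\<lambda>j. real j * ?a j + \<mu> * ?a j) sums (- t * entire_J (\<mu> + 1) t + \<mu> * entire_J \<mu> t)"
    by (rule sums_add)
  moreover have "real j * ?a j + \<mu> * ?a j = rGamma (real j + (\<mu> - 1) + 1) / fact j * (- t) ^ j" for j
  proof -
    have "real j * ?a j + \<mu> * ?a j = (real j + \<mu>) * rGamma (real j + \<mu> + 1) / fact j * (- t) ^ j"
      by (simp add: algebra_simps add_divide_distrib)
    then show ?thesis by (simp only: rGamma_plus1) simp
  qed
  ultimately show ?thesis unfolding entire_J_def[of "\<mu> - 1"] by (simp add: sums_iff)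
qed

lemma entire_J_zero: "entire_J \<mu> 0 = rGamma (\<mu> + 1)"
proof -
  have "(\<lambda>j. rGamma (real j + \<mu> + 1) / fact j * 0 ^ j) sums (rGamma (real 0 + \<mu> + 1) / fact 0)"
    by (rule powser_sums_zero)
  then show ?thesis by (simp add: entire_J_def sums_iff)
qed

lemma continuous_on_entire_J [continuous_intros]:
  "continuous_on S f \<Longrightarrow> continuous_on S (\<lambda>x. entire_J \<mu> (f x))"
  by (rule continuous_on_compose2[of UNIV "entire_J \<mu>"])
     (auto intro: DERIV_continuous_on entire_J_has_derivative)

definition entire_J_order_deriv :: "real \<Rightarrow> real \<Rightarrow> real" where
  "entire_J_order_deriv \<mu> t = (\<Sum>j. deriv rGamma (real j + \<mu> + 1) / fact j * (- t) ^ j)"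

lemma entire_J_has_order_derivative:
  "((\<lambda>\<mu>. entire_J \<mu> t) has_real_derivative entire_J_order_deriv \<mu> t) (at \<mu>)"
proof -
  let ?S = "{\<mu> - 1<..<\<mu> + 1}"
  let ?D = "deriv rGamma :: real \<Rightarrow> real"
  obtain C where C: "\<And>x. x \<ge> \<mu> \<Longrightarrow> \<bar>?D x\<bar> \<le> C"
    using rGamma_and_deriv_bounded[of \<mu>] by metis
  have "uniformly_convergent_on ?S (\<lambda>n x. \<Sum>j<n. ?D (real j + x + 1) / fact j * (- t) ^ j)"
  proof (rule Weierstrass_m_test')
    show "summable (\<lambda>j. C * (\<bar>t\<bar> ^ j / fact j))"
      using summable_exp[of "\<bar>t\<bar>"] by (intro summable_mult) (simp add: divide_inverse mult.commute)
    show "norm (?D (real j + x + 1) / fact j * (- t) ^ j) \<le> C * (\<bar>t\<bar> ^ j / fact j)" if "x \<in> ?S" for j x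
      using mult_right_mono[OF C[of "real j + x + 1"], of "\<bar>t\<bar> ^ j / fact j"] that
      by (simp add: abs_mult power_abs)
  qed
  then show ?thesis unfolding entire_J_def entire_J_order_deriv_def
  proof (rule has_field_derivative_series'(2)[rotated 2])
    show "convex ?S" by simp
    show "\<mu> \<in> ?S" "\<mu> \<in> interior ?S" by auto
    show "summable (\<lambda>n. rGamma (real n + \<mu> + 1) / fact n * (- t) ^ n)" by (rule summable_entire_J)
    show "((\<lambda>\<mu>. rGamma (real n + \<mu> + 1) / fact n * (- t) ^ n) has_real_derivative
           ?D (real n + x + 1) / fact n * (- t) ^ n) (at x within ?S)" for n x
    proof -
      have "((\<lambda>\<mu>. rGamma (real n + \<mu> + 1)) has_real_derivative ?D (real n + x + 1) * 1) (at x)"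
        by (rule DERIV_chain2[OF rGamma_has_deriv]) (auto intro!: derivative_eq_intros)
      from DERIV_cmult_right[OF DERIV_cdivide[OF this, of "fact n"], of "(- t) ^ n"]
      show ?thesis by (simp add: has_field_derivative_at_within)
    qed
  qed
qed

lemma entire_J_order_deriv_has_derivative:
  "(entire_J_order_deriv \<mu> has_real_derivative - entire_J_order_deriv (\<mu> + 1) t) (at t within S)"
proof -
  obtain C where C: "\<And>x::real. x \<ge> \<mu> + 1 \<Longrightarrow> \<bar>deriv rGamma x\<bar> \<le> C"
    using rGamma_and_deriv_bounded[of "\<mu> + 1"] by metis
  have "\<bar>deriv rGamma (real j + \<mu> + 1)\<bar> \<le> C" for j by (rule C) simp
  from bounded_exp_series_has_derivative[of "\<lambda>j. deriv rGamma (real j + \<mu> + 1)", OF this, where t=t and S=S] show ?thesis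
    by (simp add: entire_J_order_deriv_def[abs_def] algebra_simps)
qed

lemmas entire_J_has_order_derivative' = DERIV_chain2[OF entire_J_has_order_derivative]

lemma rGamma_reflection_real: "rGamma (1 + x) * rGamma (- x :: real) = - sin (pi * x) / pi"
proof -
  have "complex_of_real (rGamma (- x) * rGamma (1 - (- x))) = complex_of_real (sin (pi * (- x)) / pi)"
    using rGamma_reflection_complex[of "of_real (- x)"]
    by (simp only: of_real_mult rGamma_complex_of_real[symmetric] of_real_diff of_real_1 of_real_minus
        of_real_divide sin_of_real[symmetric])
  then have "rGamma (- x) * rGamma (1 - (- x)) = sin (pi * (- x)) / pi" by (simp only: of_real_eq_iff)
  then show ?thesis by (simp add: mult.commute)
qed

text \<open>By the recurrences the left-hand side has derivative \<open>0\<close> in \<open>t\<close>; at \<open>t = 0\<close> it is the reflection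
  formula of the Gamma function. The identity can be differentiated in the order, and its derivative in \<open>\<mu>\<close> at an
  integer yields the Wronskian for Bessel functions \<open>Y\<close> of integer order.\<close>

lemma entire_J_wronskian:
  "t * entire_J (\<mu> + 1) t * entire_J (- \<mu>) t + entire_J \<mu> t * entire_J (- \<mu> - 1) t = - sin (pi * \<mu>) / pi"
proof -
  let ?W = "\<lambda>t. t * entire_J (\<mu> + 1) t * entire_J (- \<mu>) t + entire_J \<mu> t * entire_J (- \<mu> - 1) t"
  have d: "(?W has_real_derivative 0) (at t)" for t
  proof -
    have r1: "entire_J \<mu> t = (\<mu> + 1) * entire_J (\<mu> + 1) t - t * entire_J (\<mu> + 1 + 1) t"
      using entire_J_recurrence[of "\<mu> + 1" t] by (simp add: add.commute)
    have r2: "entire_J (- \<mu> - 1) t = - \<mu> * entire_J (- \<mu>) t - t * entire_J (- \<mu> + 1) t"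
      by (rule entire_J_recurrence)
    have e: "- \<mu> - 1 + 1 = - \<mu>" by simp
    show ?thesis
      by (rule derivative_eq_intros refl)+ (unfold e r1 r2, simp add: algebra_simps)
  qed
  have "?W t = ?W 0" using DERIV_isconst_all[of ?W] d by blast
  then show ?thesis by (simp add: entire_J_zero rGamma_reflection_real add.commute)
qed

text \<open>The first \<open>n\<close> coefficients vanish at the poles of the Gamma function. This is \<open>J\<^sub>-\<^sub>n = (-1)\<^sup>n J\<^sub>n\<close>.\<close>

lemma entire_J_neg_int: "entire_J (- real n) t = (- t) ^ n * entire_J (real n) t"
proof -
  let ?a = "\<lambda>j. rGamma (real j + (- real n) + 1) / fact j * (- t) ^ j"
  have z: "?a j = 0" if "j < n" for j
  proof -
    have "real j + (- real n) + 1 = - real (n - j - 1)" using that by (simp add: of_nat_diff)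
    then have "rGamma (real j + (- real n) + 1) = 0"
      by (metis minus_of_nat_in_nonpos_Ints rGamma_eq_zero_iff)
    then show ?thesis by (simp only: div_0 mult_zero_left)
  qed
  have 1: "(\<Sum>j. ?a j) = (\<Sum>j. ?a (j + n))"
  proof -
    have "(\<Sum>i<n. ?a i) = 0" using z by (intro sum.neutral) blast
    then show ?thesis using suminf_split_initial_segment[OF summable_entire_J, of "- real n" "-t" n]
      by (simp only: add_0_right)
  qed
  have 2: "?a (j + n) = (- t) ^ n * (rGamma (real j + real n + 1) / fact j * (- t) ^ j)" for j
  proof -
    have "rGamma (real j + 1) = inverse (fact j)" using rGamma_of_int[of "int j + 1", where 'a=real] by simp
    moreover have "rGamma (real j + real n + 1) = inverse (fact (j + n))"
      using rGamma_of_int[of "int j + int n + 1", where 'a=real] by (simp add: nat_add_distrib)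
    ultimately show ?thesis by (simp add: power_add field_simps)
  qed
  have "(\<Sum>j. (- t) ^ n * (rGamma (real j + real n + 1) / fact j * (- t) ^ j)) = (- t) ^ n * entire_J (real n) t"
    unfolding entire_J_def by (intro suminf_mult summable_entire_J)
  then show ?thesis unfolding entire_J_def[of "- real n"] 1 2 .
qed

section \<open>The singular radial solution\<close>

text \<open>\<open>Y\<^sub>\<nu>\<close> normalised like \<open>entire_J\<close>, so that \<open>Y\<^sub>\<nu>(x) = (x / 2)\<^sup>\<nu> radial_Y \<nu> (x\<^sup>2 / 4)\<close> for \<open>x > 0\<close>.\<close>

definition radial_Y :: "real \<Rightarrow> real \<Rightarrow> real" where
  "radial_Y \<nu> t = t powr (- \<nu> / 2) * bessel_Y \<nu> (2 * sqrt t)"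

lemma bessel_J_eq_entire_J:
  assumes "t > 0"
  shows "bessel_J \<nu> (2 * sqrt t) = t powr (\<nu> / 2) * entire_J \<nu> t"
proof -
  have "sqrt t powr \<nu> = t powr (\<nu> / 2)"
    using assms by (simp add: powr_half_sqrt[symmetric] powr_powr)
  moreover have "(-1) ^ j * rGamma (real j + \<nu> + 1) / fact j * sqrt t ^ (2 * j)
       = rGamma (real j + \<nu> + 1) / fact j * (- t) ^ j" for j
  proof -
    have "(- t) ^ j = (-1) ^ j * sqrt t ^ (2 * j)" using assms by (simp add: power_mult power_minus[of t])
    then show ?thesis by (simp only:) simp
  qed
  moreover have "2 * sqrt t / 2 = sqrt t" by simp
  ultimately show ?thesis unfolding bessel_J_def entire_J_def by (simp only:)
qed

lemma radial_Y_nonint: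
  assumes "t > 0" "\<nu> \<notin> \<int>"
  shows "radial_Y \<nu> t = (entire_J \<nu> t * cos (\<nu> * pi) - t powr (- \<nu>) * entire_J (- \<nu>) t) / sin (\<nu> * pi)"
proof -
  have "t powr (- \<nu> / 2) * t powr (\<nu> / 2) = 1" "t powr (- \<nu> / 2) * t powr (- \<nu> / 2) = t powr (- \<nu>)"
    using assms by (simp_all add: powr_add[symmetric])
  then show ?thesis using assms
    by (simp add: radial_Y_def bessel_Y_def bessel_J_eq_entire_J right_diff_distrib diff_divide_distrib
        mult.assoc[symmetric])
qed


text \<open>At an integer both the numerator and the denominator of the formula defining \<open>Y\<close> vanish, so the limit is the
  quotient of their derivatives in the order.\<close>

lemma radial_Y_nat:
  assumes t: "t > 0"
  shows "radial_Y (real n) t = (entire_J_order_deriv (real n) t +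
    (-1) ^ n / t ^ n * (ln t * entire_J (- real n) t + entire_J_order_deriv (- real n) t)) / pi"
proof -
  define H where "H \<mu> = entire_J_order_deriv \<mu> t" for \<mu>
  have H: "((\<lambda>\<mu>. entire_J \<mu> t) has_real_derivative H \<mu>) (at \<mu>)" for \<mu>
    unfolding H_def by (rule entire_J_has_order_derivative)
  define F where "F \<mu> = entire_J \<mu> t * cos (\<mu> * pi) - t powr (- \<mu>) * entire_J (- \<mu>) t" for \<mu>
  define L where "L = H (real n) * (-1) ^ n + 1 / t ^ n * (ln t * entire_J (- real n) t + H (- real n))"
  have p: "t powr (- real n) = 1 / t ^ n" using t by (simp add: powr_minus powr_realpow divide_inverse)
  have "(F has_real_derivative L) (at (real n))"
  proof -
    have 0: "((\<lambda>\<mu>. cos (\<mu> * pi)) has_real_derivative 0) (at (real n))"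
      by (rule DERIV_cong[OF DERIV_chain2[OF DERIV_cos DERIV_cmult_right[OF DERIV_ident]]]) (simp add: sin_npi)
    have 1: "((\<lambda>\<mu>. entire_J \<mu> t * cos (\<mu> * pi)) has_real_derivative H (real n) * (-1) ^ n) (at (real n))"
      by (rule DERIV_cong[OF DERIV_mult[OF H 0]]) (simp add: cos_npi)
    have 2: "((\<lambda>\<mu>. entire_J (- \<mu>) t) has_real_derivative H (- real n) * - 1) (at (real n))"
      by (rule DERIV_chain2[OF H]) (rule derivative_eq_intros refl)+
    have 3: "((\<lambda>\<mu>. t powr (- \<mu>)) has_real_derivative - ln t * (1 / t ^ n)) (at (real n))"
    proof -
      have "((\<lambda>\<mu>. exp (- \<mu> * ln t)) has_real_derivative exp (- real n * ln t) * (- 1 * ln t)) (at (real n))"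
        by (rule DERIV_chain2[OF DERIV_exp DERIV_cmult_right[OF DERIV_minus[OF DERIV_ident]]])
      moreover have "exp (- \<mu> * ln t) = t powr (- \<mu>)" for \<mu> using t by (simp add: powr_def)
      ultimately show ?thesis by (simp only: p) (simp add: mult.commute)
    qed
    have "H (real n) * (-1) ^ n - ((- ln t * (1 / t ^ n)) * entire_J (- real n) t + (H (- real n) * - 1) * t powr (- real n)) = L"
      unfolding L_def p by (simp add: ring_distribs)
    with DERIV_diff[OF 1 DERIV_mult[OF 3 2]] show ?thesis unfolding F_def[abs_def] by (simp only:)
  qed
  moreover have "F (real n) = 0"
  proof -
    have "(- t) ^ n = t ^ n * (-1) ^ n" by (simp add: power_minus[of t] mult.commute)
    then show ?thesis using t by (simp add: F_def entire_J_neg_int cos_npi p)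
  qed
  ultimately have F: "((\<lambda>\<mu>. F \<mu> / (\<mu> - real n)) \<longlongrightarrow> L) (at (real n))"
    by (simp add: has_field_derivative_iff)
  have "((\<lambda>\<mu>. sin (\<mu> * pi)) has_real_derivative (-1) ^ n * pi) (at (real n))"
    by (rule derivative_eq_intros refl)+ (simp add: cos_npi)
  then have S: "((\<lambda>\<mu>. sin (\<mu> * pi) / (\<mu> - real n)) \<longlongrightarrow> (-1) ^ n * pi) (at (real n))"
    by (simp add: has_field_derivative_iff sin_npi)
  have "((\<lambda>\<mu>. t powr (\<mu> / 2) * ((F \<mu> / (\<mu> - real n)) / (sin (\<mu> * pi) / (\<mu> - real n)))) \<longlongrightarrow>
       t powr (real n / 2) * (L / ((-1) ^ n * pi))) (at (real n))"
  proof (rule tendsto_mult[OF _ tendsto_divide[OF F S]])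
    have "isCont (\<lambda>\<mu>. t powr (\<mu> / 2)) (real n)" using t by (intro continuous_intros) auto
    then show "((\<lambda>\<mu>. t powr (\<mu> / 2)) \<longlongrightarrow> t powr (real n / 2)) (at (real n))"
      by (simp add: isCont_def)
  qed simp
  then have "((\<lambda>\<mu>. (bessel_J \<mu> (2 * sqrt t) * cos (\<mu> * pi) - bessel_J (- \<mu>) (2 * sqrt t)) / sin (\<mu> * pi))
       \<longlongrightarrow> t powr (real n / 2) * (L / ((-1) ^ n * pi))) (at (real n))"
  proof (rule Lim_transform_eventually)
    show "\<forall>\<^sub>F \<mu> in at (real n). t powr (\<mu> / 2) * ((F \<mu> / (\<mu> - real n)) / (sin (\<mu> * pi) / (\<mu> - real n)))
       = (bessel_J \<mu> (2 * sqrt t) * cos (\<mu> * pi) - bessel_J (- \<mu>) (2 * sqrt t)) / sin (\<mu> * pi)"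
      unfolding eventually_at_filter
    proof (intro always_eventually allI impI)
      fix \<mu> :: real assume "\<mu> \<noteq> real n"
      then have "(F \<mu> / (\<mu> - real n)) / (sin (\<mu> * pi) / (\<mu> - real n)) = F \<mu> / sin (\<mu> * pi)"
        by simp
      moreover have "t powr (- \<mu> / 2) = t powr (\<mu> / 2) * t powr (- \<mu>)"
        by (simp add: powr_add[symmetric])
      then have "bessel_J \<mu> (2 * sqrt t) * cos (\<mu> * pi) - bessel_J (- \<mu>) (2 * sqrt t) = t powr (\<mu> / 2) * F \<mu>"
        unfolding bessel_J_eq_entire_J[OF t] F_def by (simp only: right_diff_distrib mult.assoc)
      ultimately show "t powr (\<mu> / 2) * ((F \<mu> / (\<mu> - real n)) / (sin (\<mu> * pi) / (\<mu> - real n)))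
       = (bessel_J \<mu> (2 * sqrt t) * cos (\<mu> * pi) - bessel_J (- \<mu>) (2 * sqrt t)) / sin (\<mu> * pi)"
        by (simp only: times_divide_eq_right)
    qed
  qed
  then have "bessel_Y (real n) (2 * sqrt t) = t powr (real n / 2) * (L / ((-1) ^ n * pi))"
    unfolding bessel_Y_def Let_def using tendsto_Lim[OF trivial_limit_at] by simp
  moreover have "t powr (- real n / 2) * t powr (real n / 2) = 1"
    using t by (simp add: powr_add[symmetric])
  ultimately have "radial_Y (real n) t = L / ((-1) ^ n * pi)"
    by (simp add: radial_Y_def mult.assoc[symmetric])
  also have "\<dots> = (H (real n) + (-1) ^ n / t ^ n * (ln t * entire_J (- real n) t + H (- real n))) / pi"
    by (cases "even n") (simp_all add: L_def diff_divide_distrib)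
  finally show ?thesis by (simp add: H_def)
qed

text \<open>The derivative in the order of \<open>entire_J_recurrence\<close>.\<close>

lemma entire_J_order_deriv_recurrence:
  "entire_J_order_deriv (\<mu> - 1) t
     = entire_J \<mu> t + \<mu> * entire_J_order_deriv \<mu> t - t * entire_J_order_deriv (\<mu> + 1) t" (is "?H (\<mu> - 1) = _")
proof (rule DERIV_unique)
  have shift: "((\<lambda>\<mu>. entire_J (\<mu> + c) t) has_real_derivative ?H (\<mu> + c)) (at \<mu>)" for c
    using DERIV_chain2[OF entire_J_has_order_derivative[of t "\<mu> + c"] DERIV_add[OF DERIV_ident DERIV_const]]
      by simp
  from shift[of "-1"] show "((\<lambda>\<mu>. entire_J (\<mu> - 1) t) has_real_derivative ?H (\<mu> - 1)) (at \<mu>)"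
    by simp
  have "(\<lambda>\<mu>. entire_J (\<mu> - 1) t) = (\<lambda>\<mu>. \<mu> * entire_J \<mu> t - t * entire_J (\<mu> + 1) t)"
    by (rule ext) (rule entire_J_recurrence)
  then show "((\<lambda>\<mu>. entire_J (\<mu> - 1) t) has_real_derivative entire_J \<mu> t + \<mu> * ?H \<mu> - t * ?H (\<mu> + 1)) (at \<mu>)"
    using DERIV_diff[OF DERIV_mult[OF DERIV_ident entire_J_has_order_derivative] DERIV_cmult[OF shift[of 1], of t]]
    by (simp only:) (simp add: mult.commute add.commute)
qed

lemma real_nonneg_nat_or_nonint_cases:
  assumes "0 \<le> (\<nu>::real)"
  obtains n where "\<nu> = real n" | "\<nu> \<notin> \<int>"
proof (cases "\<nu> \<in> \<int>")
  case True
  from True obtain i where "\<nu> = of_int i" by (rule Ints_cases)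
  with assms have "\<nu> = real (nat i)" by simp
  then show ?thesis by (rule that(1))
next
  case False
  then show ?thesis by (rule that(2))
qed


text \<open>For a non-integer order this is read off the two terms of \<open>radial_Y\<close>; for an integer order off the
  logarithmic formula, where the recurrences at the orders \<open>- n\<close> absorb the derivatives of \<open>ln t\<close> and \<open>t\<^sup>-\<^sup>n\<close>.
  Like \<open>entire_J\<close>, \<open>radial_Y\<close> thus satisfies the first of the two relations that make up the radial equation;
  the second is \<open>radial_Y_recurrence\<close>.\<close>

lemma radial_Y_has_derivative:
  assumes t: "t > 0" and \<nu>: "0 \<le> \<nu>"
  shows "(radial_Y \<nu> has_real_derivative - radial_Y (\<nu> + 1) t) (at t within S)"
proof (rule has_field_derivative_at_within)
  have cong: "(radial_Y \<nu> has_real_derivative - radial_Y (\<nu> + 1) t) (at t)"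
    if "\<And>s. s > 0 \<Longrightarrow> f s = radial_Y \<nu> s" "(f has_real_derivative - radial_Y (\<nu> + 1) t) (at t)" for f
    by (rule has_field_derivative_transform_within_open[OF that(2), of "{0<..}"]) (use that t in auto)
  show "(radial_Y \<nu> has_real_derivative - radial_Y (\<nu> + 1) t) (at t)"
    using \<nu>
  proof (cases rule: real_nonneg_nat_or_nonint_cases)
    case (1 n)
    let ?H = entire_J_order_deriv
    have r1: "entire_J (- real n - 1) t = - real n * entire_J (- real n) t - t * entire_J (- real n + 1) t"
      by (rule entire_J_recurrence)
    have r2: "?H (- real n - 1) t = entire_J (- real n) t - real n * ?H (- real n) t - t * ?H (- real n + 1) t"
      using entire_J_order_deriv_recurrence[of "- real n" t] by simp
    have e: "- real (Suc n) = - real n - 1" "real (Suc n) = real n + 1" "- (real n + 1) = - real n - 1" by auto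
    have eq': "radial_Y (real n + 1) t = (?H (real n + 1) t - (-1) ^ n / (t * t ^ n) *
        (ln t * (- real n * entire_J (- real n) t - t * entire_J (- real n + 1) t)
         + (entire_J (- real n) t - real n * ?H (- real n) t - t * ?H (- real n + 1) t))) / pi"
      using radial_Y_nat[OF t, of "Suc n"] unfolding e r1 r2 by (simp add: mult.commute)
    have D1: "((\<lambda>t. (-1) ^ n / t ^ n) has_real_derivative - real n * (-1) ^ n / (t * t ^ n)) (at t)"
    proof -
      have "((\<lambda>t. t powr (- real n)) has_real_derivative - real n * t powr (- real n - 1)) (at t)"
        using t by (auto intro!: derivative_eq_intros)
      then have "((\<lambda>t. t powr (- real n)) has_real_derivative - real n / (t * t ^ n)) (at t)"
        using t by (simp add: powr_diff powr_minus powr_realpow field_simps)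
      from has_field_derivative_transform_within_open[OF DERIV_cmult[OF this, of "(-1) ^ n"], of "{0<..}" "\<lambda>t. (-1) ^ n / t ^ n"]
      show ?thesis using t by (simp add: powr_minus powr_realpow field_simps)
    qed
    have D2: "((\<lambda>t. ln t * entire_J (- real n) t) has_real_derivative
       entire_J (- real n) t / t - ln t * entire_J (- real n + 1) t) (at t)"
      by (rule DERIV_cong[OF DERIV_mult[OF DERIV_ln_divide[OF t] entire_J_has_derivative]]) simp
    have "((\<lambda>t. (?H (real n) t + (-1) ^ n / t ^ n * (ln t * entire_J (- real n) t + ?H (- real n) t)) / pi)
       has_real_derivative - radial_Y (\<nu> + 1) t) (at t)"
      unfolding 1 eq'
      by (rule DERIV_cong[OF DERIV_cdivide[OF DERIV_add[OF entire_J_order_deriv_has_derivative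
            DERIV_mult[OF D1 DERIV_add[OF D2 entire_J_order_deriv_has_derivative]]]]])
         (use t in \<open>simp add: divide_simps, simp add: algebra_simps\<close>)
    then show ?thesis
    proof (rule cong[rotated])
      show "(?H (real n) s + (-1) ^ n / s ^ n * (ln s * entire_J (- real n) s + ?H (- real n) s)) / pi = radial_Y \<nu> s"
        if "s > 0" for s unfolding 1 by (rule radial_Y_nat[OF that, symmetric])
    qed
  next
    case 2
    then have 3: "\<nu> + 1 \<notin> \<int>" using Ints_diff[OF _ Ints_1, of "\<nu> + 1"] by auto
    have s: "sin (\<nu> * pi) \<noteq> 0" using 2 sin_times_pi_eq_0[of \<nu>] by auto
    have r1: "entire_J (- \<nu> - 1) t = - \<nu> * entire_J (- \<nu>) t - t * entire_J (- \<nu> + 1) t"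
      by (rule entire_J_recurrence)
    have sc: "sin ((\<nu> + 1) * pi) = - sin (\<nu> * pi)" "cos ((\<nu> + 1) * pi) = - cos (\<nu> * pi)"
      by (simp_all add: distrib_right)
    have e: "- (\<nu> + 1) = - \<nu> - 1" by simp
    have pw: "t powr (- \<nu> - 1) = t powr (- \<nu>) / t" using t by (simp add: powr_diff)
    have D1: "((\<lambda>t. t powr (- \<nu>)) has_real_derivative - \<nu> * (t powr (- \<nu>) / t)) (at t)"
      using t pw by (auto intro!: derivative_eq_intros)
    have "((\<lambda>t. (entire_J \<nu> t * cos (\<nu> * pi) - t powr (- \<nu>) * entire_J (- \<nu>) t) / sin (\<nu> * pi))
       has_real_derivative - radial_Y (\<nu> + 1) t) (at t)"
      unfolding radial_Y_nonint[OF t 3] sc e r1 pw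
      by (rule DERIV_cong[OF DERIV_cdivide[OF DERIV_diff[OF DERIV_cmult_right[OF entire_J_has_derivative]
             DERIV_mult[OF D1 entire_J_has_derivative]]]])
         (use t s in \<open>simp add: divide_simps, simp add: algebra_simps\<close>)
    then show ?thesis
    proof (rule cong[rotated])
      show "(entire_J \<nu> s * cos (\<nu> * pi) - s powr (- \<nu>) * entire_J (- \<nu>) s) / sin (\<nu> * pi) = radial_Y \<nu> s"
        if "s > 0" for s by (rule radial_Y_nonint[OF that 2, symmetric])
    qed
  qed
qed


lemma radial_Y_recurrence:
  assumes t: "t > 0" and \<nu>: "0 \<le> \<nu>"
  shows "t * radial_Y (\<nu> + 2) t = (\<nu> + 1) * radial_Y (\<nu> + 1) t - radial_Y \<nu> t"
  using \<nu>
proof (cases rule: real_nonneg_nat_or_nonint_cases)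
  case (1 n)
  let ?H = entire_J_order_deriv
  note eq = radial_Y_nat[OF t]
  have r1: "entire_J (real n) t = (real n + 1) * entire_J (real n + 1) t - t * entire_J (real n + 2) t"
    using entire_J_recurrence[of "real n + 1" t] by (simp add: algebra_simps)
  have r2: "?H (real n) t = entire_J (real n + 1) t + (real n + 1) * ?H (real n + 1) t - t * ?H (real n + 2) t"
    using entire_J_order_deriv_recurrence[of "real n + 1" t] by (simp add: algebra_simps)
  have r3: "entire_J (- real n - 2) t = - (real n + 1) * entire_J (- real n - 1) t - t * entire_J (- real n) t"
    using entire_J_recurrence[of "- real n - 1" t] by (simp add: algebra_simps)
  have r4: "?H (- real n - 2) t = entire_J (- real n - 1) t - (real n + 1) * ?H (- real n - 1) t - t * ?H (- real n) t"
    using entire_J_order_deriv_recurrence[of "- real n - 1" t] by (simp add: algebra_simps)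
  have n1: "entire_J (- real n - 1) t = - t * (- t) ^ n * entire_J (real n + 1) t"
    using entire_J_neg_int[of "Suc n" t] by (simp add: add.commute minus_diff_commute mult.assoc)
  have m: "(- t) ^ n = (-1) ^ n * t ^ n" by (rule power_minus)
  have sq: "(-1) ^ n * ((-1) ^ n * x) = (x::real)" for x by (cases "even n") auto
  have e: "real (Suc n) = real n + 1" "real (Suc (Suc n)) = real n + 2" "- (real n + 1) = - real n - 1"
    "- (real n + 2) = - real n - 2" by auto
  have E0: "pi * t ^ n * radial_Y (real n) t
      = t ^ n * ?H (real n) t + (-1) ^ n * (ln t * entire_J (- real n) t + ?H (- real n) t)"
    using eq[of n] t by (simp add: field_simps)
  have E1: "pi * (t * t ^ n) * radial_Y (real n + 1) t
      = t * t ^ n * ?H (real n + 1) t - (-1) ^ n * (ln t * entire_J (- real n - 1) t + ?H (- real n - 1) t)"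
    using eq[of "Suc n"] t unfolding e by (simp add: field_simps)
  have E2: "pi * (t * t * t ^ n) * radial_Y (real n + 2) t
      = t * t * t ^ n * ?H (real n + 2) t + (-1) ^ n * (ln t * entire_J (- real n - 2) t + ?H (- real n - 2) t)"
    using eq[of "Suc (Suc n)"] t unfolding e by (simp add: field_simps)
  have "pi * (t * t ^ n) * (t * radial_Y (real n + 2) t - (real n + 1) * radial_Y (real n + 1) t + radial_Y (real n) t)
     = pi * (t * t * t ^ n) * radial_Y (real n + 2) t - (real n + 1) * (pi * (t * t ^ n) * radial_Y (real n + 1) t)
       + t * (pi * t ^ n * radial_Y (real n) t)"
    by (simp add: algebra_simps)
  also have "\<dots> = t * t ^ n * entire_J (real n + 1) t + (-1) ^ n * entire_J (- real n - 1) t"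
    unfolding E0 E1 E2 r2 r3 r4 by (simp add: algebra_simps)
  also have "\<dots> = 0" unfolding n1 m by (simp add: algebra_simps sq)
  finally show ?thesis unfolding 1 using t by simp
next
  case 2
  then have 3: "\<nu> + 1 \<notin> \<int>" using Ints_diff[OF _ Ints_1, of "\<nu> + 1"] by auto
  from 2 have 4: "\<nu> + 2 \<notin> \<int>"
    using Ints_diff[OF _ Ints_numeral[of "num.Bit0 num.One"], of "\<nu> + 2"] by auto
  have s: "sin (\<nu> * pi) \<noteq> 0" using 2 sin_times_pi_eq_0[of \<nu>] by auto
  have r1: "entire_J \<nu> t = (\<nu> + 1) * entire_J (\<nu> + 1) t - t * entire_J (\<nu> + 2) t"
    using entire_J_recurrence[of "\<nu> + 1" t] by (simp add: algebra_simps)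
  have r3: "entire_J (- \<nu> - 2) t = - (\<nu> + 1) * entire_J (- \<nu> - 1) t - t * entire_J (- \<nu>) t"
    using entire_J_recurrence[of "- \<nu> - 1" t] by (simp add: algebra_simps)
  have sc: "sin ((\<nu> + 1) * pi) = - sin (\<nu> * pi)" "cos ((\<nu> + 1) * pi) = - cos (\<nu> * pi)"
    "sin ((\<nu> + 2) * pi) = sin (\<nu> * pi)" "cos ((\<nu> + 2) * pi) = cos (\<nu> * pi)"
    by (simp_all add: distrib_right sin_add cos_add)
  have e: "- (\<nu> + 1) = - \<nu> - 1" "- (\<nu> + 2) = - \<nu> - 2" by simp_all
  have pw: "t powr (- \<nu> - 1) = t powr (- \<nu>) / t" "t powr (- \<nu> - 2) = t powr (- \<nu>) / (t * t)"
    using t by (simp_all add: powr_diff power2_eq_square)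
  show ?thesis
    unfolding radial_Y_nonint[OF t 2] radial_Y_nonint[OF t 3] radial_Y_nonint[OF t 4] sc e r1 r3 pw
    using t s by (simp add: field_simps)
qed

text \<open>This is the Wronskian \<open>J\<^sub>\<nu>\<^sub>+\<^sub>1 Y\<^sub>\<nu> - J\<^sub>\<nu> Y\<^sub>\<nu>\<^sub>+\<^sub>1 = 2 / (\<pi> x)\<close>. Its constant fixes the size of the point mass that
  matches a ball of given radius.\<close>

lemma entire_J_radial_Y_wronskian:
  assumes t: "t > 0" and \<nu>: "0 \<le> \<nu>"
  shows "entire_J (\<nu> + 1) t * radial_Y \<nu> t - entire_J \<nu> t * radial_Y (\<nu> + 1) t = t powr (- \<nu> - 1) / pi"
  using \<nu>
proof (cases rule: real_nonneg_nat_or_nonint_cases)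
  case (1 n)
  let ?H = entire_J_order_deriv
  note eq = radial_Y_nat[OF t]
  have W: "t * ?H (real n + 1) t * entire_J (- real n) t - t * entire_J (real n + 1) t * ?H (- real n) t
     + ?H (real n) t * entire_J (- real n - 1) t - entire_J (real n) t * ?H (- real n - 1) t = - ((-1) ^ n)"
  proof (rule DERIV_unique)
    show "((\<lambda>\<mu>. t * entire_J (\<mu> + 1) t * entire_J (- \<mu>) t + entire_J \<mu> t * entire_J (- \<mu> - 1) t)
      has_real_derivative t * ?H (real n + 1) t * entire_J (- real n) t - t * entire_J (real n + 1) t * ?H (- real n) t
     + ?H (real n) t * entire_J (- real n - 1) t - entire_J (real n) t * ?H (- real n - 1) t) (at (real n))"
      by (rule entire_J_has_order_derivative' derivative_eq_intros refl | simp)+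
    show "((\<lambda>\<mu>. t * entire_J (\<mu> + 1) t * entire_J (- \<mu>) t + entire_J \<mu> t * entire_J (- \<mu> - 1) t)
      has_real_derivative - ((-1) ^ n)) (at (real n))"
      unfolding entire_J_wronskian
      by (rule derivative_eq_intros refl | simp add: cos_npi2)+
  qed
  have n0: "entire_J (- real n) t = (- t) ^ n * entire_J (real n) t"
    by (rule entire_J_neg_int)
  have n1: "entire_J (- real n - 1) t = - t * (- t) ^ n * entire_J (real n + 1) t"
    using entire_J_neg_int[of "Suc n" t] by (simp add: add.commute minus_diff_commute mult.assoc)
  have m: "(- t) ^ n = (-1) ^ n * t ^ n" by (rule power_minus)
  have sq: "(-1) ^ n * ((-1) ^ n * x) = (x::real)" for x by (cases "even n") auto
  have e: "real (Suc n) = real n + 1" "- (real n + 1) = - real n - 1" by auto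
  have pw: "t powr (- real n - 1) = 1 / (t * t ^ n)"
    using t by (simp add: powr_diff powr_minus powr_realpow field_simps)
  have W': "t * (entire_J (real n + 1) t * ?H (- real n) t) + entire_J (real n) t * ?H (- real n - 1) t
     = (-1) ^ n + t * ?H (real n + 1) t * ((-1) ^ n * t ^ n * entire_J (real n) t) - ?H (real n) t * (t * ((-1) ^ n * t ^ n) * entire_J (real n + 1) t)"
    using W unfolding n0 n1 m by (simp add: algebra_simps)
  have E: "(-1) ^ n * (t * (entire_J (real n + 1) t * ?H (- real n) t) + entire_J (real n) t * ?H (- real n - 1) t)
     = 1 + t * t ^ n * (?H (real n + 1) t * entire_J (real n) t - ?H (real n) t * entire_J (real n + 1) t)"
    unfolding W' by (simp add: algebra_simps sq)
  have E0: "pi * t ^ n * radial_Y (real n) t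
      = t ^ n * ?H (real n) t + (-1) ^ n * (ln t * entire_J (- real n) t + ?H (- real n) t)"
    using eq[of n] t by (simp add: field_simps)
  have E1: "pi * (t * t ^ n) * radial_Y (real n + 1) t
      = t * t ^ n * ?H (real n + 1) t - (-1) ^ n * (ln t * entire_J (- real n - 1) t + ?H (- real n - 1) t)"
    using eq[of "Suc n"] t unfolding e by (simp add: field_simps)
  have "pi * (t * t ^ n) * (entire_J (real n + 1) t * radial_Y (real n) t - entire_J (real n) t * radial_Y (real n + 1) t)
    = t * entire_J (real n + 1) t * (pi * t ^ n * radial_Y (real n) t)
      - entire_J (real n) t * (pi * (t * t ^ n) * radial_Y (real n + 1) t)"
    by (simp add: algebra_simps)
  also have "\<dots> = t * t ^ n * (?H (real n) t * entire_J (real n + 1) t - ?H (real n + 1) t * entire_J (real n) t) +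
      (-1) ^ n * (t * (entire_J (real n + 1) t * ?H (- real n) t) + entire_J (real n) t * ?H (- real n - 1) t)"
    unfolding E0 E1 n0 n1 m by (simp add: algebra_simps sq)
  finally have "pi * (t * t ^ n) * (entire_J (real n + 1) t * radial_Y (real n) t - entire_J (real n) t * radial_Y (real n + 1) t) = 1"
    unfolding E by (simp add: algebra_simps)
  then show ?thesis unfolding 1 pw using t by (simp add: field_simps)
next
  case 2
  then have 3: "\<nu> + 1 \<notin> \<int>" using Ints_diff[OF _ Ints_1, of "\<nu> + 1"] by auto
  have s: "sin (\<nu> * pi) \<noteq> 0" using 2 sin_times_pi_eq_0[of \<nu>] by auto
  have sc: "sin ((\<nu> + 1) * pi) = - sin (\<nu> * pi)" "cos ((\<nu> + 1) * pi) = - cos (\<nu> * pi)"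
    by (simp_all add: distrib_right)
  have e: "- (\<nu> + 1) = - \<nu> - 1" by simp
  have pw: "t powr (- \<nu> - 1) = t powr (- \<nu>) / t" using t by (simp add: powr_diff)
  have "entire_J (\<nu> + 1) t * radial_Y \<nu> t - entire_J \<nu> t * radial_Y (\<nu> + 1) t
     = - (t powr (- \<nu>) / t) * (t * entire_J (\<nu> + 1) t * entire_J (- \<nu>) t + entire_J \<nu> t * entire_J (- \<nu> - 1) t) / sin (\<nu> * pi)"
    unfolding radial_Y_nonint[OF t 2] radial_Y_nonint[OF t 3] sc e pw
    using t s by (simp add: field_simps)
  also have "\<dots> = t powr (- \<nu> - 1) / pi"
    unfolding entire_J_wronskian pw using t s by (simp add: field_simps)
  finally show ?thesis .
qed


section \<open>First zero, critical mass and kernel\<close>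

lemma entire_J_power_has_derivative:
  assumes "t > 0"
  shows "((\<lambda>t. t powr (\<nu> + 1) * entire_J (\<nu> + 1) t) has_real_derivative t powr \<nu> * entire_J \<nu> t) (at t)"
proof -
  have "((\<lambda>t. t powr (\<nu> + 1)) has_real_derivative (\<nu> + 1) * t powr \<nu>) (at t)"
    using has_real_derivative_powr[OF assms, of "\<nu> + 1"] by simp
  from DERIV_mult[OF this entire_J_has_derivative[of "\<nu> + 1"]] show ?thesis
  proof (rule DERIV_cong)
    have r: "(\<nu> + 1) * entire_J (\<nu> + 1) t - t * entire_J (\<nu> + 1 + 1) t = entire_J \<nu> t"
      using entire_J_recurrence[of "\<nu> + 1" t] by simp
    have "(\<nu> + 1) * t powr \<nu> * entire_J (\<nu> + 1) t + - entire_J (\<nu> + 1 + 1) t * t powr (\<nu> + 1)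
      = t powr \<nu> * ((\<nu> + 1) * entire_J (\<nu> + 1) t - t * entire_J (\<nu> + 1 + 1) t)"
      using assms by (simp add: powr_add algebra_simps)
    then show "(\<nu> + 1) * t powr \<nu> * entire_J (\<nu> + 1) t + - entire_J (\<nu> + 1 + 1) t * t powr (\<nu> + 1) = t powr \<nu> * entire_J \<nu> t"
      unfolding r .
  qed
qed

lemma radial_Y_power_has_derivative:
  assumes "t > 0" "0 \<le> \<nu>"
  shows "((\<lambda>t. t powr (\<nu> + 1) * radial_Y (\<nu> + 1) t) has_real_derivative t powr \<nu> * radial_Y \<nu> t) (at t)"
proof -
  have 1: "((\<lambda>t. t powr (\<nu> + 1)) has_real_derivative (\<nu> + 1) * t powr \<nu>) (at t)"
    using has_real_derivative_powr[OF assms(1), of "\<nu> + 1"] by simp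
  have 2: "0 \<le> \<nu> + 1" using assms by simp
  have "(\<nu> + 1) * t powr \<nu> * radial_Y (\<nu> + 1) t + - radial_Y (\<nu> + 1 + 1) t * t powr (\<nu> + 1)
     = t powr \<nu> * ((\<nu> + 1) * radial_Y (\<nu> + 1) t - t * radial_Y (\<nu> + 1 + 1) t)"
    using assms by (simp add: powr_add algebra_simps)
  also have "(\<nu> + 1) * radial_Y (\<nu> + 1) t - t * radial_Y (\<nu> + 1 + 1) t = radial_Y \<nu> t"
    using radial_Y_recurrence[OF assms] by (simp add: add.commute)
  finally have "(\<nu> + 1) * t powr \<nu> * radial_Y (\<nu> + 1) t + - radial_Y (\<nu> + 1 + 1) t * t powr (\<nu> + 1) = t powr \<nu> * radial_Y \<nu> t" .
  then show ?thesis by (rule DERIV_cong[OF DERIV_mult[OF 1 radial_Y_has_derivative[OF assms(1) 2]]])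
qed

text \<open>\<open>t\<^sup>\<nu>\<^sup>+\<^sup>1 entire_J (\<nu> + 1) t\<close> starts at \<open>0\<close> and its derivative is \<open>t\<^sup>\<nu> entire_J \<nu> t\<close>. The endpoint \<open>T\<close>, where
  \<open>entire_J \<nu>\<close> may vanish, is included.\<close>

lemma entire_J_Suc_pos:
  assumes \<nu>: "\<nu> > -1" and pos: "\<And>s. 0 \<le> s \<Longrightarrow> s < T \<Longrightarrow> entire_J \<nu> s > 0" and t: "0 \<le> t" "t \<le> T"
  shows "entire_J (\<nu> + 1) t > 0"
proof (cases "t = 0")
  case True
  have "Gamma (\<nu> + 2) > 0" by (rule Gamma_real_pos) (use \<nu> in simp)
  then show ?thesis using True by (simp add: entire_J_zero rGamma_inverse_Gamma add.commute)
next
  case False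
  then have t0: "0 < t" using t by simp
  have "0 powr (\<nu> + 1) * entire_J (\<nu> + 1) 0 < t powr (\<nu> + 1) * entire_J (\<nu> + 1) t"
  proof (rule DERIV_pos_imp_increasing_open[OF t0])
    fix s assume s: "0 < s" "s < t"
    have "s powr \<nu> * entire_J \<nu> s > 0" using s t pos[of s] by simp
    then show "\<exists>y. ((\<lambda>t. t powr (\<nu> + 1) * entire_J (\<nu> + 1) t) has_real_derivative y) (at s) \<and> y > 0"
      using entire_J_power_has_derivative[OF s(1)] by blast
  next
    show "continuous_on {0..t} (\<lambda>t. t powr (\<nu> + 1) * entire_J (\<nu> + 1) t)"
      by (intro continuous_intros continuous_on_powr') (use \<nu> in auto)
  qed
  then show ?thesis using t0 by (simp add: zero_less_mult_iff)
qed

text \<open>If there were no zero up to \<open>T0 = (\<nu> + 1) (\<nu> + 2)\<close>, the functions of orders \<open>\<nu>\<close> to \<open>\<nu> + 3\<close> would all be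
  positive there. Applied twice, the recurrence then gives
  \<open>entire_J \<nu> T0 < ((\<nu> + 1) (\<nu> + 2) - T0) entire_J (\<nu> + 2) T0 = 0\<close>.\<close>

lemma entire_J_first_zero:
  assumes \<nu>: "\<nu> > -1"
  obtains T where "T > 0" "entire_J \<nu> T = 0" "\<And>t. 0 \<le> t \<Longrightarrow> t < T \<Longrightarrow> entire_J \<nu> t > 0"
proof -
  (* The value at which the two recurrence steps in the contradiction below cancel exactly. *)
  define T0 where "T0 = (\<nu> + 1) * (\<nu> + 2)"
  have T0: "T0 > 0" using \<nu> by (simp add: T0_def)
  have z: "entire_J \<nu> 0 > 0"
    using Gamma_real_pos[of "\<nu> + 1"] \<nu> by (simp add: entire_J_zero rGamma_inverse_Gamma)
  let ?Z = "{t \<in> {0..T0}. entire_J \<nu> t = 0}"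
  have cont: "continuous_on S (entire_J \<nu>)" for S by (intro continuous_intros)
  have "?Z \<noteq> {}"
  proof
    assume e: "?Z = {}"
    have p0: "entire_J \<nu> t > 0" if nn: "0 \<le> t" and "t \<le> T0" for t
    proof (rule ccontr)
      assume "\<not> entire_J \<nu> t > 0"
      then obtain s where "0 \<le> s" "s \<le> t" "entire_J \<nu> s = 0"
        using IVT2'[of "entire_J \<nu>" t 0 0, OF _ _ nn cont] z by auto
      then show False using e \<open>t \<le> T0\<close> by auto
    qed
    have p1: "entire_J (\<nu> + 1) t > 0" if "0 \<le> t" "t \<le> T0" for t
      by (rule entire_J_Suc_pos[of \<nu> T0]) (use \<nu> p0 that in auto)
    have p2: "entire_J (\<nu> + 1 + 1) t > 0" if "0 \<le> t" "t \<le> T0" for t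
      by (rule entire_J_Suc_pos[of "\<nu> + 1" T0]) (use \<nu> p1 that in auto)
    have p3: "entire_J (\<nu> + 1 + 1 + 1) t > 0" if "0 \<le> t" "t \<le> T0" for t
      by (rule entire_J_Suc_pos[of "\<nu> + 1 + 1" T0]) (use \<nu> p2 that in auto)
    have r1: "entire_J \<nu> T0 = (\<nu> + 1) * entire_J (\<nu> + 1) T0 - T0 * entire_J (\<nu> + 1 + 1) T0"
      using entire_J_recurrence[of "\<nu> + 1" T0] by simp
    have "entire_J (\<nu> + 1) T0 = (\<nu> + 2) * entire_J (\<nu> + 1 + 1) T0 - T0 * entire_J (\<nu> + 1 + 1 + 1) T0"
      using entire_J_recurrence[of "\<nu> + 1 + 1" T0] by (simp add: add.commute)
    then have "entire_J (\<nu> + 1) T0 < (\<nu> + 2) * entire_J (\<nu> + 1 + 1) T0"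
      using p3[of T0] T0 by simp
    then have "(\<nu> + 1) * entire_J (\<nu> + 1) T0 < (\<nu> + 1) * ((\<nu> + 2) * entire_J (\<nu> + 1 + 1) T0)"
      using \<nu> by simp
    then have "entire_J \<nu> T0 < 0" unfolding r1 by (simp add: T0_def mult.assoc)
    then show False using p0[of T0] T0 by simp
  qed
  moreover have "compact ?Z"
  proof -
    have "closed ({0..T0} \<inter> entire_J \<nu> -` {0})"
      by (intro continuous_closed_preimage cont) auto
    moreover have "{0..T0} \<inter> entire_J \<nu> -` {0} = ?Z" by auto
    ultimately have "closed ?Z" by simp
    moreover have "bounded ?Z" by (rule bounded_subset[of "{0..T0}"]) auto
    ultimately show ?thesis by (simp add: compact_eq_bounded_closed)
  qed
  ultimately obtain T where T: "T \<in> ?Z" "\<And>t. t \<in> ?Z \<Longrightarrow> T \<le> t"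
    using compact_attains_inf[of ?Z] by blast
  have Tpos: "T > 0" using T(1) z by (cases "T = 0") auto
  have "entire_J \<nu> t > 0" if nn: "0 \<le> t" and "t < T" for t
  proof (rule ccontr)
    assume "\<not> entire_J \<nu> t > 0"
    then obtain s where "0 \<le> s" "s \<le> t" "entire_J \<nu> s = 0"
      using IVT2'[of "entire_J \<nu>" t 0 0, OF _ _ nn cont] z by auto
    then show False using T(2)[of s] T(1) \<open>t < T\<close> by auto
  qed
  then show ?thesis using that[OF Tpos] T(1) by blast
qed

lemma bessel_J_zero1_eq:
  assumes T: "T > 0" "entire_J \<nu> T = 0" "\<And>t. 0 \<le> t \<Longrightarrow> t < T \<Longrightarrow> entire_J \<nu> t > 0"
  shows "bessel_J_zero1 \<nu> = 2 * sqrt T"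
  unfolding bessel_J_zero1_def
proof (rule Least_equality)
  show "0 < 2 * sqrt T \<and> bessel_J \<nu> (2 * sqrt T) = 0"
    using T by (simp add: bessel_J_eq_entire_J)
  fix y assume y: "0 < y \<and> bessel_J \<nu> y = 0"
  then have e: "y = 2 * sqrt ((y / 2)\<^sup>2)" by simp
  then have "bessel_J \<nu> y = ((y / 2)\<^sup>2) powr (\<nu> / 2) * entire_J \<nu> ((y / 2)\<^sup>2)"
    using bessel_J_eq_entire_J[of "(y / 2)\<^sup>2" \<nu>] y by simp
  then have "entire_J \<nu> ((y / 2)\<^sup>2) = 0" using y by simp
  then have "T \<le> (y / 2)\<^sup>2" using T(3)[of "(y / 2)\<^sup>2"] by force
  then have "sqrt T \<le> y / 2" using y by (intro real_le_lsqrt) auto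
  then show "2 * sqrt T \<le> y" by simp
qed

lemma c_ball_eq_entire_J:
  assumes "k > 0" "r \<ge> 0" "real N = 2 * \<nu> + 2"
  shows "c_ball N k r = (4 * pi / k\<^sup>2) powr (\<nu> + 1) * ((k\<^sup>2 * r\<^sup>2 / 4) powr (\<nu> + 1) * entire_J (\<nu> + 1) (k\<^sup>2 * r\<^sup>2 / 4))"
proof (cases "r = 0")
  case True
  then show ?thesis by (simp add: c_ball_def)
next
  case False
  then have r: "r > 0" using assms by simp
  define t where "t = k\<^sup>2 * r\<^sup>2 / 4"
  have t: "t > 0" using r assms by (simp add: t_def)
  have st: "sqrt t = k * r / 2" using r assms by (simp add: t_def real_sqrt_divide real_sqrt_mult)
  have N: "real N / 2 = \<nu> + 1" using assms by simp
  have "c_ball N k r = (2 * pi * r / k) powr (\<nu> + 1) * bessel_J (\<nu> + 1) (2 * sqrt t)"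
    unfolding c_ball_def N st by simp
  also have "2 * pi * r / k = 4 * pi / k\<^sup>2 * sqrt t"
    using assms by (simp add: st field_simps power2_eq_square)
  also have "(4 * pi / k\<^sup>2 * sqrt t) powr (\<nu> + 1) = (4 * pi / k\<^sup>2) powr (\<nu> + 1) * sqrt t powr (\<nu> + 1)"
    by (rule powr_mult)
  also have "sqrt t powr (\<nu> + 1) = t powr ((\<nu> + 1) / 2)"
    using t by (simp add: powr_half_sqrt[symmetric] powr_powr)
  also have "bessel_J (\<nu> + 1) (2 * sqrt t) = t powr ((\<nu> + 1) / 2) * entire_J (\<nu> + 1) t"
    by (rule bessel_J_eq_entire_J[OF t])
  also have "(4 * pi / k\<^sup>2) powr (\<nu> + 1) * t powr ((\<nu> + 1) / 2) * (t powr ((\<nu> + 1) / 2) * entire_J (\<nu> + 1) t)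
     = (4 * pi / k\<^sup>2) powr (\<nu> + 1) * ((t powr ((\<nu> + 1) / 2) * t powr ((\<nu> + 1) / 2)) * entire_J (\<nu> + 1) t)"
    by (simp only: mult.assoc)
  also have "t powr ((\<nu> + 1) / 2) * t powr ((\<nu> + 1) / 2) = t powr (\<nu> + 1)"
    by (simp add: powr_add[symmetric])
  finally show ?thesis unfolding t_def .
qed

lemma helmholtz_kernel_eq_radial_Y:
  fixes x :: "'a::euclidean_space"
  assumes "k > 0" "x \<noteq> 0" "\<nu> = (real DIM('a) - 2) / 2"
  shows "helmholtz_kernel k x = ereal (- ((k\<^sup>2 / (4 * pi)) powr \<nu> / 4 * radial_Y \<nu> (k\<^sup>2 * (norm x)\<^sup>2 / 4)))"
proof -
  define t where "t = k\<^sup>2 * (norm x)\<^sup>2 / 4"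
  have nx: "norm x > 0" using assms by simp
  have t: "t > 0" using nx assms by (simp add: t_def)
  have st: "sqrt t = k * norm x / 2" using nx assms by (simp add: t_def real_sqrt_divide real_sqrt_mult)
  have "t powr (- \<nu> / 2) = sqrt t powr (- \<nu>)"
    using t by (simp add: powr_half_sqrt[symmetric] powr_powr)
  also have "\<dots> = (k powr (- \<nu>) * norm x powr (- \<nu>)) / 2 powr (- \<nu>)"
    unfolding st using nx assms by (simp add: powr_divide powr_mult)
  finally have tp: "t powr (- \<nu> / 2) = 2 powr \<nu> * norm x powr (- \<nu>) / k powr \<nu>"
    by (simp add: powr_minus field_simps)
  have "(k\<^sup>2 / (4 * pi)) powr \<nu> = k powr \<nu> * k powr \<nu> / (2 powr \<nu> * 2 powr \<nu> * pi powr \<nu>)"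
  proof -
    have "k\<^sup>2 / (4 * pi) = k * k / (2 * 2 * pi)" by (simp add: power2_eq_square)
    then show ?thesis using assms by (simp only: powr_divide powr_mult)
  qed
  then have "(k\<^sup>2 / (4 * pi)) powr \<nu> / 4 * (t powr (- \<nu> / 2)) = k powr \<nu> / (2 powr (\<nu> + 2) * pi powr \<nu>) * norm x powr (- \<nu>)"
    unfolding tp using assms(1) by (simp add: powr_add)
  then have "(k\<^sup>2 / (4 * pi)) powr \<nu> / 4 * radial_Y \<nu> t = k powr \<nu> / (2 powr (\<nu> + 2) * pi powr \<nu>) * norm x powr (- \<nu>) * bessel_Y \<nu> (k * norm x)"
    unfolding radial_Y_def st by (simp add: mult.assoc[symmetric])
  then show ?thesis using assms(2) unfolding helmholtz_kernel_def assms(3)[symmetric] Let_def t_def by simp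
qed

section \<open>The gap between the potential and the glued function\<close>

text \<open>\<open>k\<^sup>2\<close> times the gap \<open>U - V\<close>, as a function of \<open>t\<close>: the solution of \<open>t w'' + (\<nu> + 1) w' + w = 1\<close> that vanishes
  together with its derivative at \<open>t0\<close>. The coefficient of \<open>radial_Y\<close> is proportional to the point mass.\<close>

definition excess :: "real \<Rightarrow> real \<Rightarrow> real \<Rightarrow> real" where
  "excess \<nu> t0 t = 1 - pi * t0 powr (\<nu> + 1) *
     (entire_J (\<nu> + 1) t0 * radial_Y \<nu> t - radial_Y (\<nu> + 1) t0 * entire_J \<nu> t)"

definition excess' :: "real \<Rightarrow> real \<Rightarrow> real \<Rightarrow> real" where
  "excess' \<nu> t0 t = pi * t0 powr (\<nu> + 1) *
     (entire_J (\<nu> + 1) t0 * radial_Y (\<nu> + 1) t - radial_Y (\<nu> + 1) t0 * entire_J (\<nu> + 1) t)"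

lemma excess_has_derivative:
  assumes "t > 0" "0 \<le> \<nu>"
  shows "(excess \<nu> t0 has_real_derivative excess' \<nu> t0 t) (at t within S)"
  unfolding excess_def[abs_def]
  by (rule DERIV_cong[OF DERIV_diff[OF DERIV_const DERIV_cmult[OF DERIV_diff[OF
       DERIV_cmult[OF radial_Y_has_derivative[OF assms]] DERIV_cmult[OF entire_J_has_derivative]]]]])
     (simp add: excess'_def algebra_simps)

lemma excess_touch:
  assumes "t0 > 0" "0 \<le> \<nu>"
  shows "excess \<nu> t0 t0 = 0" "excess' \<nu> t0 t0 = 0"
proof -
  have "pi * t0 powr (\<nu> + 1) * (t0 powr (- \<nu> - 1) / pi) = 1"
    using assms by (simp add: powr_add[symmetric])
  then show "excess \<nu> t0 t0 = 0"
    using entire_J_radial_Y_wronskian[OF assms] by (simp add: excess_def mult.commute)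
  show "excess' \<nu> t0 t0 = 0" by (simp add: excess'_def)
qed

lemma excess'_power_has_derivative:
  assumes "t > 0" "0 \<le> \<nu>"
  shows "((\<lambda>t. t powr (\<nu> + 1) * excess' \<nu> t0 t) has_real_derivative t powr \<nu> * (1 - excess \<nu> t0 t)) (at t)"
proof -
  have "((\<lambda>t. pi * t0 powr (\<nu> + 1) * (entire_J (\<nu> + 1) t0 * (t powr (\<nu> + 1) * radial_Y (\<nu> + 1) t)
      - radial_Y (\<nu> + 1) t0 * (t powr (\<nu> + 1) * entire_J (\<nu> + 1) t))) has_real_derivative
      pi * t0 powr (\<nu> + 1) * (entire_J (\<nu> + 1) t0 * (t powr \<nu> * radial_Y \<nu> t)
      - radial_Y (\<nu> + 1) t0 * (t powr \<nu> * entire_J \<nu> t))) (at t)"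
    by (intro DERIV_cmult DERIV_diff radial_Y_power_has_derivative[OF assms] entire_J_power_has_derivative[OF assms(1)])
  then show ?thesis unfolding excess'_def excess_def by (simp add: algebra_simps)
qed

text \<open>The numerator of the derivative of the quotient, times \<open>t\<^sup>\<nu>\<^sup>+\<^sup>1\<close>, is a Wronskian \<open>W\<close>. Since \<open>excess\<close> and
  \<open>entire_J\<close> solve the same equation with right-hand sides \<open>1\<close> and \<open>0\<close>, \<open>W\<close> has derivative
  \<open>t\<^sup>\<nu> entire_J \<nu> t > 0\<close>; it vanishes at \<open>t0\<close>, and so it is negative before.\<close>

lemma excess_quotient_decreasing:
  assumes \<nu>: "0 \<le> \<nu>" and pos: "\<And>s. 0 \<le> s \<Longrightarrow> s < t0 \<Longrightarrow> entire_J \<nu> s > 0" and t: "0 < s" "s < t" "t < t0"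
  shows "excess \<nu> t0 t / entire_J \<nu> t < excess \<nu> t0 s / entire_J \<nu> s"
proof (rule DERIV_neg_imp_decreasing[OF t(2)])
  fix x assume x: "s \<le> x" "x \<le> t"
  then have x0: "0 < x" "x < t0" using t by auto
  have gx: "entire_J \<nu> x > 0" using pos x0 by simp
  define W where "W x = (x powr (\<nu> + 1) * excess' \<nu> t0 x) * entire_J \<nu> x + excess \<nu> t0 x * (x powr (\<nu> + 1) * entire_J (\<nu> + 1) x)" for x
  have W: "(W has_real_derivative y powr \<nu> * entire_J \<nu> y) (at y)" if "y > 0" for y
    unfolding W_def[abs_def]
    by (rule DERIV_cong[OF DERIV_add[OF DERIV_mult[OF excess'_power_has_derivative[OF that \<nu>] entire_J_has_derivative]
          DERIV_mult[OF excess_has_derivative[OF that \<nu>] entire_J_power_has_derivative[OF that]]]])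
       (simp add: algebra_simps)
  have "W x < W t0"
  proof (rule DERIV_pos_imp_increasing_open[OF x0(2)])
    fix y assume "x < y" "y < t0"
    then have "y powr \<nu> * entire_J \<nu> y > 0" "y > 0" using x0 pos[of y] by auto
    then show "\<exists>z. (W has_real_derivative z) (at y) \<and> 0 < z" using W by blast
  next
    show "continuous_on {x..t0} W"
      by (rule DERIV_continuous_on[where D="\<lambda>y. y powr \<nu> * entire_J \<nu> y"]) (use W x0 in \<open>auto intro: has_field_derivative_at_within\<close>)
  qed
  also have "W t0 = 0" unfolding W_def using excess_touch[of t0 \<nu>] x0 \<nu> by simp
  finally have "x powr (\<nu> + 1) * (excess' \<nu> t0 x * entire_J \<nu> x + excess \<nu> t0 x * entire_J (\<nu> + 1) x) < 0"
    unfolding W_def by (simp add: algebra_simps)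
  then have neg: "excess' \<nu> t0 x * entire_J \<nu> x + excess \<nu> t0 x * entire_J (\<nu> + 1) x < 0"
    using x0 by (simp add: mult_less_0_iff not_less powr_ge_zero) 
  have "((\<lambda>x. excess \<nu> t0 x / entire_J \<nu> x) has_real_derivative
     (excess' \<nu> t0 x * entire_J \<nu> x - excess \<nu> t0 x * (- entire_J (\<nu> + 1) x)) / (entire_J \<nu> x * entire_J \<nu> x)) (at x)"
    by (rule DERIV_divide[OF excess_has_derivative[OF x0(1) \<nu>] entire_J_has_derivative]) (use gx in simp)
  moreover have "(excess' \<nu> t0 x * entire_J \<nu> x - excess \<nu> t0 x * (- entire_J (\<nu> + 1) x)) / (entire_J \<nu> x * entire_J \<nu> x) < 0"
    using neg gx by (simp add: divide_less_0_iff)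
  ultimately show "\<exists>y. ((\<lambda>x. excess \<nu> t0 x / entire_J \<nu> x) has_real_derivative y) (at x) \<and> y < 0"
    by blast
qed

text \<open>The excess vanishes to second order at \<open>t0\<close>, \<open>entire_J \<nu>\<close> at most to first order, because its derivative
  \<open>- entire_J (\<nu> + 1)\<close> does not vanish at the first zero.\<close>

lemma excess_quotient_tendsto:
  assumes \<nu>: "0 \<le> \<nu>" and t0: "t0 > 0" and pos: "\<And>s. 0 \<le> s \<Longrightarrow> s < t0 \<Longrightarrow> entire_J \<nu> s > 0"
  shows "((\<lambda>t. excess \<nu> t0 t / entire_J \<nu> t) \<longlongrightarrow> 0) (at_left t0)"
proof -
  have D1: "((\<lambda>t. excess \<nu> t0 t / (t - t0)) \<longlongrightarrow> 0) (at_left t0)"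
    using excess_has_derivative[OF t0 \<nu>, of t0 "{..<t0}"] excess_touch[OF t0 \<nu>]
      by (simp add: has_field_derivative_iff)
  show ?thesis
  proof (cases "entire_J \<nu> t0 = 0")
    case False
    have "(excess \<nu> t0 \<longlongrightarrow> excess \<nu> t0 t0) (at_left t0)"
      using has_field_derivative_imp_has_derivative[OF excess_has_derivative[OF t0 \<nu>, of t0 "{..<t0}"], THEN has_derivative_continuous]
      by (simp add: continuous_within)
    moreover have "(entire_J \<nu> \<longlongrightarrow> entire_J \<nu> t0) (at_left t0)"
      using has_field_derivative_imp_has_derivative[OF entire_J_has_derivative[of \<nu> t0 "{..<t0}"], THEN has_derivative_continuous]
      by (simp add: continuous_within)
    ultimately have "((\<lambda>t. excess \<nu> t0 t / entire_J \<nu> t) \<longlongrightarrow> excess \<nu> t0 t0 / entire_J \<nu> t0) (at_left t0)"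
      using False by (rule tendsto_divide)
    then show ?thesis using excess_touch[OF t0 \<nu>] by simp
  next
    case True
    have "((\<lambda>t. entire_J \<nu> t / (t - t0)) \<longlongrightarrow> - entire_J (\<nu> + 1) t0) (at_left t0)"
      using entire_J_has_derivative[of \<nu> t0 "{..<t0}"] True by (simp add: has_field_derivative_iff)
    moreover have "- entire_J (\<nu> + 1) t0 \<noteq> 0"
      using entire_J_Suc_pos[of \<nu> t0 t0] \<nu> t0 pos by force
    ultimately have "((\<lambda>t. (excess \<nu> t0 t / (t - t0)) / (entire_J \<nu> t / (t - t0))) \<longlongrightarrow> 0 / (- entire_J (\<nu> + 1) t0)) (at_left t0)"
      using D1 by (intro tendsto_divide)
    then have "((\<lambda>t. excess \<nu> t0 t / entire_J \<nu> t) \<longlongrightarrow> 0 / (- entire_J (\<nu> + 1) t0)) (at_left t0)"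
    proof (rule Lim_transform_eventually)
      show "\<forall>\<^sub>F t in at_left t0. (excess \<nu> t0 t / (t - t0)) / (entire_J \<nu> t / (t - t0)) = excess \<nu> t0 t / entire_J \<nu> t"
        unfolding eventually_at_filter by (intro always_eventually) auto
    qed
    then show ?thesis by simp
  qed
qed

lemma excess_pos:
  assumes \<nu>: "0 \<le> \<nu>" and pos: "\<And>s. 0 \<le> s \<Longrightarrow> s < t0 \<Longrightarrow> entire_J \<nu> s > 0" and t: "0 < t" "t < t0"
  shows "excess \<nu> t0 t > 0"
proof -
  let ?q = "\<lambda>t. excess \<nu> t0 t / entire_J \<nu> t"
  define m where "m = (t + t0) / 2"
  have m: "t < m" "m < t0" using t by (auto simp: m_def)
  have "(?q \<longlongrightarrow> 0) (at_left t0)" using t by (intro excess_quotient_tendsto \<nu> pos) auto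
  moreover have "\<forall>\<^sub>F x in at_left t0. ?q x \<le> ?q m"
    using eventually_at_left_real[OF m(2)]
  proof eventually_elim
    case (elim x)
    then have "?q x < ?q m" using m t by (intro excess_quotient_decreasing \<nu> pos) auto
    then show ?case by simp
  qed
  ultimately have "0 \<le> ?q m" by (rule tendsto_upperbound) simp
  also have "?q m < ?q t" using m t by (intro excess_quotient_decreasing \<nu> pos) auto
  finally show ?thesis using pos[of t] t by (simp add: zero_less_divide_iff)
qed

section \<open>Smooth functions and test functions\<close>

lemma partial_deriv_eqI: "(f has_derivative f') (at x) \<Longrightarrow> partial_deriv b f x = f' b"
  unfolding partial_deriv_def using frechet_derivative_at by metis

lemma smooth_imp_differentiable: "smooth f \<Longrightarrow> f differentiable (at x)"
  unfolding smooth_def iter_partial_def by (drule spec[of _ "[]"]) simp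

text \<open>Smoothness is the greatest property that implies differentiability and is stable under partial
  derivatives.\<close>

lemma smooth_coinduct:
  assumes "f \<in> S" and "\<And>g x. g \<in> S \<Longrightarrow> g differentiable (at x)"
    and "\<And>g b. g \<in> S \<Longrightarrow> b \<in> Basis \<Longrightarrow> partial_deriv b g \<in> S"
  shows "smooth f"
proof -
  have "iter_partial bs f \<in> S" if "set bs \<subseteq> Basis" for bs
    using that by (induction bs) (auto simp: iter_partial_def assms)
  then show ?thesis using assms(2) unfolding smooth_def by blast
qed

lemma smooth_partial_deriv:
  assumes "smooth f" "b \<in> Basis"
  shows "smooth (partial_deriv b f)"
  unfolding smooth_def
proof (intro allI impI)
  fix bs :: "'a list" and x assume bs: "set bs \<subseteq> Basis"
  have "set (bs @ [b]) \<subseteq> Basis" using assms bs by auto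
  then have "iter_partial (bs @ [b]) f differentiable (at x)"
    using assms(1) unfolding smooth_def by blast
  then show "iter_partial bs (partial_deriv b f) differentiable (at x)" by (simp add: iter_partial_def)
qed

lemma partial_deriv_lincomb:
  assumes "f differentiable (at x)" "g differentiable (at x)"
  shows "partial_deriv v (\<lambda>x. a * f x + c * g x) x = a * partial_deriv v f x + c * partial_deriv v g x"
proof -
  have "(f has_derivative frechet_derivative f (at x)) (at x)" "(g has_derivative frechet_derivative g (at x)) (at x)"
    using assms frechet_derivative_works by blast+
  then have "((\<lambda>x. a * f x + c * g x) has_derivative
     (\<lambda>h. a * frechet_derivative f (at x) h + c * frechet_derivative g (at x) h)) (at x)"
    by (intro derivative_intros)
  from partial_deriv_eqI[OF this] show ?thesis by (simp add: partial_deriv_def)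
qed

lemma smooth_lincomb:
  fixes f g :: "'a::euclidean_space \<Rightarrow> real"
  assumes "smooth f" "smooth g"
  shows "smooth (\<lambda>x. a * f x + c * g x)"
proof (rule smooth_coinduct)
  let ?S = "{\<lambda>x. a * f x + c * g x | f g :: 'a \<Rightarrow> real. smooth f \<and> smooth g}"
  show "(\<lambda>x. a * f x + c * g x) \<in> ?S" using assms by blast
  show "h differentiable (at x)" if "h \<in> ?S" for h x
    using that smooth_imp_differentiable by (auto intro!: derivative_intros)
  show "partial_deriv b h \<in> ?S" if "h \<in> ?S" "b \<in> Basis" for h b
  proof -
    from that obtain f g :: "'a \<Rightarrow> real" where h: "h = (\<lambda>x. a * f x + c * g x)" "smooth f" "smooth g"
      by blast
    have "partial_deriv b h = (\<lambda>x. a * partial_deriv b f x + c * partial_deriv b g x)"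
      unfolding h(1) by (intro ext partial_deriv_lincomb smooth_imp_differentiable h)
    then show ?thesis using h smooth_partial_deriv that by blast
  qed
qed

lemma smooth_const: "smooth (\<lambda>x. c)"
proof (rule smooth_coinduct[of _ "range (\<lambda>c x. c)"])
  show "partial_deriv b g \<in> range (\<lambda>c x. c)" if "g \<in> range (\<lambda>c x. c)" for g :: "'a \<Rightarrow> real" and b
  proof -
    from that obtain c where "g = (\<lambda>x. c)" by blast
    then have "partial_deriv b g = (\<lambda>x. 0)"
      by (intro ext partial_deriv_eqI) (simp add: has_derivative_const)
    then show ?thesis by blast
  qed
qed auto

lemma smooth_sum:
  fixes f :: "'i \<Rightarrow> 'a::euclidean_space \<Rightarrow> real"
  assumes "finite I" "\<And>i. i \<in> I \<Longrightarrow> smooth (f i)"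
  shows "smooth (\<lambda>x. \<Sum>i\<in>I. f i x)"
  using assms
proof (induction I)
  case (insert i I)
  then show ?case using smooth_lincomb[of "f i" "\<lambda>x. \<Sum>i\<in>I. f i x" 1 1] by simp
qed (simp add: smooth_const)

lemma test_functions_iff:
  "\<phi> \<in> test_functions \<longleftrightarrow> smooth \<phi> \<and> (\<exists>M. \<forall>x. \<phi> x \<noteq> 0 \<longrightarrow> norm x \<le> M)"
proof -
  have "compact (closure S) \<longleftrightarrow> (\<exists>M. \<forall>x\<in>S. norm x \<le> M)" for S :: "'a set"
  proof
    assume "compact (closure S)"
    then have "bounded S" using compact_imp_bounded bounded_subset closure_subset by blast
    then show "\<exists>M. \<forall>x\<in>S. norm x \<le> M" by (simp add: bounded_iff)
  next
    assume "\<exists>M. \<forall>x\<in>S. norm x \<le> M"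
    then have "bounded S" by (simp add: bounded_iff)
    then show "compact (closure S)" by (simp add: compact_eq_bounded_closed bounded_closure)
  qed
  then show ?thesis unfolding test_functions_def by auto
qed

lemma test_functions_lincomb:
  assumes "\<phi> \<in> test_functions" "\<psi> \<in> test_functions"
  shows "(\<lambda>x. a * \<phi> x + c * \<psi> x) \<in> test_functions"
proof -
  obtain M1 M2 where M: "\<And>x. \<phi> x \<noteq> 0 \<Longrightarrow> norm x \<le> M1" "\<And>x. \<psi> x \<noteq> 0 \<Longrightarrow> norm x \<le> M2"
    using assms unfolding test_functions_iff by blast
  have "norm x \<le> max M1 M2" if "a * \<phi> x + c * \<psi> x \<noteq> 0" for x
    using M[of x] that by (cases "\<phi> x = 0") auto
  then show ?thesis using assms smooth_lincomb unfolding test_functions_iff by blast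
qed

lemma partial_deriv_outside_support:
  fixes \<phi> :: "'a::euclidean_space \<Rightarrow> real"
  assumes "\<And>x. \<phi> x \<noteq> 0 \<Longrightarrow> norm x \<le> M" "norm x > M"
  shows "partial_deriv b \<phi> x = 0"
proof -
  have "open (- cball 0 M :: 'a set)" by auto
  moreover have "x \<in> - cball 0 M" using assms by auto
  ultimately have "(\<phi> has_derivative (\<lambda>h. 0)) (at x)"
  proof (rule has_derivative_transform_within_open[OF has_derivative_const])
    fix y :: 'a assume "y \<in> - cball 0 M"
    then show "0 = \<phi> y" using assms(1)[of y] by auto
  qed
  then show ?thesis by (rule partial_deriv_eqI)
qed

lemma test_functions_partial_deriv:
  assumes "\<phi> \<in> test_functions" "b \<in> Basis"
  shows "partial_deriv b \<phi> \<in> test_functions"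
proof -
  obtain M where M: "\<And>x. \<phi> x \<noteq> 0 \<Longrightarrow> norm x \<le> M"
    using assms unfolding test_functions_iff by blast
  have "norm x \<le> M" if "partial_deriv b \<phi> x \<noteq> 0" for x
    using that partial_deriv_outside_support[of \<phi> M x b] M by fastforce
  then show ?thesis using assms smooth_partial_deriv unfolding test_functions_iff by blast
qed

lemma test_functions_laplacian:
  fixes \<phi> :: "'a::euclidean_space \<Rightarrow> real"
  assumes \<phi>: "\<phi> \<in> test_functions"
  shows "laplacian \<phi> \<in> test_functions"
proof -
  have 2: "partial_deriv b (partial_deriv b \<phi>) \<in> test_functions" if "b \<in> Basis" for b
    by (intro test_functions_partial_deriv \<phi> that)
  obtain M where M: "\<And>x. \<phi> x \<noteq> 0 \<Longrightarrow> norm x \<le> M"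
    using \<phi> unfolding test_functions_iff by blast
  have z: "laplacian \<phi> x = 0" if "norm x > M" for x
    unfolding laplacian_def
  proof (intro sum.neutral ballI)
    fix b assume "b \<in> (Basis :: 'a set)"
    have "norm y \<le> M" if "partial_deriv b \<phi> y \<noteq> 0" for y
      using that partial_deriv_outside_support[of \<phi> M y b] M by fastforce
    then show "partial_deriv b (partial_deriv b \<phi>) x = 0"
      using that by (rule partial_deriv_outside_support)
  qed
  have "smooth (laplacian \<phi>)" unfolding laplacian_def[abs_def]
    by (rule smooth_sum) (use 2 test_functions_iff in auto)
  then show ?thesis
    unfolding test_functions_iff using z linorder_not_le by blast
qed

lemma test_functions_helmholtz:
  "\<phi> \<in> test_functions \<Longrightarrow> (\<lambda>x. - (laplacian \<phi> x + c * \<phi> x)) \<in> test_functions"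
  using test_functions_lincomb[OF test_functions_laplacian, of \<phi> \<phi> "-1" "-c"] by simp

lemma smooth_has_line_derivative:
  assumes "smooth \<phi>"
  shows "((\<lambda>h. \<phi> (x + h *\<^sub>R b)) has_real_derivative partial_deriv b \<phi> (x + h *\<^sub>R b)) (at h)"
proof -
  let ?D = "frechet_derivative \<phi> (at (x + h *\<^sub>R b))"
  have D: "(\<phi> has_derivative ?D) (at (x + h *\<^sub>R b))"
    using assms smooth_imp_differentiable frechet_derivative_works by blast
  have "((\<lambda>h. x + h *\<^sub>R b) has_derivative (\<lambda>h. h *\<^sub>R b)) (at h)"
    by (auto intro!: derivative_eq_intros)
  from has_derivative_compose[OF this D]
  have "((\<lambda>h. \<phi> (x + h *\<^sub>R b)) has_derivative (\<lambda>h'. ?D (h' *\<^sub>R b))) (at h)" .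
  moreover have "?D (h' *\<^sub>R b) = ?D b * h'" for h'
    using linear_cmul[OF has_derivative_linear[OF D]] by simp
  ultimately show ?thesis unfolding has_field_derivative_def partial_deriv_def by simp
qed

lemma smooth_continuous_on: "smooth \<phi> \<Longrightarrow> continuous_on S \<phi>"
  using smooth_imp_differentiable differentiable_imp_continuous_within
  by (metis continuous_at_imp_continuous_on)

lemma test_function_continuous: "\<phi> \<in> test_functions \<Longrightarrow> continuous_on S \<phi>"
  unfolding test_functions_iff by (blast intro: smooth_continuous_on)

lemma test_function_bounded:
  assumes "\<phi> \<in> test_functions"
  obtains C M where "\<And>x. \<bar>\<phi> x\<bar> \<le> C" "\<And>x. \<phi> x \<noteq> 0 \<Longrightarrow> norm x \<le> M"
proof -
  obtain M where M: "\<And>x. \<phi> x \<noteq> 0 \<Longrightarrow> norm x \<le> M"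
    using assms unfolding test_functions_iff by blast
  have "compact (\<phi> ` cball 0 M)"
    by (rule compact_continuous_image[OF test_function_continuous[OF assms]]) simp
  then obtain C where C: "\<And>x. x \<in> cball 0 M \<Longrightarrow> \<bar>\<phi> x\<bar> \<le> C"
    using compact_imp_bounded bounded_iff by (metis (no_types, lifting) imageI real_norm_def)
  have "\<bar>\<phi> x\<bar> \<le> \<bar>C\<bar>" for x
    using C[of x] M[of x] by (cases "\<phi> x = 0") auto
  then show ?thesis using M that by blast
qed

section \<open>Bump functions\<close>

definition flat_exp :: "nat \<Rightarrow> real \<Rightarrow> real" where
  "flat_exp m s = (if s \<le> 0 then 0 else exp (- 1 / s) / s ^ m)"

lemma flat_exp_nonneg: "0 \<le> flat_exp m s" by (simp add: flat_exp_def)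

lemma power_div_fact_le_exp: "0 \<le> (x::real) \<Longrightarrow> x ^ n / fact n \<le> exp x"
  using sum_le_suminf[of "\<lambda>n. x ^ n / fact n" "{n}"] summable_exp[of x]
  by (simp add: exp_def divide_inverse mult.commute)

text \<open>All of these functions vanish to second order at \<open>0\<close>, which makes them differentiable there; the exponential
  series supplies the power of \<open>h\<close>.\<close>

lemma flat_exp_le: "\<bar>flat_exp m h\<bar> \<le> fact (m + 2) * h\<^sup>2"
proof (cases "h \<le> 0")
  case False
  then have h: "h > 0" by simp
  have "(1 / h) ^ (m + 2) / fact (m + 2) \<le> exp (1 / h)" by (rule power_div_fact_le_exp) (use h in simp)
  then have "1 \<le> exp (1 / h) * (fact (m + 2) * h ^ (m + 2))"
    using h by (simp add: field_simps power_divide del: power_Suc fact_Suc)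
  then have "exp (- 1 / h) \<le> fact (m + 2) * h ^ (m + 2)"
    by (simp add: exp_minus field_simps)
  then have "exp (- 1 / h) / h ^ m \<le> fact (m + 2) * h ^ (m + 2) / h ^ m"
    using h by (intro divide_right_mono) auto
  also have "\<dots> = fact (m + 2) * h\<^sup>2" using h by (simp add: power_add power2_eq_square)
  finally show ?thesis using h by (simp add: flat_exp_def)
qed (simp add: flat_exp_def)

lemma flat_exp_has_derivative:
  "(flat_exp m has_real_derivative flat_exp (m + 2) s - real m * flat_exp (m + 1) s) (at s)"
proof -
  consider "s < 0" | "s = 0" | "s > 0" by linarith
  then show ?thesis
  proof cases
    case 1
    have "(flat_exp m has_real_derivative 0) (at s)"
      by (rule has_field_derivative_transform_within_open[OF DERIV_const, of "{..<0}"]) (use 1 in \<open>auto simp: flat_exp_def\<close>)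
    then show ?thesis using 1 by (simp add: flat_exp_def)
  next
    case 2
    have "((\<lambda>h. flat_exp m h / h) \<longlongrightarrow> 0) (at 0)"
    proof (rule Lim_null_comparison)
      have "norm (flat_exp m h / h) \<le> fact (m + 2) * \<bar>h\<bar>" for h
      proof (cases "h = 0")
        case False
        have "\<bar>flat_exp m h\<bar> / \<bar>h\<bar> \<le> fact (m + 2) * h\<^sup>2 / \<bar>h\<bar>"
          using flat_exp_le[of m h] by (rule divide_right_mono) simp
        also have "h\<^sup>2 = \<bar>h\<bar> * \<bar>h\<bar>" by (simp add: power2_eq_square)
        also have "fact (m + 2) * (\<bar>h\<bar> * \<bar>h\<bar>) / \<bar>h\<bar> = fact (m + 2) * \<bar>h\<bar>"
          using False nonzero_mult_div_cancel_right[of "\<bar>h\<bar>" "fact (m + 2) * \<bar>h\<bar>"]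
            by (simp only: mult.assoc abs_eq_0) simp
        finally show ?thesis by simp
      qed simp
      then show "\<forall>\<^sub>F h in at 0. norm (flat_exp m h / h) \<le> fact (m + 2) * \<bar>h\<bar>"
        by simp
      show "((\<lambda>h. fact (m + 2) * \<bar>h\<bar>) \<longlongrightarrow> (0::real)) (at 0)"
        by (rule tendsto_eq_intros refl)+ simp
    qed
    then show ?thesis using 2 by (simp add: has_field_derivative_iff flat_exp_def)
  next
    case 3
    have "((\<lambda>s. exp (- 1 / s) / s ^ m) has_real_derivative flat_exp (m + 2) s - real m * flat_exp (m + 1) s) (at s)"
    proof -
      have "((\<lambda>s. - 1 / s) has_real_derivative 1 / (s * s)) (at s)"
        using 3 by (auto intro!: derivative_eq_intros)
      then have e: "((\<lambda>s. exp (- 1 / s)) has_real_derivative exp (- 1 / s) * (1 / (s * s))) (at s)"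
        by (rule DERIV_chain2[OF DERIV_exp])
      have "((\<lambda>s. s ^ m) has_real_derivative real m * s ^ m / s) (at s)"
        using DERIV_pow[of m s UNIV] 3 by (cases m) auto
      from DERIV_divide[OF e this] show ?thesis
        by (rule DERIV_cong) (use 3 in \<open>simp_all add: flat_exp_def power_add power2_eq_square field_simps\<close>)
    qed
    then show ?thesis
      by (rule has_field_derivative_transform_within_open[of _ _ _ "{0<..}"]) (use 3 in \<open>auto simp: flat_exp_def\<close>)
  qed
qed

lemma continuous_on_flat_exp [continuous_intros]:
  "continuous_on S f \<Longrightarrow> continuous_on S (\<lambda>x. flat_exp m (f x))"
  by (rule continuous_on_compose2[of UNIV "flat_exp m"])
     (auto intro: DERIV_continuous_on has_field_derivative_at_within flat_exp_has_derivative)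

definition bump :: "'a::euclidean_space \<Rightarrow> real \<Rightarrow> 'a \<Rightarrow> real" where
  "bump z e x = flat_exp 0 (e - (norm (x - z))\<^sup>2)"

text \<open>The algebra generated by the radial functions \<open>flat_exp m (e - |x - z|\<^sup>2)\<close> and the coordinates is closed under partial
  derivatives. Bumps are smooth because they lie in it.\<close>

inductive_set bump_algebra :: "'a::euclidean_space \<Rightarrow> real \<Rightarrow> ('a \<Rightarrow> real) set" for z e where
  const: "(\<lambda>x. c) \<in> bump_algebra z e"
| coord: "(\<lambda>x. (x - z) \<bullet> v) \<in> bump_algebra z e"
| radial: "(\<lambda>x. flat_exp m (e - (norm (x - z))\<^sup>2)) \<in> bump_algebra z e"
| add: "f \<in> bump_algebra z e \<Longrightarrow> g \<in> bump_algebra z e \<Longrightarrow> (\<lambda>x. f x + g x) \<in> bump_algebra z e"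
| mult: "f \<in> bump_algebra z e \<Longrightarrow> g \<in> bump_algebra z e \<Longrightarrow> (\<lambda>x. f x * g x) \<in> bump_algebra z e"

lemma has_derivative_radial_flat_exp:
  "((\<lambda>x. flat_exp m (e - (norm (x - z))\<^sup>2)) has_derivative
     (\<lambda>h. (flat_exp (m + 2) (e - (norm (x - z))\<^sup>2) + (- real m) * flat_exp (m + 1) (e - (norm (x - z))\<^sup>2)) * (-2 * ((x - z) \<bullet> h)))) (at x)"
proof -
  have "((\<lambda>x. e - (x - z) \<bullet> (x - z)) has_derivative (\<lambda>h. -2 * ((x - z) \<bullet> h))) (at x)"
    by (rule derivative_eq_intros refl)+ (simp add: inner_commute)
  then have "((\<lambda>x. e - (norm (x - z))\<^sup>2) has_derivative (\<lambda>h. -2 * ((x - z) \<bullet> h))) (at x)"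
    by (simp only: dot_square_norm)
  from has_derivative_compose[OF this flat_exp_has_derivative[of m "e - (norm (x - z))\<^sup>2", unfolded has_field_derivative_def]]
  show ?thesis by simp
qed

lemma bump_algebra_closed:
  assumes "f \<in> bump_algebra z e"
  shows "\<exists>D. \<forall>x. (f has_derivative D x) (at x) \<and> (\<forall>v. (\<lambda>x. D x v) \<in> bump_algebra z e)"
  using assms
proof induction
  case (const c)
  show ?case by (rule exI[of _ "\<lambda>x h. 0"]) (auto intro: bump_algebra.intros)
next
  case (coord v)
  show ?case by (rule exI[of _ "\<lambda>x h. h \<bullet> v"]) (auto intro: bump_algebra.intros intro!: derivative_eq_intros)
next
  case (radial m)
  show ?case
  proof (intro exI allI conjI)
    show "(\<lambda>x. (flat_exp (m + 2) (e - (norm (x - z))\<^sup>2) + (- real m) * flat_exp (m + 1) (e - (norm (x - z))\<^sup>2)) * (-2 * ((x - z) \<bullet> v)))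
      \<in> bump_algebra z e" for v
      by (intro bump_algebra.intros)
  qed (rule has_derivative_radial_flat_exp)
next
  case (add f g)
  then obtain D E where "\<And>x. (f has_derivative D x) (at x)" "\<And>v. (\<lambda>x. D x v) \<in> bump_algebra z e"
    "\<And>x. (g has_derivative E x) (at x)" "\<And>v. (\<lambda>x. E x v) \<in> bump_algebra z e" by metis
  then show ?case
    by (intro exI[of _ "\<lambda>x h. D x h + E x h"]) (auto intro: bump_algebra.intros intro!: derivative_intros)
next
  case (mult f g)
  then obtain D E where DE: "\<And>x. (f has_derivative D x) (at x)" "\<And>v. (\<lambda>x. D x v) \<in> bump_algebra z e"
    "\<And>x. (g has_derivative E x) (at x)" "\<And>v. (\<lambda>x. E x v) \<in> bump_algebra z e" by metis
  show ?case
    by (rule exI[of _ "\<lambda>x h. f x * E x h + D x h * g x"])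
       (use DE mult.hyps in \<open>auto intro!: bump_algebra.intros(4,5) has_derivative_mult\<close>)
qed

lemma smooth_bump_algebra: "f \<in> bump_algebra z e \<Longrightarrow> smooth f"
proof (erule smooth_coinduct)
  fix g and x b :: 'a assume g: "g \<in> bump_algebra z e"
  then obtain D where D: "\<And>x. (g has_derivative D x) (at x)" "\<And>v. (\<lambda>x. D x v) \<in> bump_algebra z e"
    using bump_algebra_closed by metis
  show "g differentiable (at x)" using D differentiable_def by blast
  have "partial_deriv b g = (\<lambda>x. D x b)" by (intro ext partial_deriv_eqI D(1))
  then show "partial_deriv b g \<in> bump_algebra z e" using D(2) by simp
qed

lemma bump_test_function: "bump z e \<in> test_functions"
proof -
  have "smooth (bump z e)" unfolding bump_def[abs_def] by (rule smooth_bump_algebra[OF bump_algebra.radial])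
  moreover have "norm x \<le> norm z + (\<bar>e\<bar> + 1)" if "bump z e x \<noteq> 0" for x
  proof -
    have "(norm (x - z))\<^sup>2 < e" using that by (auto simp: bump_def flat_exp_def split: if_splits)
    also have "e \<le> (\<bar>e\<bar> + 1) * 1" by simp
    also have "\<dots> \<le> (\<bar>e\<bar> + 1)\<^sup>2"
      unfolding power2_eq_square by (intro mult_left_mono) auto
    finally have "norm (x - z) < \<bar>e\<bar> + 1" by (rule power2_less_imp_less) simp
    then show ?thesis using norm_triangle_sub[of x z] by simp
  qed
  ultimately show ?thesis unfolding test_functions_iff by blast
qed

lemma bump_nonneg: "0 \<le> bump z e x" by (simp add: bump_def flat_exp_nonneg)

lemma bump_pos_iff: "0 < bump z e x \<longleftrightarrow> (norm (x - z))\<^sup>2 < e"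
  by (auto simp: bump_def flat_exp_def)

text \<open>The first and second derivative of a bump in the direction \<open>b\<close>, written out because they depend on \<open>x - z\<close>
  only, the second one evenly. This symmetry lets a bump be differentiated in its centre instead.\<close>

definition bump1 :: "'a::euclidean_space \<Rightarrow> real \<Rightarrow> 'a \<Rightarrow> 'a \<Rightarrow> real" where
  "bump1 z e b x = flat_exp 2 (e - (norm (x - z))\<^sup>2) * (-2 * ((x - z) \<bullet> b))"

definition bump2 :: "'a::euclidean_space \<Rightarrow> real \<Rightarrow> 'a \<Rightarrow> 'a \<Rightarrow> real" where
  "bump2 z e b x = (flat_exp 4 (e - (norm (x - z))\<^sup>2) - 2 * flat_exp 3 (e - (norm (x - z))\<^sup>2)) * (-2 * ((x - z) \<bullet> b))\<^sup>2
     + flat_exp 2 (e - (norm (x - z))\<^sup>2) * (-2 * (b \<bullet> b))"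

lemma bump_partials: "partial_deriv b (bump z e) x = bump1 z e b x" "partial_deriv b (bump1 z e b) x = bump2 z e b x"
proof -
  show "partial_deriv b (bump z e) x = bump1 z e b x"
    using partial_deriv_eqI[OF has_derivative_radial_flat_exp[of 0 e z x]]
      by (simp add: bump_def[abs_def] bump1_def eval_nat_numeral)
  have "((\<lambda>x. flat_exp 2 (e - (norm (x - z))\<^sup>2) * (-2 * ((x - z) \<bullet> b))) has_derivative
     (\<lambda>h. flat_exp 2 (e - (norm (x - z))\<^sup>2) * (-2 * (h \<bullet> b)) +
       ((flat_exp (2 + 2) (e - (norm (x - z))\<^sup>2) + (- real 2) * flat_exp (2 + 1) (e - (norm (x - z))\<^sup>2)) * (-2 * ((x - z) \<bullet> h))) *
        (-2 * ((x - z) \<bullet> b)))) (at x)"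
    by (rule has_derivative_mult[OF has_derivative_radial_flat_exp]) (auto intro!: derivative_eq_intros)
  from partial_deriv_eqI[OF this, of b]
  have "partial_deriv b (bump1 z e b) x = flat_exp 2 (e - (norm (x - z))\<^sup>2) * (-2 * (b \<bullet> b)) +
       ((flat_exp (2 + 2) (e - (norm (x - z))\<^sup>2) + (- real 2) * flat_exp (2 + 1) (e - (norm (x - z))\<^sup>2)) * (-2 * ((x - z) \<bullet> b))) *
        (-2 * ((x - z) \<bullet> b))"
    unfolding bump1_def[abs_def] .
  also have "\<dots> = bump2 z e b x" by (simp add: bump2_def power2_eq_square)
  finally show "partial_deriv b (bump1 z e b) x = bump2 z e b x" .
qed

lemma laplacian_bump: "laplacian (bump z e) x = (\<Sum>b\<in>Basis. bump2 z e b x)"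
proof -
  have "partial_deriv b (bump z e) = bump1 z e b" for b by (intro ext bump_partials(1))
  then show ?thesis by (simp add: laplacian_def bump_partials)
qed

section \<open>Integration by parts for radial functions with Lipschitz gradient\<close>

lemma integrable_continuous_compact_support:
  fixes f :: "'a::euclidean_space \<Rightarrow> real"
  assumes "continuous_on UNIV f" "\<And>x. norm x > M \<Longrightarrow> f x = 0"
  shows "integrable lborel f"
proof -
  have "integrable lborel (\<lambda>x. indicator (cball 0 M) x *\<^sub>R f x)"
    by (intro borel_integrable_compact continuous_on_subset[OF assms(1)]) auto
  moreover have "indicator (cball 0 M) x *\<^sub>R f x = f x" for x
    using assms(2)[of x] by (auto simp: indicator_def)
  ultimately show ?thesis by (simp only:)
qed

lemma integrable_continuous_mult_test_function:
  assumes F: "continuous_on UNIV F" and \<phi>: "\<phi> \<in> test_functions"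
  shows "integrable lborel (\<lambda>x. F x * \<phi> x)"
proof -
  obtain M where M: "\<And>x. \<phi> x \<noteq> 0 \<Longrightarrow> norm x \<le> M"
    using \<phi> unfolding test_functions_iff by blast
  show ?thesis
  proof (rule integrable_continuous_compact_support[of _ M])
    show "continuous_on UNIV (\<lambda>x. F x * \<phi> x)"
      by (intro continuous_on_mult F test_function_continuous \<phi>)
    show "F x * \<phi> x = 0" if "norm x > M" for x using M[of x] that by auto
  qed
qed

text \<open>The integral of a difference quotient of \<open>F\<close> vanishes by translation invariance, and the Lipschitz bound
  permits dominated convergence. Exceptional null sets, such as the sphere where a glued function has a
  discontinuous second derivative, do no harm.\<close>

lemma integral_line_derivative_eq_0:
  fixes F D :: "'a::euclidean_space \<Rightarrow> real" and b :: 'a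
  assumes cont: "continuous_on UNIV F"
    and lip: "\<And>x h. \<bar>h\<bar> \<le> 1 \<Longrightarrow> \<bar>F (x + h *\<^sub>R b) - F x\<bar> \<le> L * \<bar>h\<bar>"
    and supp: "\<And>x. norm x > M \<Longrightarrow> F x = 0"
    and D[measurable]: "D \<in> borel_measurable borel"
    and deriv: "AE x in lborel. ((\<lambda>h. F (x + h *\<^sub>R b)) has_real_derivative D x) (at 0)"
  shows "integrable lborel D" "(LINT x|lborel. D x) = 0"
proof -
  have F: "integrable lborel F" using integrable_continuous_compact_support[OF cont supp] .
  have [measurable]: "F \<in> borel_measurable borel"
    using cont by (rule borel_measurable_continuous_onI)
  define h where "h n = inverse (real (Suc n))" for n
  have h: "0 < h n" "h n \<le> 1" for n by (auto simp: h_def field_simps)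
  define s where "s n x = (F (x + h n *\<^sub>R b) - F x) / h n" for n x
  define w where "w x = L * indicator (cball 0 (M + norm b)) x" for x :: 'a
  have [measurable]: "s n \<in> borel_measurable lborel" for n unfolding s_def by measurable
  have w: "integrable lborel w"
    unfolding w_def by (intro integrable_mult_right integrable_real_indicator) (use emeasure_lborel_cball_finite[of "0::'a"] in auto)
  have L: "0 \<le> L" using lip[of 1 0] by auto
  have bound: "AE x in lborel. norm (s n x) \<le> w x" for n
  proof (intro AE_I2)
    fix x
    show "norm (s n x) \<le> w x"
    proof (cases "x \<in> cball 0 (M + norm b)")
      case True
      then show ?thesis using lip[of "h n" x] h[of n] by (simp add: s_def w_def abs_divide divide_le_eq)
    next
      case False
      have "norm (h n *\<^sub>R b) \<le> norm b" using h[of n] by (simp add: mult_left_le_one_le)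
      moreover have "norm x \<le> norm (x + h n *\<^sub>R b) + norm (h n *\<^sub>R b)"
        using norm_triangle_ineq4[of "x + h n *\<^sub>R b" "h n *\<^sub>R b"] by simp
      ultimately have "norm (x + h n *\<^sub>R b) > M" using False by simp
      moreover have "norm x > M" using False norm_ge_zero[of b] unfolding mem_cball_0 by linarith
      ultimately have "s n x = 0" using supp by (simp add: s_def)
      then show ?thesis using L by (simp add: w_def)
    qed
  qed
  have lim: "AE x in lborel. (\<lambda>n. s n x) \<longlonglongrightarrow> D x"
    using deriv
  proof eventually_elim
    case (elim x)
    then have "((\<lambda>h. (F (x + h *\<^sub>R b) - F x) / h) \<longlongrightarrow> D x) (at 0)"
      by (simp add: has_field_derivative_iff)
    moreover have "filterlim h (at 0) sequentially"
      unfolding h_def filterlim_at using LIMSEQ_inverse_real_of_nat by auto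
    ultimately show ?case unfolding s_def by (rule filterlim_compose)
  qed
  show "integrable lborel D"
    by (rule integrable_dominated_convergence[OF _ _ w lim bound]) auto
  have "(\<lambda>n. LINT x|lborel. s n x) \<longlonglongrightarrow> (LINT x|lborel. D x)"
    by (rule integral_dominated_convergence[OF _ _ w lim bound]) auto
  moreover have "(LINT x|lborel. s n x) = 0" for n
  proof -
    have "distr lborel borel ((+) (h n *\<^sub>R b)) = (lborel :: 'a measure)" by (rule lborel_distr_plus)
    then have "(LINT x|lborel. F x) = (LINT x|distr lborel borel ((+) (h n *\<^sub>R b)). F x)" by simp
    also have "\<dots> = (LINT x|lborel. F (h n *\<^sub>R b + x))" by (subst integral_distr) auto
    finally have e: "(LINT x|lborel. F (x + h n *\<^sub>R b)) = (LINT x|lborel. F x)" by (simp add: add.commute)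
    have "integrable (distr lborel borel ((+) (h n *\<^sub>R b))) F" using F by (simp add: lborel_distr_plus)
    then have "integrable lborel (\<lambda>x. F (x + h n *\<^sub>R b))"
      by (subst (asm) integrable_distr_eq) (auto simp: add.commute)
    with F e show ?thesis unfolding s_def by simp
  qed
  ultimately show "(LINT x|lborel. D x) = 0" by (simp add: LIMSEQ_const_iff)
qed

text \<open>Lipschitz continuity in one direction only: this is what \<open>integral_line_derivative_eq_0\<close> asks for, and it follows
  from a bound on a single directional derivative.\<close>

definition line_lipschitz :: "'a::euclidean_space \<Rightarrow> 'a set \<Rightarrow> ('a \<Rightarrow> real) \<Rightarrow> bool" where
  "line_lipschitz b S f \<longleftrightarrow> (\<exists>L. \<forall>x\<in>S. \<forall>h. x + h *\<^sub>R b \<in> S \<longrightarrow> \<bar>f (x + h *\<^sub>R b) - f x\<bar> \<le> L * \<bar>h\<bar>)"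

lemma continuous_bounded_on_compact:
  fixes f :: "'a::euclidean_space \<Rightarrow> real"
  assumes "continuous_on UNIV f" "compact S"
  obtains C where "C \<ge> 0" "\<And>x. x \<in> S \<Longrightarrow> \<bar>f x\<bar> \<le> C"
proof -
  have "compact (f ` S)" by (rule compact_continuous_image[OF continuous_on_subset[OF assms(1)] assms(2)]) simp
  then have "bounded (f ` S)" by (rule compact_imp_bounded)
  then obtain C where "\<And>x. x \<in> S \<Longrightarrow> \<bar>f x\<bar> \<le> C"
    unfolding bounded_iff by auto
  then show ?thesis using that[of "\<bar>C\<bar>"] by force
qed

lemma line_lipschitz_mult:
  assumes "line_lipschitz b S f" "line_lipschitz b S g" "continuous_on UNIV f" "continuous_on UNIV g" "compact S"
  shows "line_lipschitz b S (\<lambda>x. f x * g x)"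
proof -
  obtain L1 L2 where L: "\<And>x h. x \<in> S \<Longrightarrow> x + h *\<^sub>R b \<in> S \<Longrightarrow> \<bar>f (x + h *\<^sub>R b) - f x\<bar> \<le> L1 * \<bar>h\<bar>"
    "\<And>x h. x \<in> S \<Longrightarrow> x + h *\<^sub>R b \<in> S \<Longrightarrow> \<bar>g (x + h *\<^sub>R b) - g x\<bar> \<le> L2 * \<bar>h\<bar>"
    using assms(1,2) unfolding line_lipschitz_def by blast
  obtain C1 where C1: "C1 \<ge> 0" "\<And>x. x \<in> S \<Longrightarrow> \<bar>f x\<bar> \<le> C1"
    using continuous_bounded_on_compact assms by blast
  obtain C2 where C2: "C2 \<ge> 0" "\<And>x. x \<in> S \<Longrightarrow> \<bar>g x\<bar> \<le> C2"
    using continuous_bounded_on_compact assms by blast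
  have "\<bar>f (x + h *\<^sub>R b) * g (x + h *\<^sub>R b) - f x * g x\<bar> \<le> (C1 * L2 + C2 * L1) * \<bar>h\<bar>"
    if x: "x \<in> S" "x + h *\<^sub>R b \<in> S" for x h
  proof -
    have "\<bar>f (x + h *\<^sub>R b) * g (x + h *\<^sub>R b) - f x * g x\<bar>
       = \<bar>f (x + h *\<^sub>R b) * (g (x + h *\<^sub>R b) - g x) + g x * (f (x + h *\<^sub>R b) - f x)\<bar>" by (simp add: algebra_simps)
    also have "\<dots> \<le> \<bar>f (x + h *\<^sub>R b)\<bar> * \<bar>g (x + h *\<^sub>R b) - g x\<bar> + \<bar>g x\<bar> * \<bar>f (x + h *\<^sub>R b) - f x\<bar>"
      by (metis abs_mult abs_triangle_ineq)
    also have "\<dots> \<le> C1 * (L2 * \<bar>h\<bar>) + C2 * (L1 * \<bar>h\<bar>)"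
      by (intro add_mono mult_mono C1 C2 L x) auto
    finally show ?thesis by (simp add: algebra_simps)
  qed
  then show ?thesis unfolding line_lipschitz_def by blast
qed

lemma line_lipschitz_diff:
  assumes "line_lipschitz b S f" "line_lipschitz b S g"
  shows "line_lipschitz b S (\<lambda>x. f x - g x)"
proof -
  obtain L1 L2 where L: "\<And>x h. x \<in> S \<Longrightarrow> x + h *\<^sub>R b \<in> S \<Longrightarrow> \<bar>f (x + h *\<^sub>R b) - f x\<bar> \<le> L1 * \<bar>h\<bar>"
    "\<And>x h. x \<in> S \<Longrightarrow> x + h *\<^sub>R b \<in> S \<Longrightarrow> \<bar>g (x + h *\<^sub>R b) - g x\<bar> \<le> L2 * \<bar>h\<bar>"
    using assms(1,2) unfolding line_lipschitz_def by blast
  have "\<bar>(f (x + h *\<^sub>R b) - g (x + h *\<^sub>R b)) - (f x - g x)\<bar> \<le> (L1 + L2) * \<bar>h\<bar>"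
    if x: "x \<in> S" "x + h *\<^sub>R b \<in> S" for x h
    using L(1)[OF x] L(2)[OF x] by (simp add: distrib_right)
  then show ?thesis unfolding line_lipschitz_def by blast
qed

lemma line_lipschitz_of_derivative:
  assumes der: "\<And>x h. ((\<lambda>h. f (x + h *\<^sub>R b)) has_real_derivative D (x + h *\<^sub>R b)) (at h)"
    and D: "continuous_on UNIV D" and S: "compact S" "convex S"
  shows "line_lipschitz b S f"
proof -
  obtain C where C: "C \<ge> 0" "\<And>x. x \<in> S \<Longrightarrow> \<bar>D x\<bar> \<le> C"
    using continuous_bounded_on_compact[OF D S(1)] by blast
  have "\<bar>f (x + h *\<^sub>R b) - f x\<bar> \<le> C * \<bar>h\<bar>" if x: "x \<in> S" "x + h *\<^sub>R b \<in> S" for x h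
  proof -
    let ?I = "{t. x + t *\<^sub>R b \<in> S}"
    have "convex ?I"
    proof (rule convexI)
      fix s t u v :: real assume a: "s \<in> ?I" "t \<in> ?I" "0 \<le> u" "0 \<le> v" "u + v = 1"
      have "x + (u *\<^sub>R s + v *\<^sub>R t) *\<^sub>R b = u *\<^sub>R (x + s *\<^sub>R b) + v *\<^sub>R (x + t *\<^sub>R b)"
        using a(5) by (simp add: algebra_simps flip: scaleR_add_left)
      then show "u *\<^sub>R s + v *\<^sub>R t \<in> ?I" using convexD[OF S(2)] a by auto
    qed
    moreover have "norm ((\<lambda>h. f (x + h *\<^sub>R b)) h - (\<lambda>h. f (x + h *\<^sub>R b)) 0) \<le> C * norm (h - 0)" if "convex ?I"
      by (rule field_differentiable_bound[OF that, of _ "\<lambda>h. D (x + h *\<^sub>R b)"])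
         (use x C der in \<open>auto intro: has_field_derivative_at_within\<close>)
    ultimately show ?thesis by simp
  qed
  then show ?thesis unfolding line_lipschitz_def by blast
qed

lemma AE_not_in_sphere: "AE x in lborel. (x::'a::euclidean_space) \<notin> sphere z r"
proof -
  have "sphere z r \<in> null_sets lborel"
    using negligible_sphere[of z r] by (auto simp: null_sets_completion_iff negligible_iff_null_sets)
  then show ?thesis by (rule AE_not_in)
qed

lemma radial_line_derivative:
  fixes z :: "'a::euclidean_space"
  assumes "(P has_real_derivative P1) (at (\<sigma> * (norm (x + h *\<^sub>R b - z))\<^sup>2))"
  shows "((\<lambda>h. P (\<sigma> * (norm (x + h *\<^sub>R b - z))\<^sup>2)) has_real_derivative P1 * (2 * \<sigma> * ((x + h *\<^sub>R b - z) \<bullet> b))) (at h)"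
proof -
  have "((\<lambda>h. \<sigma> * ((x + h *\<^sub>R b - z) \<bullet> (x + h *\<^sub>R b - z))) has_vector_derivative 2 * \<sigma> * ((x + h *\<^sub>R b - z) \<bullet> b)) (at h)"
    unfolding has_vector_derivative_def
    by (rule derivative_eq_intros refl)+ (auto simp: inner_commute algebra_simps)
  then have "((\<lambda>h. \<sigma> * (norm (x + h *\<^sub>R b - z))\<^sup>2) has_real_derivative 2 * \<sigma> * ((x + h *\<^sub>R b - z) \<bullet> b)) (at h)"
    by (simp only: dot_square_norm has_real_derivative_iff_has_vector_derivative)
  from DERIV_chain2[OF assms this] show ?thesis .
qed

text \<open>The function \<open>F = V \<partial>\<^sub>b\<phi> - \<phi> \<partial>\<^sub>bV\<close> is Lipschitz with compact support, and its derivative in the direction \<open>b\<close>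
  is \<open>V \<partial>\<^sub>b\<^sub>b\<phi> - \<phi> \<partial>\<^sub>b\<^sub>bV\<close> off one sphere. Summing over \<open>b\<close> gives Green's identity; \<open>LV\<close> is the Laplacian of
  the radial function \<open>V\<close>.\<close>

lemma integral_radial_laplacian:
  fixes z :: "'a::euclidean_space" and \<phi> :: "'a \<Rightarrow> real"
  assumes \<sigma>: "\<sigma> > 0"
    and P: "\<And>t. (P has_real_derivative P1 t) (at t)"
    and P1: "\<And>t. t \<noteq> t0 \<Longrightarrow> (P1 has_real_derivative P2 t) (at t)"
    and lip: "\<And>K. \<exists>L. L-lipschitz_on {0..K} P1"
    and P2[measurable]: "P2 \<in> borel_measurable borel"
    and \<phi>: "\<phi> \<in> test_functions"
  defines "V \<equiv> \<lambda>x. P (\<sigma> * (norm (x - z))\<^sup>2)"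
    and "LV \<equiv> \<lambda>x. 4 * \<sigma> * (\<sigma> * (norm (x - z))\<^sup>2) * P2 (\<sigma> * (norm (x - z))\<^sup>2) + 2 * \<sigma> * DIM('a) * P1 (\<sigma> * (norm (x - z))\<^sup>2)"
  shows "(LINT x|lborel. V x * laplacian \<phi> x) = (LINT x|lborel. \<phi> x * LV x)"
    and "integrable lborel (\<lambda>x. \<phi> x * LV x)"
proof -
  define t where "t x = \<sigma> * (norm (x - z))\<^sup>2" for x :: 'a
  have P1c: "continuous_on {0..} P1"
    unfolding continuous_on_eq_continuous_within
  proof
    fix s :: real assume "s \<in> {0..}"
    obtain L where "L-lipschitz_on {0..s + 1} P1" using lip by blast
    then have "continuous_on {0..s + 1} P1" by (rule lipschitz_on_continuous_on)
    then have "continuous (at s within {0..s + 1}) P1"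
      using \<open>s \<in> {0..}\<close> by (simp add: continuous_on_eq_continuous_within)
    moreover have "at s within {0..s + 1} = at s within {0..}"
      by (rule at_within_nhd[of _ "{..<s + 1}"]) (use \<open>s \<in> {0..}\<close> in auto)
    ultimately show "continuous (at s within {0..}) P1" by simp
  qed
  have tc: "continuous_on UNIV t" unfolding t_def by (intro continuous_intros)
  have t0: "t x \<ge> 0" for x using \<sigma> by (simp add: t_def)
  have Pc: "continuous_on UNIV P" using P by (rule DERIV_continuous_on)
  have Vc: "continuous_on UNIV V"
    unfolding V_def by (intro continuous_on_compose2[OF Pc] continuous_intros) auto
  have P1tc: "continuous_on UNIV (\<lambda>x. P1 (t x))"
    by (rule continuous_on_compose2[OF P1c tc]) (use t0 in auto)
  have [measurable]: "P1 \<circ> t \<in> borel_measurable borel" "V \<in> borel_measurable borel" "t \<in> borel_measurable borel"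
    using P1tc Vc tc by (auto intro: borel_measurable_continuous_onI simp: comp_def)
  obtain M where M: "\<And>x. \<phi> x \<noteq> 0 \<Longrightarrow> norm x \<le> M"
    using \<phi> unfolding test_functions_iff by blast
  have sm: "smooth \<phi>" using \<phi> unfolding test_functions_iff by blast
  have [measurable]: "\<phi> \<in> borel_measurable borel"
    by (rule borel_measurable_continuous_onI[OF test_function_continuous[OF \<phi>]])
  define D where "D b x = V x * partial_deriv b (partial_deriv b \<phi>) x
     - \<phi> x * (P2 (t x) * (2 * \<sigma> * ((x - z) \<bullet> b))\<^sup>2 + P1 (t x) * (2 * \<sigma>))" for b x
  have key: "integrable lborel (D b) \<and> (LINT x|lborel. D b x) = 0" if b: "b \<in> Basis" for b
  proof -
    have sm1: "smooth (partial_deriv b \<phi>)" using sm b by (rule smooth_partial_deriv)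
    have sm2: "smooth (partial_deriv b (partial_deriv b \<phi>))" using sm1 b by (rule smooth_partial_deriv)
    define G where "G x = P1 (t x) * (2 * \<sigma> * ((x - z) \<bullet> b))" for x
    have Gc: "continuous_on UNIV G" unfolding G_def by (intro continuous_intros P1tc)
    define F where "F x = V x * partial_deriv b \<phi> x - \<phi> x * G x" for x
    have \<phi>c: "continuous_on UNIV \<phi>" "continuous_on UNIV (partial_deriv b \<phi>)" "continuous_on UNIV (partial_deriv b (partial_deriv b \<phi>))"
      using sm sm1 sm2 smooth_continuous_on by blast+
    have Fc: "continuous_on UNIV F" unfolding F_def by (intro continuous_intros Vc Gc \<phi>c)
    have F0: "F x = 0" if "norm x > M" for x
      using that M[of x] partial_deriv_outside_support[of \<phi> M x b] M by (fastforce simp: F_def)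
    have nb: "norm b = 1" using b by simp
    let ?S = "cball 0 (M + 2) :: 'a set"
    have Vd: "((\<lambda>h. V (x + h *\<^sub>R b)) has_real_derivative G (x + h *\<^sub>R b)) (at h)" for x h
      unfolding V_def G_def t_def by (rule radial_line_derivative[OF P])
    have lV: "line_lipschitz b ?S V" by (rule line_lipschitz_of_derivative[OF Vd Gc]) auto
    have l1: "line_lipschitz b ?S \<phi>"
      by (rule line_lipschitz_of_derivative[OF smooth_has_line_derivative[OF sm] \<phi>c(2)]) auto
    have l2: "line_lipschitz b ?S (partial_deriv b \<phi>)"
      by (rule line_lipschitz_of_derivative[OF smooth_has_line_derivative[OF sm1] \<phi>c(3)]) auto
    have td: "((\<lambda>h. t (x + h *\<^sub>R b)) has_real_derivative 2 * \<sigma> * ((x + h *\<^sub>R b - z) \<bullet> b)) (at h)" for x h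
      using radial_line_derivative[of "\<lambda>t. t" 1 \<sigma> x h b z] by (simp add: t_def)
    have lt: "line_lipschitz b ?S t"
      by (rule line_lipschitz_of_derivative[OF td]) (auto intro!: continuous_intros)
    have ll: "line_lipschitz b ?S (\<lambda>x. 2 * \<sigma> * ((x - z) \<bullet> b))"
    proof (rule line_lipschitz_of_derivative)
      show "((\<lambda>h. 2 * \<sigma> * ((x + h *\<^sub>R b - z) \<bullet> b)) has_real_derivative 2 * \<sigma>) (at h)" for x h
        using b by (auto intro!: derivative_eq_intros simp: inner_add_left inner_diff_left)
    qed (auto intro!: continuous_intros)
    have lP1: "line_lipschitz b ?S (\<lambda>x. P1 (t x))"
    proof -
      obtain K where K: "\<And>x. x \<in> ?S \<Longrightarrow> \<bar>t x\<bar> \<le> K"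
        using continuous_bounded_on_compact[OF tc compact_cball] by blast
      obtain L where L: "L-lipschitz_on {0..K} P1" using lip by blast
      obtain L' where L': "\<And>x h. x \<in> ?S \<Longrightarrow> x + h *\<^sub>R b \<in> ?S \<Longrightarrow> \<bar>t (x + h *\<^sub>R b) - t x\<bar> \<le> L' * \<bar>h\<bar>"
        using lt unfolding line_lipschitz_def by blast
      have "\<bar>P1 (t (x + h *\<^sub>R b)) - P1 (t x)\<bar> \<le> L * L' * \<bar>h\<bar>" if x: "x \<in> ?S" "x + h *\<^sub>R b \<in> ?S" for x h
      proof -
        have "t (x + h *\<^sub>R b) \<in> {0..K}" "t x \<in> {0..K}" using K[OF x(1)] K[OF x(2)] t0 by auto
        from lipschitz_onD[OF L this] have "\<bar>P1 (t (x + h *\<^sub>R b)) - P1 (t x)\<bar> \<le> L * \<bar>t (x + h *\<^sub>R b) - t x\<bar>"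
          by (simp add: dist_real_def)
        also have "\<dots> \<le> L * (L' * \<bar>h\<bar>)"
          by (intro mult_left_mono L' x lipschitz_on_nonneg[OF L])
        finally show ?thesis by (simp add: mult.assoc)
      qed
      then show ?thesis unfolding line_lipschitz_def by blast
    qed
    have lF: "line_lipschitz b ?S F" unfolding F_def G_def
      by (intro line_lipschitz_diff line_lipschitz_mult lV l1 l2 lP1 ll Vc \<phi>c P1tc compact_cball continuous_intros)
    then obtain L where L: "\<And>x h. x \<in> ?S \<Longrightarrow> x + h *\<^sub>R b \<in> ?S \<Longrightarrow> \<bar>F (x + h *\<^sub>R b) - F x\<bar> \<le> L * \<bar>h\<bar>"
      unfolding line_lipschitz_def by blast
    have L': "\<bar>F (x + h *\<^sub>R b) - F x\<bar> \<le> \<bar>L\<bar> * \<bar>h\<bar>" if h: "\<bar>h\<bar> \<le> 1" for x h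
    proof (cases "norm x \<le> M + 1")
      case True
      have "norm (x + h *\<^sub>R b) \<le> norm x + norm (h *\<^sub>R b)" by (rule norm_triangle_ineq)
      then have "norm (x + h *\<^sub>R b) \<le> M + 2" using True h nb by simp
      then have "\<bar>F (x + h *\<^sub>R b) - F x\<bar> \<le> L * \<bar>h\<bar>" using True by (intro L) auto
      also have "\<dots> \<le> \<bar>L\<bar> * \<bar>h\<bar>" by (intro mult_right_mono) auto
      finally show ?thesis .
    next
      case False
      have "norm x \<le> norm (x + h *\<^sub>R b) + norm (h *\<^sub>R b)"
        using norm_triangle_ineq4[of "x + h *\<^sub>R b" "h *\<^sub>R b"] by simp
      then have "norm (x + h *\<^sub>R b) > M" using False h nb by simp
      then show ?thesis using False F0 by simp
    qed
    have [measurable]: "partial_deriv b (partial_deriv b \<phi>) \<in> borel_measurable borel"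
      by (rule borel_measurable_continuous_onI[OF \<phi>c(3)])
    have [measurable]: "(\<lambda>x. P1 (t x)) \<in> borel_measurable borel"
      by (rule borel_measurable_continuous_onI[OF P1tc])
    have Dm: "D b \<in> borel_measurable borel" unfolding D_def by measurable
    have "AE x in lborel. ((\<lambda>h. F (x + h *\<^sub>R b)) has_real_derivative D b x) (at 0)"
      using AE_not_in_sphere[of z "sqrt (t0 / \<sigma>)"]
    proof eventually_elim
      case (elim x)
      have ne: "t x \<noteq> t0"
      proof
        assume "t x = t0"
        then have "(norm (x - z))\<^sup>2 = t0 / \<sigma>" using \<sigma> by (simp add: t_def field_simps)
        then have "sqrt (t0 / \<sigma>) = norm (x - z)" by (metis norm_ge_zero real_sqrt_unique)
        then show False using elim by (simp add: dist_norm norm_minus_commute)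
      qed
      have dP1: "((\<lambda>h. P1 (t (x + h *\<^sub>R b))) has_real_derivative P2 (t x) * (2 * \<sigma> * ((x - z) \<bullet> b))) (at 0)"
        using radial_line_derivative[of P1 "P2 (t x)" \<sigma> x 0 b z] P1[OF ne] by (simp add: t_def)
      have dl: "((\<lambda>h. 2 * \<sigma> * ((x + h *\<^sub>R b - z) \<bullet> b)) has_real_derivative 2 * \<sigma>) (at 0)"
        using b by (auto intro!: derivative_eq_intros simp: inner_add_left inner_diff_left)
      have dG: "((\<lambda>h. G (x + h *\<^sub>R b)) has_real_derivative P2 (t x) * (2 * \<sigma> * ((x - z) \<bullet> b))\<^sup>2 + P1 (t x) * (2 * \<sigma>)) (at 0)"
        unfolding G_def by (rule DERIV_cong[OF DERIV_mult[OF dP1 dl]]) (simp add: power2_eq_square algebra_simps)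
      show ?case unfolding F_def
        by (rule DERIV_cong[OF DERIV_diff[OF DERIV_mult[OF Vd[of x 0] smooth_has_line_derivative[OF sm1, of x b 0]]
              DERIV_mult[OF smooth_has_line_derivative[OF sm, of x b 0] dG]]])
           (simp add: D_def algebra_simps)
    qed
    from integral_line_derivative_eq_0[OF Fc L' F0 Dm this] show ?thesis by blast
  qed
  have sumD: "(\<Sum>b\<in>Basis. D b x) = V x * laplacian \<phi> x - \<phi> x * LV x" for x
  proof -
    have "(\<Sum>b\<in>Basis. P2 (t x) * (2 * \<sigma> * ((x - z) \<bullet> b))\<^sup>2 + P1 (t x) * (2 * \<sigma>))
      = 4 * \<sigma> * \<sigma> * P2 (t x) * (\<Sum>b\<in>Basis. ((x - z) \<bullet> b) * ((x - z) \<bullet> b)) + DIM('a) * (P1 (t x) * (2 * \<sigma>))"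
      by (simp add: sum.distrib sum_distrib_left power2_eq_square mult_ac)
    also have "(\<Sum>b\<in>Basis. ((x - z) \<bullet> b) * ((x - z) \<bullet> b)) = (norm (x - z))\<^sup>2"
      by (simp only: euclidean_inner[symmetric] dot_square_norm)
    also have "4 * \<sigma> * \<sigma> * P2 (t x) * (norm (x - z))\<^sup>2 + DIM('a) * (P1 (t x) * (2 * \<sigma>)) = LV x"
      by (simp add: LV_def t_def)
    finally show ?thesis
      unfolding D_def sum_subtractf sum_distrib_left[symmetric] laplacian_def by simp
  qed
  have int: "integrable lborel (\<lambda>x. \<Sum>b\<in>Basis. D b x)"
    using key by (intro Bochner_Integration.integrable_sum) auto
  have int0: "(LINT x|lborel. (\<Sum>b\<in>Basis. D b x)) = 0"
    using key by (subst Bochner_Integration.integral_sum) auto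
  have intV: "integrable lborel (\<lambda>x. V x * laplacian \<phi> x)"
    by (intro integrable_continuous_mult_test_function Vc test_functions_laplacian \<phi>)
  have "(\<lambda>x. \<phi> x * LV x) = (\<lambda>x. V x * laplacian \<phi> x - (\<Sum>b\<in>Basis. D b x))"
    using sumD by auto
  then show "integrable lborel (\<lambda>x. \<phi> x * LV x)" using intV int by simp
  show "(LINT x|lborel. V x * laplacian \<phi> x) = (LINT x|lborel. \<phi> x * LV x)"
    using int0 intV \<open>integrable lborel (\<lambda>x. \<phi> x * LV x)\<close> unfolding sumD by simp
qed

section \<open>Maximum principle for smooth subsolutions\<close>

lemma second_derivative_local_max:
  fixes \<phi> :: "real \<Rightarrow> real"
  assumes d: "\<And>h. (\<phi> has_real_derivative \<phi>1 h) (at h)" and d2: "(\<phi>1 has_real_derivative c) (at 0)"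
    and \<epsilon>: "\<epsilon> > 0" and max: "\<And>h. \<bar>h\<bar> < \<epsilon> \<Longrightarrow> \<phi> h \<le> \<phi> 0"
  shows "c \<le> 0"
proof (rule ccontr)
  assume "\<not> c \<le> 0"
  then have c: "c > 0" by simp
  have z: "\<phi>1 0 = 0" by (rule DERIV_local_max[OF d \<epsilon>]) (use max in auto)
  obtain \<delta> where \<delta>: "\<delta> > 0" "\<And>h. 0 < h \<Longrightarrow> h < \<delta> \<Longrightarrow> \<phi>1 0 < \<phi>1 (0 + h)"
    using DERIV_pos_inc_right[OF d2 c] by blast
  define h where "h = min \<delta> \<epsilon> / 2"
  have h: "0 < h" "h < \<delta>" "h < \<epsilon>" using \<delta> \<epsilon> by (auto simp: h_def)
  have "\<phi> 0 < \<phi> h"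
  proof (rule DERIV_pos_imp_increasing_open[OF h(1)])
    fix x assume "0 < x" "x < h"
    then show "\<exists>y. (\<phi> has_real_derivative y) (at x) \<and> 0 < y"
      using d \<delta>(2)[of x] z h by auto
  next
    show "continuous_on {0..h} \<phi>"
      by (rule DERIV_continuous_on[where D=\<phi>1]) (use d in \<open>auto intro: has_field_derivative_at_within\<close>)
  qed
  then show False using max[of h] h by auto
qed

lemma line_derivative_shift:
  fixes f :: "'a::euclidean_space \<Rightarrow> real"
  assumes "\<And>x. ((\<lambda>h. f (x + h *\<^sub>R b)) has_real_derivative D x) (at 0)"
  shows "((\<lambda>h. f (x + h *\<^sub>R b)) has_real_derivative D (x + h *\<^sub>R b)) (at h)"
proof -
  have "(\<lambda>h'. f (x + (h + h') *\<^sub>R b)) = (\<lambda>h'. f (x + h *\<^sub>R b + h' *\<^sub>R b))"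
    by (simp add: scaleR_add_left add.assoc)
  then have "((\<lambda>h'. f (x + (h + h') *\<^sub>R b)) has_real_derivative D (x + h *\<^sub>R b)) (at 0)"
    using assms[of "x + h *\<^sub>R b"] by (simp only:)
  then show ?thesis using DERIV_shift[of "\<lambda>h. f (x + h *\<^sub>R b)" "D (x + h *\<^sub>R b)" 0 h]
    by (simp add: add.commute)
qed

text \<open>Divide \<open>d\<close> by \<open>f - \<delta>\<close> for a small constant \<open>\<delta> > 0\<close>. While \<open>f\<close> is only a solution, \<open>f - \<delta>\<close> is a strict
  supersolution: \<open>(\<Delta> + k\<^sup>2) (f - \<delta>) = - k\<^sup>2 \<delta>\<close>. At a positive interior maximum \<open>M\<close> of the quotient, the function
  \<open>d - M (f - \<delta>)\<close> is maximal with value \<open>0\<close>, so its Laplacian is at most \<open>0\<close>, whereas the hypotheses make it at least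
  \<open>M k\<^sup>2 \<delta>\<close>.\<close>

lemma helmholtz_maximum_principle:
  fixes d f :: "'a::euclidean_space \<Rightarrow> real"
  assumes k: "k > 0" and cont: "continuous_on (cball z s) d" "continuous_on (cball z s) f"
    and fpos: "\<And>x. x \<in> cball z s \<Longrightarrow> f x > 0"
    and d1: "\<And>x b. b \<in> Basis \<Longrightarrow> ((\<lambda>h. d (x + h *\<^sub>R b)) has_real_derivative d1 b x) (at 0)"
    and d2: "\<And>x b. b \<in> Basis \<Longrightarrow> ((\<lambda>h. d1 b (x + h *\<^sub>R b)) has_real_derivative d2 b x) (at 0)"
    and f1: "\<And>x b. b \<in> Basis \<Longrightarrow> ((\<lambda>h. f (x + h *\<^sub>R b)) has_real_derivative f1 b x) (at 0)"
    and f2: "\<And>x b. b \<in> Basis \<Longrightarrow> ((\<lambda>h. f1 b (x + h *\<^sub>R b)) has_real_derivative f2 b x) (at 0)"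
    and sub: "\<And>x. x \<in> ball z s \<Longrightarrow> (\<Sum>b\<in>Basis. d2 b x) + k\<^sup>2 * d x \<ge> 0"
    and sol: "\<And>x. x \<in> ball z s \<Longrightarrow> (\<Sum>b\<in>Basis. f2 b x) + k\<^sup>2 * f x = 0"
    and bd: "\<And>x. x \<in> sphere z s \<Longrightarrow> d x \<le> 0"
    and y: "y \<in> cball z s"
  shows "d y \<le> 0"
proof (rule ccontr)
  assume dy: "\<not> d y \<le> 0"
  have ne: "cball z s \<noteq> {}" using y by blast
  obtain xm where xm: "xm \<in> cball z s" "\<And>x. x \<in> cball z s \<Longrightarrow> f xm \<le> f x"
    using continuous_attains_inf[OF compact_cball ne cont(2)] by blast
  (* Half the minimum of f on the closed ball, so that f - \<delta> stays positive on it. *)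
  define \<delta> where "\<delta> = f xm / 2"
  have \<delta>: "\<delta> > 0" "\<And>x. x \<in> cball z s \<Longrightarrow> f x - \<delta> > 0"
  proof -
    show "\<delta> > 0" using fpos[OF xm(1)] by (simp add: \<delta>_def)
    show "f x - \<delta> > 0" if "x \<in> cball z s" for x
      using fpos[OF xm(1)] xm(2)[OF that] unfolding \<delta>_def by linarith
  qed
  have "continuous_on (cball z s) (\<lambda>x. d x / (f x - \<delta>))"
    by (intro continuous_on_divide continuous_on_diff continuous_on_const cont ballI) (use \<delta>(2) in force)
  from continuous_attains_sup[OF compact_cball ne this]
  obtain x0 where x0: "x0 \<in> cball z s" "\<And>x. x \<in> cball z s \<Longrightarrow> d x / (f x - \<delta>) \<le> d x0 / (f x0 - \<delta>)"
    by blast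
  define M where "M = d x0 / (f x0 - \<delta>)"
  have "0 < d y / (f y - \<delta>)" using dy \<delta>(2)[OF y] by (intro divide_pos_pos) auto
  also have "\<dots> \<le> M" using x0(2)[OF y] unfolding M_def .
  finally have M: "M > 0" .
  have "x0 \<notin> sphere z s"
  proof
    assume "x0 \<in> sphere z s"
    then have "M \<le> 0" unfolding M_def by (intro divide_nonpos_pos bd \<delta>(2) x0(1))
    then show False using M by simp
  qed
  then have x0b: "x0 \<in> ball z s" using x0(1) unfolding mem_cball mem_ball mem_sphere by linarith
  have le: "d x - M * (f x - \<delta>) \<le> 0" if "x \<in> cball z s" for x
  proof -
    have "d x / (f x - \<delta>) \<le> M" using x0(2)[OF that] unfolding M_def .
    then show ?thesis using \<delta>(2)[OF that] by (simp add: pos_divide_le_eq)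
  qed
  have eq: "d x0 = M * (f x0 - \<delta>)" using \<delta>(2)[OF x0(1)] unfolding M_def by auto
  have second: "d2 b x0 - M * f2 b x0 \<le> 0" if b: "b \<in> Basis" for b
  proof -
    obtain \<epsilon> where \<epsilon>: "\<epsilon> > 0" "ball x0 \<epsilon> \<subseteq> ball z s"
      using x0b openE[OF open_ball] by metis
    show ?thesis
    proof (rule second_derivative_local_max[OF _ _ \<epsilon>(1)])
      show "((\<lambda>h. d (x0 + h *\<^sub>R b) - M * (f (x0 + h *\<^sub>R b) - \<delta>)) has_real_derivative
          d1 b (x0 + h *\<^sub>R b) - M * f1 b (x0 + h *\<^sub>R b)) (at h)" for h
        by (rule DERIV_cong[OF DERIV_diff[OF line_derivative_shift[OF d1[OF b]]
              DERIV_cmult[OF DERIV_diff[OF line_derivative_shift[OF f1[OF b]] DERIV_const]]]]) simp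
      show "((\<lambda>h. d1 b (x0 + h *\<^sub>R b) - M * f1 b (x0 + h *\<^sub>R b)) has_real_derivative d2 b x0 - M * f2 b x0) (at 0)"
        by (rule DERIV_diff[OF d2[OF b] DERIV_cmult[OF f2[OF b]]])
      fix h :: real assume "\<bar>h\<bar> < \<epsilon>"
      then have "x0 + h *\<^sub>R b \<in> ball x0 \<epsilon>" using b by (simp add: dist_norm)
      then have "x0 + h *\<^sub>R b \<in> cball z s" using \<epsilon>(2) by auto
      then show "d (x0 + h *\<^sub>R b) - M * (f (x0 + h *\<^sub>R b) - \<delta>) \<le> d (x0 + 0 *\<^sub>R b) - M * (f (x0 + 0 *\<^sub>R b) - \<delta>)"
        using le eq by simp
    qed
  qed
  have "(\<Sum>b\<in>Basis. d2 b x0) - M * (\<Sum>b\<in>Basis. f2 b x0) \<le> 0"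
    unfolding sum_distrib_left sum_subtractf[symmetric] by (intro sum_nonpos second)
  moreover have "(\<Sum>b\<in>Basis. f2 b x0) = - k\<^sup>2 * f x0" using sol[OF x0b] by simp
  ultimately have "(\<Sum>b\<in>Basis. d2 b x0) + k\<^sup>2 * d x0 \<le> - (M * k\<^sup>2 * \<delta>)"
    unfolding eq by (simp add: right_diff_distrib left_diff_distrib mult_ac)
  also have "\<dots> < 0" using M k \<delta>(1) by simp
  finally show False using sub[OF x0b] by simp
qed

section \<open>Convolution of locally integrable functions with test functions\<close>

lemma has_real_derivative_integral:
  fixes K K' :: "real \<Rightarrow> 'b \<Rightarrow> real"
  assumes int: "\<And>h. integrable M (K h)"
    and K': "\<And>h y. ((\<lambda>h. K h y) has_real_derivative K' h y) (at h)"
    and meas: "K' 0 \<in> borel_measurable M"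
    and bound: "\<And>h y. \<bar>h\<bar> < 1 \<Longrightarrow> \<bar>K' h y\<bar> \<le> w y" and w: "integrable M w"
  shows "((\<lambda>h. LINT y|M. K h y) has_real_derivative (LINT y|M. K' 0 y)) (at 0)"
proof -
  have "((\<lambda>h. ((LINT y|M. K h y) - (LINT y|M. K 0 y)) / (h - 0)) \<longlongrightarrow> (LINT y|M. K' 0 y)) (at 0 within {-1<..<1})"
    unfolding tendsto_at_iff_sequentially
  proof (intro allI impI)
    fix X :: "nat \<Rightarrow> real" assume X: "\<forall>i. X i \<in> {-1<..<1} - {0}" "X \<longlonglongrightarrow> 0"
    have "(\<lambda>n. LINT y|M. (K (X n) y - K 0 y) / X n) \<longlonglongrightarrow> (LINT y|M. K' 0 y)"
    proof (rule integral_dominated_convergence[OF meas _ w])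
      show "(\<lambda>y. (K (X n) y - K 0 y) / X n) \<in> borel_measurable M" for n
        using int by (intro borel_measurable_divide borel_measurable_diff) (auto intro: borel_measurable_integrable)
      show "AE y in M. (\<lambda>n. (K (X n) y - K 0 y) / X n) \<longlonglongrightarrow> K' 0 y"
      proof (intro AE_I2)
        fix y
        have "((\<lambda>h. (K h y - K 0 y) / h) \<longlongrightarrow> K' 0 y) (at 0)"
          using K'[of y 0] by (simp add: has_field_derivative_iff)
        moreover have "filterlim X (at 0) sequentially" unfolding filterlim_at using X by auto
        ultimately show "(\<lambda>n. (K (X n) y - K 0 y) / X n) \<longlonglongrightarrow> K' 0 y"
          by (rule filterlim_compose)
      qed
      show "AE y in M. norm ((K (X n) y - K 0 y) / X n) \<le> w y" for n
      proof (intro AE_I2)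
        fix y
        have Xn: "\<bar>X n\<bar> < 1" "X n \<noteq> 0" using X(1)[rule_format, of n] by auto
        have "norm ((\<lambda>h. K h y) (X n) - (\<lambda>h. K h y) 0) \<le> w y * norm (X n - 0)"
          by (rule field_differentiable_bound[of "{-1<..<1}" _ "\<lambda>h. K' h y"])
             (use Xn K' bound in \<open>auto intro: has_field_derivative_at_within\<close>)
        then show "norm ((K (X n) y - K 0 y) / X n) \<le> w y" using Xn by (simp add: abs_divide divide_le_eq)
      qed
    qed
    moreover have "(LINT y|M. (K (X n) y - K 0 y) / X n) = ((LINT y|M. K (X n) y) - (LINT y|M. K 0 y)) / (X n - 0)" for n
      by (simp only: integral_divide_zero Bochner_Integration.integral_diff[OF int int] diff_zero)
    ultimately show "((\<lambda>h. ((LINT y|M. K h y) - (LINT y|M. K 0 y)) / (h - 0)) \<circ> X) \<longlonglongrightarrow> (LINT y|M. K' 0 y)"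
      by (simp only: comp_def)
  qed
  then show ?thesis by (simp add: has_field_derivative_iff at_within_open[of 0 "{-1<..<1}"])
qed

definition loc_integrable :: "('a::euclidean_space \<Rightarrow> real) \<Rightarrow> bool" where
  "loc_integrable W \<longleftrightarrow> W \<in> borel_measurable borel \<and> (\<forall>R. integrable lborel (\<lambda>y. indicator (cball 0 R) y * W y))"

lemma loc_integrable_mult:
  assumes W: "loc_integrable W" and [measurable]: "B \<in> borel_measurable borel"
    and B: "\<And>x. \<bar>B x\<bar> \<le> C" "\<And>x. B x \<noteq> 0 \<Longrightarrow> norm x \<le> R"
  shows "integrable lborel (\<lambda>y. W y * B y)"
proof -
  have [measurable]: "W \<in> borel_measurable borel" using W by (simp add: loc_integrable_def)
  have "integrable lborel (\<lambda>y. C * (indicator (cball 0 R) y * W y))"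
    using W by (simp add: loc_integrable_def)
  then show ?thesis
  proof (rule Bochner_Integration.integrable_bound)
    show "AE y in lborel. norm (W y * B y) \<le> norm (C * (indicator (cball 0 R) y * W y))"
    proof (intro AE_I2)
      fix y
      show "norm (W y * B y) \<le> norm (C * (indicator (cball 0 R) y * W y))"
      proof (cases "B y = 0")
        case False
        then have "y \<in> cball 0 R" using B(2) by simp
        moreover have "\<bar>B y\<bar> \<le> \<bar>C\<bar>" using B(1)[of y] by linarith
        ultimately show ?thesis using mult_left_mono[of "\<bar>B y\<bar>" "\<bar>C\<bar>" "\<bar>W y\<bar>"]
          by (simp add: abs_mult mult.commute)
      qed simp
    qed
  qed simp
qed

lemma loc_integrable_continuous:
  assumes "continuous_on UNIV f"
  shows "loc_integrable f"
proof -
  have "integrable lborel (\<lambda>y. indicator (cball 0 R) y *\<^sub>R f y)" for R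
    by (intro borel_integrable_compact continuous_on_subset[OF assms]) auto
  then show ?thesis
    unfolding loc_integrable_def using borel_measurable_continuous_onI[OF assms] by simp
qed

lemma loc_integrable_diff:
  assumes "loc_integrable f" "loc_integrable g"
  shows "loc_integrable (\<lambda>x. f x - g x)"
  using assms unfolding loc_integrable_def by (auto simp: right_diff_distrib)

lemma loc_integrable_mult_test_function:
  assumes W: "loc_integrable W" and \<phi>: "\<phi> \<in> test_functions"
  shows "integrable lborel (\<lambda>x. W x * \<phi> x)"
proof -
  obtain C M where "\<And>x. \<bar>\<phi> x\<bar> \<le> C" "\<And>x. \<phi> x \<noteq> 0 \<Longrightarrow> norm x \<le> M"
    using \<phi> by (rule test_function_bounded) blast
  then show ?thesis
    by (intro loc_integrable_mult[OF W, of _ C M] borel_measurable_continuous_onI test_function_continuous \<phi>)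
qed

definition conv :: "('a::euclidean_space \<Rightarrow> real) \<Rightarrow> ('a \<Rightarrow> real) \<Rightarrow> 'a \<Rightarrow> real" where
  "conv W B x = (LINT y|lborel. W y * B (x - y))"

lemma shifted_support:
  fixes x y :: "'a::real_normed_vector"
  assumes "norm (x - y) \<le> R" "norm x \<le> S"
  shows "norm y \<le> S + R"
  using norm_triangle_ineq4[of x "x - y"] assms by simp

lemma conv_integrable:
  assumes "loc_integrable W" "B \<in> test_functions"
  shows "integrable lborel (\<lambda>y. W y * B (x - y))"
proof -
  obtain C R where B: "\<And>x. \<bar>B x\<bar> \<le> C" "\<And>x. B x \<noteq> 0 \<Longrightarrow> norm x \<le> R"
    using assms(2) by (rule test_function_bounded) blast
  have [measurable]: "B \<in> borel_measurable borel"
    by (rule borel_measurable_continuous_onI[OF test_function_continuous[OF assms(2)]])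
  show ?thesis
    by (rule loc_integrable_mult[OF assms(1), of _ C "norm x + R"]) (use B shifted_support[OF B(2)] in auto)
qed

lemma conv_continuous:
  assumes "loc_integrable W" "B \<in> test_functions"
  shows "continuous_on UNIV (conv W B)"
  unfolding continuous_on_eq_continuous_within continuous_at_sequentially
proof (intro ballI allI impI)
  fix a and X :: "nat \<Rightarrow> 'a" assume X: "X \<longlonglongrightarrow> a"
  obtain C R where B: "\<And>x. \<bar>B x\<bar> \<le> C" "\<And>x. B x \<noteq> 0 \<Longrightarrow> norm x \<le> R"
    using assms(2) by (rule test_function_bounded) blast
  have C: "0 \<le> C" using B(1)[of 0] by simp
  have Bc: "continuous_on UNIV B" using assms(2) by (rule test_function_continuous)
  then have [measurable]: "B \<in> borel_measurable borel" by (rule borel_measurable_continuous_onI)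
  have [measurable]: "W \<in> borel_measurable borel" using assms(1) by (simp add: loc_integrable_def)
  obtain S where S: "\<And>n. norm (X n) \<le> S"
    using Bseq_def convergent_imp_Bseq[OF convergentI[OF X]] by blast
  have "(\<lambda>n. LINT y|lborel. W y * B (X n - y)) \<longlonglongrightarrow> (LINT y|lborel. W y * B (a - y))"
  proof (rule integral_dominated_convergence[where w="\<lambda>y. C * \<bar>indicator (cball 0 (S + R)) y * W y\<bar>"])
    show "integrable lborel (\<lambda>y. C * \<bar>indicator (cball 0 (S + R)) y * W y\<bar>)"
      using assms(1) by (intro integrable_mult_right integrable_abs) (simp add: loc_integrable_def)
    show "AE y in lborel. (\<lambda>n. W y * B (X n - y)) \<longlonglongrightarrow> W y * B (a - y)"
    proof (intro AE_I2 tendsto_mult tendsto_const)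
      fix y
      have "isCont B (a - y)" using Bc by (simp add: continuous_on_eq_continuous_at)
      then show "(\<lambda>n. B (X n - y)) \<longlonglongrightarrow> B (a - y)"
        by (rule isCont_tendsto_compose) (intro tendsto_diff X tendsto_const)
    qed
    show "AE y in lborel. norm (W y * B (X n - y)) \<le> C * \<bar>indicator (cball 0 (S + R)) y * W y\<bar>" for n
    proof (intro AE_I2)
      fix y
      show "norm (W y * B (X n - y)) \<le> C * \<bar>indicator (cball 0 (S + R)) y * W y\<bar>"
      proof (cases "B (X n - y) = 0")
        case False
        then have "norm y \<le> S + R" using shifted_support[OF B(2) S] by blast
        then show ?thesis using mult_right_mono[OF B(1)[of "X n - y"], of "\<bar>W y\<bar>"]
          by (simp add: abs_mult mult.commute)
      qed (use C in simp)
    qed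
  qed auto
  then show "(conv W B \<circ> X) \<longlonglongrightarrow> conv W B a" by (simp add: conv_def comp_def)
qed

lemma conv_line_derivative:
  fixes W B :: "'a::euclidean_space \<Rightarrow> real"
  assumes W: "loc_integrable W" and B: "B \<in> test_functions" and b: "b \<in> Basis"
  shows "((\<lambda>h. conv W B (x + h *\<^sub>R b)) has_real_derivative conv W (partial_deriv b B) x) (at 0)"
proof -
  let ?D = "partial_deriv b B"
  have D: "?D \<in> test_functions" using B b by (rule test_functions_partial_deriv)
  obtain C R where C: "\<And>x. \<bar>?D x\<bar> \<le> C" "\<And>x. ?D x \<noteq> 0 \<Longrightarrow> norm x \<le> R"
    using D by (rule test_function_bounded) blast
  have C0: "0 \<le> C" using C(1)[of 0] by simp
  have [measurable]: "?D \<in> borel_measurable borel"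
    by (rule borel_measurable_continuous_onI[OF test_function_continuous[OF D]])
  have [measurable]: "W \<in> borel_measurable borel" using W by (simp add: loc_integrable_def)
  let ?w = "\<lambda>y. C * \<bar>indicator (cball 0 (norm x + 1 + R)) y * W y\<bar>"
  have "((\<lambda>h. LINT y|lborel. W y * B (x + h *\<^sub>R b - y)) has_real_derivative
     (LINT y|lborel. W y * ?D (x + 0 *\<^sub>R b - y))) (at 0)"
  proof (rule has_real_derivative_integral[where w="?w"])
    show "integrable lborel (\<lambda>y. W y * B (x + h *\<^sub>R b - y))" for h
      by (rule conv_integrable[OF W B])
    show "((\<lambda>h. W y * B (x + h *\<^sub>R b - y)) has_real_derivative W y * ?D (x + h *\<^sub>R b - y)) (at h)" for h y
    proof (rule DERIV_cmult)
      have "smooth B" using B unfolding test_functions_iff by blast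
      from smooth_has_line_derivative[OF this, of "x - y" b h]
      show "((\<lambda>h. B (x + h *\<^sub>R b - y)) has_real_derivative ?D (x + h *\<^sub>R b - y)) (at h)"
        by (simp add: algebra_simps)
    qed
    show "integrable lborel ?w"
      using W by (intro integrable_mult_right integrable_abs) (simp add: loc_integrable_def)
    show "\<bar>W y * ?D (x + h *\<^sub>R b - y)\<bar> \<le> ?w y" if h: "\<bar>h\<bar> < 1" for h y
    proof (cases "?D (x + h *\<^sub>R b - y) = 0")
      case False
      have "norm (x + h *\<^sub>R b) \<le> norm x + norm (h *\<^sub>R b)" by (rule norm_triangle_ineq)
      then have "norm (x + h *\<^sub>R b) \<le> norm x + 1" using h b by simp
      then have "norm y \<le> norm x + 1 + R" using shifted_support[OF C(2)[OF False]] by blast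
      then show ?thesis using mult_right_mono[OF C(1)[of "x + h *\<^sub>R b - y"], of "\<bar>W y\<bar>"]
        by (simp add: abs_mult mult.commute)
    qed (use C0 in simp)
  qed auto
  then show ?thesis by (simp add: conv_def)
qed

section \<open>Bump functions as superpositions of balls\<close>

lemma loc_integrable_ball:
  fixes W :: "'a::euclidean_space \<Rightarrow> real"
  assumes "loc_integrable W"
  shows "integrable lborel (\<lambda>y. W y * indicator (ball x r) y)"
proof (rule loc_integrable_mult[OF assms, of _ 1 "norm x + \<bar>r\<bar>"])
  fix y :: 'a assume "indicator (ball x r) y \<noteq> (0::real)"
  then have "dist x y < r" by (simp add: indicator_def split: if_splits)
  then show "norm y \<le> norm x + \<bar>r\<bar>" by (intro shifted_support[of x]) (auto simp: dist_norm)
next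
  show "indicator (ball x r) \<in> borel_measurable borel" by (rule borel_measurable_indicator) simp
qed (auto simp: indicator_def)

text \<open>For \<open>0 < h < 1\<close> the condition \<open>h < flat_exp 0 s\<close> means \<open>s > - 1 / ln h\<close>. Empty superlevel sets are balls with \<open>\<rho> \<le> 0\<close>.\<close>

lemma bump_superlevel_ball:
  assumes h: "0 < h"
  shows "\<exists>\<rho>. (0 < \<rho> \<longrightarrow> \<rho>\<^sup>2 < e) \<and> {y. h < bump x e y} = ball x \<rho>"
proof (cases "h < 1")
  case False
  have "bump x e y \<le> 1" for y by (simp add: bump_def flat_exp_def)
  then have "\<not> h < bump x e y" for y using False order_trans[of "bump x e y" 1 h] by (simp add: not_less)
  then have "{y. h < bump x e y} = ball x 0" by simp
  then show ?thesis by (intro exI[of _ 0]) simp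
next
  case True
  define c where "c = - 1 / ln h"
  have l: "ln h < 0" using h True by simp
  have c: "c > 0" using l by (simp add: c_def divide_neg_neg)
  have iff: "h < flat_exp 0 s \<longleftrightarrow> c < s" for s
  proof (cases "s \<le> 0")
    case False
    then have "h < flat_exp 0 s \<longleftrightarrow> ln h < - 1 / s"
      using exp_less_cancel_iff[of "ln h" "- 1 / s"] h by (simp add: flat_exp_def)
    also have "\<dots> \<longleftrightarrow> c < s" using False l by (auto simp: c_def field_simps)
    finally show ?thesis .
  qed (use h c in \<open>simp add: flat_exp_def\<close>)
  show ?thesis
  proof (cases "c < e")
    case True
    have "h < bump x e y \<longleftrightarrow> y \<in> ball x (sqrt (e - c))" for y
    proof -
      have "h < bump x e y \<longleftrightarrow> (norm (y - x))\<^sup>2 < e - c"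
        unfolding bump_def iff by linarith
      also have "\<dots> \<longleftrightarrow> norm (y - x) < sqrt (e - c)"
        using real_sqrt_less_iff[of "(norm (y - x))\<^sup>2" "e - c"]
          by (simp only: real_sqrt_abs abs_norm_cancel)
      also have "\<dots> \<longleftrightarrow> y \<in> ball x (sqrt (e - c))"
        by (simp only: mem_ball dist_norm norm_minus_commute[of y x])
      finally show ?thesis .
    qed
    then have "{y. h < bump x e y} = ball x (sqrt (e - c))" by blast
    then show ?thesis using True c by (intro exI[of _ "sqrt (e - c)"]) auto
  next
    case False
    have "{y. h < bump x e y} = ball x 0"
    proof -
      have "\<not> c < e - (norm (y - x))\<^sup>2" for y
        using False zero_le_power2[of "norm (y - x)"] by linarith
      then show ?thesis by (simp add: bump_def iff)
    qed
    then show ?thesis by (intro exI[of _ 0]) simp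
  qed
qed

text \<open>Layer-cake formula: the bump is the integral over \<open>h\<close> of the indicators of its superlevel sets, which are
  concentric balls. By Fubini, integrals over these balls control the integral against the bump.\<close>

lemma integral_bump_nonneg_of_balls:
  fixes W :: "'a::euclidean_space \<Rightarrow> real"
  assumes W: "loc_integrable W"
    and balls: "\<And>\<rho>. 0 < \<rho> \<Longrightarrow> \<rho>\<^sup>2 < e \<Longrightarrow> (LINT y|lborel. W y * indicator (ball x \<rho>) y) \<ge> 0"
  shows "(LINT y|lborel. W y * bump x e y) \<ge> 0"
proof -
  have [measurable]: "W \<in> borel_measurable borel" using W by (simp add: loc_integrable_def)
  have [measurable]: "bump x e \<in> borel_measurable borel"
    by (rule borel_measurable_continuous_onI[OF test_function_continuous[OF bump_test_function]])
  (* W times the bump, decomposed into superlevel sets: a function of the point and of the level. *)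
  define f where "f = (\<lambda>p::'a \<times> real. W (fst p) * (if 0 < snd p \<and> snd p < bump x e (fst p) then 1 else 0))"
  have fm: "f \<in> borel_measurable (lborel \<Otimes>\<^sub>M lborel)" unfolding f_def by measurable
  have ind: "(\<lambda>h. if 0 < h \<and> h < c then 1 else 0 :: real) = indicator {0<..<c}" for c
    by (auto simp: indicator_def)
  have li: "(LINT h|lborel. (if 0 < h \<and> h < bump x e y then 1 else 0 :: real)) = bump x e y"
    "integrable lborel (\<lambda>h. if 0 < h \<and> h < bump x e y then 1 else 0 :: real)" for y
    unfolding ind using bump_nonneg[of x e y] by simp_all
  have int: "integrable lborel (\<lambda>y. W y * bump x e y)"
    using conv_integrable[OF W bump_test_function[of 0 e], of x] by (simp add: bump_def norm_minus_commute)
  have fi: "integrable (lborel \<Otimes>\<^sub>M lborel) f"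
  proof (rule lborel_pair.Fubini_integrable[OF fm])
    have "(LINT h|lborel. norm (f (y, h))) = \<bar>W y * bump x e y\<bar>" for y
    proof -
      have "(LINT h|lborel. norm (f (y, h))) = (LINT h|lborel. \<bar>W y\<bar> * (if 0 < h \<and> h < bump x e y then 1 else 0 :: real))"
        by (intro Bochner_Integration.integral_cong) (auto simp: f_def abs_mult)
      also have "\<dots> = \<bar>W y\<bar> * bump x e y" by (simp only: integral_mult_right_zero li)
      finally show ?thesis using bump_nonneg[of x e y] by (simp add: abs_mult)
    qed
    then show "integrable lborel (\<lambda>y. LINT h|lborel. norm (f (y, h)))" using int by simp
    show "AE y in lborel. integrable lborel (\<lambda>h. f (y, h))"
      unfolding f_def using li(2) by (auto intro!: AE_I2 integrable_mult_right)
  qed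
  have "(LINT y|lborel. W y * bump x e y) = (LINT y|lborel. (LINT h|lborel. f (y, h)))"
    unfolding f_def by (simp only: fst_conv snd_conv integral_mult_right_zero li)
  also have "\<dots> = (LINT h|lborel. (LINT y|lborel. f (y, h)))"
    using lborel_pair.Fubini_integral[of "\<lambda>y h. f (y, h)"] fi by simp
  also have "\<dots> \<ge> 0"
  proof (rule Bochner_Integration.integral_nonneg)
    fix h :: real
    show "0 \<le> (LINT y|lborel. f (y, h))"
    proof (cases "0 < h")
      case True
      obtain \<rho> where \<rho>: "0 < \<rho> \<longrightarrow> \<rho>\<^sup>2 < e" "{y. h < bump x e y} = ball x \<rho>"
        using bump_superlevel_ball[OF True] by blast
      have "(LINT y|lborel. f (y, h)) = (LINT y|lborel. W y * indicator (ball x \<rho>) y)"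
        unfolding f_def \<rho>(2)[symmetric] using True
        by (intro Bochner_Integration.integral_cong) (auto simp: indicator_def)
      also have "\<dots> \<ge> 0"
      proof (cases "0 < \<rho>")
        case True
        then show ?thesis using balls \<rho>(1) by blast
      next
        case False
        then have "ball x \<rho> = {}" by simp
        then show ?thesis unfolding \<open>ball x \<rho> = {}\<close> by simp
      qed
      finally show ?thesis .
    qed (simp add: f_def)
  qed
  finally show ?thesis .
qed

lemma bump_integral:
  fixes x :: "'a::euclidean_space"
  shows "(LINT y|lborel. bump x e y) = (LINT y|lborel. bump (0::'a) e y)"
proof -
  have [measurable]: "bump x e \<in> borel_measurable borel"
    by (rule borel_measurable_continuous_onI[OF test_function_continuous[OF bump_test_function]])
  have "(LINT y|lborel. bump x e y) = (LINT y|distr lborel borel ((+) x). bump x e y)"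
    by (simp add: lborel_distr_plus)
  also have "\<dots> = (LINT y|lborel. bump x e (x + y))" by (subst integral_distr) auto
  finally show ?thesis by (simp add: bump_def)
qed

lemma bump_integral_pos:
  assumes "e > 0"
  shows "(LINT y|lborel. bump (x::'a::euclidean_space) e y) > 0"
proof -
  have loc: "loc_integrable (\<lambda>y::'a. 1)" by (rule loc_integrable_continuous) auto
  have int: "integrable lborel (bump x e)"
    using conv_integrable[OF loc bump_test_function[of 0 e], of x]
    by (simp add: bump_def[abs_def] norm_minus_commute)
  define r where "r = sqrt e / 2"
  have r: "r > 0" "r\<^sup>2 = e / 4" using assms by (simp_all add: r_def power_divide)
  have "0 < exp (- 2 / e) * measure lborel (ball x r)" using r content_ball_pos[of r x] by simp
  also have "\<dots> = (LINT y|lborel. exp (- 2 / e) * indicator (ball x r) y)" by simp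
  also have "\<dots> \<le> (LINT y|lborel. bump x e y)"
  proof (rule integral_mono[OF _ int])
    show "integrable lborel (\<lambda>y. exp (- 2 / e) * indicator (ball x r) y)"
      using loc_integrable_ball[OF loc, of x r] by simp
    fix y
    show "exp (- 2 / e) * indicator (ball x r) y \<le> bump x e y"
    proof (cases "y \<in> ball x r")
      case True
      then have "norm (y - x) < r" by (simp add: dist_norm norm_minus_commute)
      then have "(norm (y - x))\<^sup>2 \<le> e / 4" using power_mono[of "norm (y - x)" r 2] r by simp
      then have s: "e - (norm (y - x))\<^sup>2 \<ge> e / 2" using assms by simp
      have "2 / e = 1 / (e / 2)" by simp
      also have "\<dots> \<ge> 1 / (e - (norm (y - x))\<^sup>2)" using s assms by (intro divide_left_mono) auto
      finally show ?thesis using True s assms by (simp add: bump_def flat_exp_def)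
    qed (simp add: bump_nonneg)
  qed
  finally show ?thesis .
qed

text \<open>The left-hand side differentiates a bump in its argument, the right-hand side one in the variable of a
  convolution.\<close>

lemma laplacian_bump_shift: "laplacian (bump x e) y = laplacian (bump 0 e) (x - y)"
proof -
  have "(y - x) \<bullet> b = - ((x - y) \<bullet> b)" for b by (simp add: inner_diff_left)
  then show ?thesis by (simp add: laplacian_bump bump2_def norm_minus_commute power2_eq_square)
qed

section \<open>Distributional subsolutions\<close>

text \<open>The convolution \<open>U\<close> of \<open>W\<close> with a bump of total integral \<open>I\<close> is smooth and satisfies \<open>(\<Delta> + k\<^sup>2) U \<ge> \<tau> I\<close> classically
  on the ball of radius \<open>s\<close>, because the bumps centred there are admissible test functions. The maximum principle applies to
  \<open>d = U / I - \<tau> / k\<^sup>2 - a f\<close>, where \<open>a\<close> makes \<open>d \<le> 0\<close> on the sphere. The hypothesis \<open>low\<close> expresses that the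
  means of \<open>W\<close> over small balls about \<open>x0\<close> are at least \<open>\<beta>\<close>.\<close>

lemma weak_subsolution_upper_bound:
  fixes W f :: "'a::euclidean_space \<Rightarrow> real"
  assumes W: "loc_integrable W" and k: "k > 0" and s: "0 < s" "s < r"
    and weak: "\<And>\<phi>. \<phi> \<in> test_functions \<Longrightarrow> (\<And>x. 0 \<le> \<phi> x) \<Longrightarrow> (\<And>x. \<phi> x \<noteq> 0 \<Longrightarrow> x \<in> ball z r) \<Longrightarrow>
        (LINT x|lborel. W x * (laplacian \<phi> x + k\<^sup>2 * \<phi> x)) \<ge> \<tau> * (LINT x|lborel. \<phi> x)"
    and fc: "continuous_on UNIV f" and fpos: "\<And>x. x \<in> cball z s \<Longrightarrow> f x > 0"
    and f1: "\<And>x b. b \<in> Basis \<Longrightarrow> ((\<lambda>h. f (x + h *\<^sub>R b)) has_real_derivative f1 b x) (at 0)"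
    and f2: "\<And>x b. b \<in> Basis \<Longrightarrow> ((\<lambda>h. f1 b (x + h *\<^sub>R b)) has_real_derivative f2 b x) (at 0)"
    and sol: "\<And>x. (\<Sum>b\<in>Basis. f2 b x) + k\<^sup>2 * f x = 0"
    and fs: "\<And>x. x \<in> sphere z s \<Longrightarrow> f x = fs" "fs > 0"
    and near: "\<rho> > 0" "AE y in lborel. \<bar>dist z y - s\<bar> < \<rho> \<longrightarrow> W y \<le> m"
    and x0: "x0 \<in> ball z s"
    and low: "\<rho>0 > 0" "\<And>\<rho>. 0 < \<rho> \<Longrightarrow> \<rho> < \<rho>0 \<Longrightarrow>
        (LINT y|lborel. (W y - \<beta>) * indicator (ball x0 \<rho>) y) \<ge> 0"
  shows "\<beta> \<le> f x0 / fs * (m - \<tau> / k\<^sup>2) + \<tau> / k\<^sup>2"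
proof -
  define \<eta> where "\<eta> = min (min \<rho> \<rho>0) (r - s) / 2"
  have \<eta>: "\<eta> > 0" "\<eta> < \<rho>" "\<eta> < \<rho>0" "\<eta> < r - s"
    using near low s by (auto simp: \<eta>_def)
  (* Bumps about points of the ball of radius s stay inside the ball of radius r, and those about
     points of its boundary inside the annulus where W is at most m. *)
  define e where "e = \<eta>\<^sup>2"
  have e: "e > 0" using \<eta> by (simp add: e_def)
  define I where "I = (LINT y|lborel. bump (0::'a) e y)"
  have I: "I > 0" unfolding I_def by (rule bump_integral_pos[OF e])
  have Ix: "(LINT y|lborel. bump x e y) = I" for x :: 'a unfolding I_def by (rule bump_integral)
  have supp: "dist x y < \<eta>" if "bump x e y \<noteq> 0" for x y :: 'a
  proof -
    have "0 < bump x e y" using that bump_nonneg[of x e y] by simp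
    then have "(norm (y - x))\<^sup>2 < \<eta>\<^sup>2" unfolding bump_pos_iff e_def .
    then show ?thesis using \<eta> by (simp add: dist_norm norm_minus_commute power2_less_imp_less)
  qed
  let ?B = "bump (0::'a) e"
  have B: "?B \<in> test_functions" by (rule bump_test_function)
  have Bx: "?B (x - y) = bump x e y" for x y by (simp add: bump_def norm_minus_commute)
  define U where "U = conv W ?B"
  have U: "U x = (LINT y|lborel. W y * bump x e y)" for x by (simp add: U_def conv_def Bx)
  have intW: "integrable lborel (\<lambda>y. W y * bump x e y)" for x
    using conv_integrable[OF W B, of x] by (simp add: Bx)
  have intb: "integrable lborel (\<lambda>y. bump x e y)" for x :: 'a
    using conv_integrable[OF loc_integrable_continuous[OF continuous_on_const[of UNIV 1]] B, of x]
      by (simp add: Bx)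
  (* The choice that makes d at most 0 on the sphere, where f = fs. *)
  define a where "a = (m - \<tau> / k\<^sup>2) / fs"
  define d where "d x = U x / I - \<tau> / k\<^sup>2 - a * f x" for x
  define U1 where "U1 b = conv W (partial_deriv b ?B)" for b
  define U2 where "U2 b = conv W (partial_deriv b (partial_deriv b ?B))" for b
  have dU1: "((\<lambda>h. U (x + h *\<^sub>R b)) has_real_derivative U1 b x) (at 0)" if "b \<in> Basis" for x b
    unfolding U_def U1_def by (rule conv_line_derivative[OF W B that])
  have dU2: "((\<lambda>h. U1 b (x + h *\<^sub>R b)) has_real_derivative U2 b x) (at 0)" if "b \<in> Basis" for x b
    unfolding U1_def U2_def by (rule conv_line_derivative[OF W test_functions_partial_deriv[OF B that] that])
  have sumU2: "(\<Sum>b\<in>Basis. U2 b x) = (LINT y|lborel. W y * laplacian (bump x e) y)" for x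
  proof -
    have "(\<Sum>b\<in>Basis. U2 b x) = (LINT y|lborel. (\<Sum>b\<in>Basis. W y * partial_deriv b (partial_deriv b ?B) (x - y)))"
      unfolding U2_def conv_def
      by (rule Bochner_Integration.integral_sum[symmetric], rule conv_integrable[OF W])
         (intro test_functions_partial_deriv B)
    then show ?thesis unfolding laplacian_bump_shift[of x] by (simp add: laplacian_def sum_distrib_left)
  qed
  have intL: "integrable lborel (\<lambda>y. W y * laplacian (bump x e) y)" for x
  proof -
    have "integrable lborel (\<lambda>y. \<Sum>b\<in>Basis. W y * partial_deriv b (partial_deriv b ?B) (x - y))"
      by (rule Bochner_Integration.integrable_sum, rule conv_integrable[OF W]) (intro test_functions_partial_deriv B)
    then show ?thesis unfolding laplacian_bump_shift[of x] by (simp add: laplacian_def sum_distrib_left)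
  qed
  have "d x0 \<le> 0"
  proof (rule helmholtz_maximum_principle[OF k, of z s d f "\<lambda>b x. U1 b x / I - a * f1 b x" "\<lambda>b x. U2 b x / I - a * f2 b x" f1 f2])
    show "continuous_on (cball z s) d" unfolding d_def U_def
      by (intro continuous_intros continuous_on_subset[OF conv_continuous[OF W B]] continuous_on_subset[OF fc]) (use I in auto)
    show "continuous_on (cball z s) f" by (rule continuous_on_subset[OF fc]) simp
    show "((\<lambda>h. d (x + h *\<^sub>R b)) has_real_derivative U1 b x / I - a * f1 b x) (at 0)" if "b \<in> Basis" for x b
      unfolding d_def
      by (rule DERIV_cong[OF DERIV_diff[OF DERIV_diff[OF DERIV_cdivide[OF dU1[OF that]] DERIV_const] DERIV_cmult[OF f1[OF that]]]]) simp
    show "((\<lambda>h. U1 b (x + h *\<^sub>R b) / I - a * f1 b (x + h *\<^sub>R b)) has_real_derivative U2 b x / I - a * f2 b x) (at 0)" if "b \<in> Basis" for x b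
      by (rule DERIV_diff[OF DERIV_cdivide[OF dU2[OF that]] DERIV_cmult[OF f2[OF that]]])
    show "(\<Sum>b\<in>Basis. U2 b x / I - a * f2 b x) + k\<^sup>2 * d x \<ge> 0" if x: "x \<in> ball z s" for x
    proof -
      have "y \<in> ball z r" if "bump x e y \<noteq> 0" for y
        using supp[OF that] x \<eta>(4) dist_triangle[of z y x] by simp
      then have "\<tau> * (LINT y|lborel. bump x e y) \<le> (LINT y|lborel. W y * (laplacian (bump x e) y + k\<^sup>2 * bump x e y))"
        by (intro weak bump_test_function bump_nonneg)
      also have "\<dots> = (LINT y|lborel. W y * laplacian (bump x e) y + k\<^sup>2 * (W y * bump x e y))"
        by (simp add: algebra_simps)
      also have "\<dots> = (\<Sum>b\<in>Basis. U2 b x) + k\<^sup>2 * U x"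
        using intL[of x] intW[of x] by (simp add: sumU2 U)
      finally have "\<tau> * I \<le> (\<Sum>b\<in>Basis. U2 b x) + k\<^sup>2 * U x" by (simp add: Ix)
      then have "\<tau> \<le> ((\<Sum>b\<in>Basis. U2 b x) + k\<^sup>2 * U x) / I"
        using I by (simp add: le_divide_eq)
      moreover have "(\<Sum>b\<in>Basis. U2 b x / I - a * f2 b x) + k\<^sup>2 * d x
        = ((\<Sum>b\<in>Basis. U2 b x) + k\<^sup>2 * U x) / I - \<tau> - a * ((\<Sum>b\<in>Basis. f2 b x) + k\<^sup>2 * f x)"
      proof -
        have "(\<Sum>b\<in>Basis. U2 b x / I - a * f2 b x) = (\<Sum>b\<in>Basis. U2 b x) / I - a * (\<Sum>b\<in>Basis. f2 b x)"
          by (simp only: sum_subtractf sum_distrib_left sum_divide_distrib)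
        moreover have "k\<^sup>2 * d x = k\<^sup>2 * U x / I - \<tau> - a * (k\<^sup>2 * f x)"
          using k by (simp add: d_def right_diff_distrib)
        ultimately show ?thesis by (simp add: add_divide_distrib distrib_left)
      qed
      ultimately show ?thesis using sol by simp
    qed
    show "(\<Sum>b\<in>Basis. f2 b x) + k\<^sup>2 * f x = 0" for x by (rule sol)
    show "d x \<le> 0" if x: "x \<in> sphere z s" for x
    proof -
      have "U x \<le> (LINT y|lborel. m * bump x e y)"
        unfolding U
      proof (rule integral_mono_AE[OF intW])
        show "AE y in lborel. W y * bump x e y \<le> m * bump x e y"
          using near(2)
        proof eventually_elim
          case (elim y)
          show ?case
          proof (cases "bump x e y = 0")
            case False
            have "\<bar>dist z y - s\<bar> \<le> dist x y"
              using x dist_triangle[of z y x] dist_triangle[of z x y] by (simp add: dist_commute abs_le_iff)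
            then have "W y \<le> m" using elim supp[OF False] \<eta> by simp
            then show ?thesis by (intro mult_right_mono bump_nonneg)
          qed simp
        qed
      qed (use intb in simp)
      also have "\<dots> = m * I" by (simp add: Ix)
      finally have "U x / I \<le> m" using I by (simp add: divide_le_eq)
      moreover have "a * f x = m - \<tau> / k\<^sup>2" using fs x by (simp add: a_def)
      ultimately show ?thesis by (simp add: d_def)
    qed
    show "x0 \<in> cball z s" using x0 by simp
  qed (use fpos f1 f2 in auto)
  moreover have "\<beta> \<le> U x0 / I"
  proof -
    have "loc_integrable (\<lambda>y. W y - \<beta>)"
      by (intro loc_integrable_diff W loc_integrable_continuous continuous_on_const)
    then have "0 \<le> (LINT y|lborel. (W y - \<beta>) * bump x0 e y)"
    proof (rule integral_bump_nonneg_of_balls)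
      fix \<rho> :: real assume "0 < \<rho>" "\<rho>\<^sup>2 < e"
      then have "\<rho> < \<rho>0" using \<eta> power2_less_imp_less[of \<rho> \<eta>] by (simp add: e_def)
      then show "0 \<le> (LINT y|lborel. (W y - \<beta>) * indicator (ball x0 \<rho>) y)"
        using low \<open>0 < \<rho>\<close> by blast
    qed
    also have "\<dots> = U x0 - \<beta> * I" using intW[of x0] intb[of x0] by (simp add: U Ix left_diff_distrib)
    finally show ?thesis using I by (simp add: le_divide_eq)
  qed
  ultimately show ?thesis by (simp add: d_def a_def mult.commute)
qed

section \<open>Gluing the potential of a point mass across a sphere\<close>

text \<open>The potential is a difference of integrals of the positive and negative parts of the kernel; for a point
  mass only the value at \<open>x - z\<close> enters, once the kernel is known to be measurable.\<close>

lemma potential_of_point_mass: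
  fixes z :: "'a::euclidean_space"
  assumes k: "k > 0" and dim: "real DIM('a) = 2 * \<nu> + 2" and \<nu>: "0 \<le> \<nu>" and c: "c > 0"
  shows "helmholtz_potential k (scale_measure (ennreal c) (return borel z)) x =
    (if x = z then \<infinity> else ereal (- (c * ((k\<^sup>2 / (4 * pi)) powr \<nu> / 4)) * radial_Y \<nu> (k\<^sup>2 / 4 * (norm (x - z))\<^sup>2)))"
proof -
  have \<nu>': "\<nu> = (real DIM('a) - 2) / 2" using dim by simp
  define q where "q y = - ((k\<^sup>2 / (4 * pi)) powr \<nu> / 4 * radial_Y \<nu> (k\<^sup>2 * (norm y)\<^sup>2 / 4))" for y :: 'a
  have ker: "helmholtz_kernel k y = (if y = 0 then \<infinity> else ereal (q y))" for y :: 'a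
    using helmholtz_kernel_eq_radial_Y[OF k _ \<nu>'] by (simp add: q_def helmholtz_kernel_def Let_def)
  have Yc: "continuous_on {0<..} (radial_Y \<nu>)"
    by (rule DERIV_continuous_on[OF radial_Y_has_derivative]) (use \<nu> in auto)
  have "continuous_on (- {0}) q" unfolding q_def
    by (intro continuous_intros continuous_on_compose2[OF Yc]) (use k in \<open>auto simp: zero_less_mult_iff\<close>)
  then have "(\<lambda>y. indicator (- {0}) y *\<^sub>R q y) \<in> borel_measurable borel"
    by (intro borel_measurable_continuous_on_indicator) auto
  then have "(\<lambda>y::'a. if y = 0 then \<infinity> else ereal (indicator (- {0}) y *\<^sub>R q y)) \<in> borel_measurable borel"
    by measurable
  moreover have "(\<lambda>y::'a. if y = 0 then \<infinity> else ereal (indicator (- {0}) y *\<^sub>R q y)) = helmholtz_kernel k"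
    by (auto simp: ker)
  ultimately have [measurable]: "helmholtz_kernel k \<in> borel_measurable (borel :: 'a measure)" by simp
  have int: "(\<integral>\<^sup>+ y. e2ennreal (g (helmholtz_kernel k (x - y))) \<partial>scale_measure (ennreal c) (return borel z))
     = ennreal c * e2ennreal (g (helmholtz_kernel k (x - z)))" if [measurable]: "g \<in> borel_measurable borel" for g
    by (subst nn_integral_scale_measure) (auto simp: nn_integral_return)
  have p: "(\<integral>\<^sup>+ y. e2ennreal (helmholtz_kernel k (x - y)) \<partial>scale_measure (ennreal c) (return borel z))
     = ennreal c * e2ennreal (helmholtz_kernel k (x - z))" by (rule int[of "\<lambda>x. x"]) auto
  have m: "(\<integral>\<^sup>+ y. e2ennreal (- helmholtz_kernel k (x - y)) \<partial>scale_measure (ennreal c) (return borel z))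
     = ennreal c * e2ennreal (- helmholtz_kernel k (x - z))" by (rule int[of "\<lambda>x. - x"]) auto
  show ?thesis
  proof (cases "x = z")
    case True
    have "ennreal c * e2ennreal \<infinity> = \<top>" using c by (simp add: e2ennreal_infty ennreal_mult_top)
    moreover have "e2ennreal (- \<infinity>) = 0" by (rule e2ennreal_neg) simp
    ultimately show ?thesis unfolding helmholtz_potential_def p m using True by (simp add: ker)
  next
    case False
    have "helmholtz_potential k (scale_measure (ennreal c) (return borel z)) x
      = enn2ereal (ennreal c * ennreal (q (x - z))) - enn2ereal (ennreal c * ennreal (- q (x - z)))"
      unfolding helmholtz_potential_def p m using False by (simp add: ker)
    also have "\<dots> = ereal (c * q (x - z))"
    proof (cases "q (x - z) \<ge> 0")
      case True
      then show ?thesis using c by (simp add: ennreal_neg ennreal_mult[symmetric] enn2ereal_ennreal zero_ennreal.rep_eq)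
    next
      case False
      then have "c * q (x - z) \<le> 0" using c by (simp add: mult_nonneg_nonpos)
      then show ?thesis using c False
        by (simp add: ennreal_neg ennreal_mult[symmetric] enn2ereal_ennreal zero_ennreal.rep_eq)
    qed
    finally show ?thesis using False by (simp add: q_def)
  qed
qed

text \<open>The second derivative of \<open>excess\<close>, solved from its differential equation.\<close>

definition excess'' :: "real \<Rightarrow> real \<Rightarrow> real \<Rightarrow> real" where
  "excess'' \<nu> t0 t = (1 - excess \<nu> t0 t - (\<nu> + 1) * excess' \<nu> t0 t) / t"

lemma excess'_has_derivative:
  assumes t: "t > 0" and \<nu>: "0 \<le> \<nu>"
  shows "(excess' \<nu> t0 has_real_derivative excess'' \<nu> t0 t) (at t within S)"
proof -
  have rY: "radial_Y (\<nu> + 1 + 1) t = ((\<nu> + 1) * radial_Y (\<nu> + 1) t - radial_Y \<nu> t) / t"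
    using radial_Y_recurrence[OF t \<nu>] t by (simp add: nonzero_eq_divide_eq mult.commute add.commute)
  have rJ: "entire_J (\<nu> + 1 + 1) t = ((\<nu> + 1) * entire_J (\<nu> + 1) t - entire_J \<nu> t) / t"
    using entire_J_recurrence[of "\<nu> + 1" t] t by (simp add: nonzero_eq_divide_eq mult.commute)
  have \<nu>1: "0 \<le> \<nu> + 1" using \<nu> by simp
  have "(excess' \<nu> t0 has_real_derivative pi * t0 powr (\<nu> + 1) *
      (entire_J (\<nu> + 1) t0 * - radial_Y (\<nu> + 1 + 1) t - radial_Y (\<nu> + 1) t0 * - entire_J (\<nu> + 1 + 1) t)) (at t within S)"
    unfolding excess'_def[abs_def]
    by (intro DERIV_cmult DERIV_diff radial_Y_has_derivative[OF t \<nu>1] entire_J_has_derivative)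
  also have "pi * t0 powr (\<nu> + 1) *
      (entire_J (\<nu> + 1) t0 * - radial_Y (\<nu> + 1 + 1) t - radial_Y (\<nu> + 1) t0 * - entire_J (\<nu> + 1 + 1) t) = excess'' \<nu> t0 t"
    unfolding rY rJ excess''_def excess_def excess'_def
      using t by (simp add: divide_simps) (simp add: algebra_simps)
  finally show ?thesis .
qed

lemma C1_imp_lipschitz_on:
  fixes f :: "real \<Rightarrow> real"
  assumes "\<And>x. x \<in> {a..b} \<Longrightarrow> (f has_real_derivative f' x) (at x within {a..b})" "continuous_on {a..b} f'"
  shows "\<exists>L. L-lipschitz_on {a..b} f"
proof -
  have "compact (f' ` {a..b})" by (rule compact_continuous_image[OF assms(2)]) simp
  then have "bounded (f' ` {a..b})" by (rule compact_imp_bounded)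
  then obtain C where "\<forall>y\<in>f' ` {a..b}. norm y \<le> C" unfolding bounded_iff by blast
  then have C: "\<bar>f' x\<bar> \<le> C" if "x \<in> {a..b}" for x using that by auto
  have "\<bar>C\<bar>-lipschitz_on {a..b} f"
  proof (rule lipschitz_onI)
    fix x y assume xy: "x \<in> {a..b}" "y \<in> {a..b}"
    have "norm (f x - f y) \<le> \<bar>C\<bar> * norm (x - y)"
      by (rule field_differentiable_bound[of "{a..b}" _ f']) (use xy assms(1) C in \<open>force+\<close>)
    then show "dist (f x) (f y) \<le> \<bar>C\<bar> * dist x y" by (simp add: dist_norm)
  qed simp
  then show ?thesis by blast
qed

text \<open>\<open>t0 = k\<^sup>2 r\<^sup>2 / 4\<close> stands for the radius \<open>r\<close>. The positivity assumption says that \<open>r\<close> does not exceed the critical radius;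
  it allows \<open>entire_J \<nu> t0 = 0\<close>.\<close>

locale subcritical_ball =
  fixes k \<nu> t0 :: real and z :: "'a::euclidean_space"
  assumes k: "0 < k" and dim: "real DIM('a) = 2 * \<nu> + 2" and \<nu>: "0 \<le> \<nu>" and t0: "0 < t0"
    and pos: "\<And>s. 0 \<le> s \<Longrightarrow> s < t0 \<Longrightarrow> entire_J \<nu> s > 0"
begin

definition radius :: real where "radius = 2 * sqrt t0 / k"

text \<open>\<open>c\<^sub>k(radius)\<close> in terms of \<open>t0\<close>.\<close>

definition mass :: real where
  "mass = (4 * pi / k\<^sup>2) powr (\<nu> + 1) * (t0 powr (\<nu> + 1) * entire_J (\<nu> + 1) t0)"

definition tt :: "'a \<Rightarrow> real" where "tt x = k\<^sup>2 / 4 * (norm (x - z))\<^sup>2"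

text \<open>The coefficient of \<open>entire_J \<nu>\<close> inside the ball, dictated by \<open>C\<^sup>1\<close> matching at \<open>t0\<close>.\<close>

definition amplitude :: real where "amplitude = - pi * t0 powr (\<nu> + 1) * radial_Y (\<nu> + 1) t0"

text \<open>Beyond \<open>t0\<close> the terms in \<open>entire_J \<nu>\<close> and the constants cancel, and what remains is the multiple of
  \<open>radial_Y \<nu>\<close> that gives the potential of the point mass. Writing it as the interior function plus a glued
  excess makes the matching visible.\<close>

definition profile :: "real \<Rightarrow> real" where
  "profile t = (amplitude * entire_J \<nu> t - 1 + (if t \<le> t0 then 0 else excess \<nu> t0 t)) / k\<^sup>2"

definition profile' :: "real \<Rightarrow> real" where
  "profile' t = (- amplitude * entire_J (\<nu> + 1) t + (if t \<le> t0 then 0 else excess' \<nu> t0 t)) / k\<^sup>2"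

definition profile'' :: "real \<Rightarrow> real" where
  "profile'' t = (amplitude * entire_J (\<nu> + 2) t + (if t \<le> t0 then 0 else excess'' \<nu> t0 t)) / k\<^sup>2"

definition V :: "'a \<Rightarrow> real" where "V x = profile (tt x)"

text \<open>The potential of the point mass minus \<open>V\<close>, away from \<open>z\<close>. At \<open>z\<close> itself the potential is infinite and the value of \<open>gap\<close>
  is meaningless.\<close>

definition gap :: "'a \<Rightarrow> real" where "gap x = (if tt x < t0 then excess \<nu> t0 (tt x) / k\<^sup>2 else 0)"

lemma radius_pos: "radius > 0" using k t0 by (simp add: radius_def)

lemma tt_nonneg: "0 \<le> tt x" by (simp add: tt_def)

lemma tt_pos_iff: "0 < tt x \<longleftrightarrow> x \<noteq> z" using k by (simp add: tt_def zero_less_mult_iff)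

lemma tt_less_iff: "0 \<le> s \<Longrightarrow> tt x < s \<longleftrightarrow> dist z x < 2 * sqrt s / k"
proof -
  assume s: "0 \<le> s"
  have "tt x < s \<longleftrightarrow> (k * dist z x / 2)\<^sup>2 < (sqrt s)\<^sup>2"
    using s by (simp add: tt_def power_mult_distrib power_divide dist_norm norm_minus_commute)
  also have "\<dots> \<longleftrightarrow> k * dist z x / 2 < sqrt s"
    using power_mono_iff[of "sqrt s" "k * dist z x / 2" 2] k s by (simp add: not_le[symmetric])
  also have "\<dots> \<longleftrightarrow> dist z x < 2 * sqrt s / k" using k by (simp add: field_simps)
  finally show ?thesis .
qed

lemma mem_ball_radius: "x \<in> ball z radius \<longleftrightarrow> tt x < t0"
  using tt_less_iff[of t0 x] t0 by (simp add: radius_def)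

lemma tt_continuous: "continuous_on S tt" unfolding tt_def by (intro continuous_intros)

lemma gap_nonneg: "x \<noteq> z \<Longrightarrow> 0 \<le> gap x"
  using excess_pos[of \<nu> t0 "tt x"] \<nu> pos tt_pos_iff[of x] by (auto simp: gap_def less_imp_le)

text \<open>The potential is linear in the mass. For \<open>T = 1\<close> this identifies \<open>V + gap\<close> with the potential of the
  matching point mass.\<close>

lemma potential_eq:
  assumes "T > 0"
  shows "helmholtz_potential k (scale_measure (ennreal (T * mass)) (return borel z)) x =
    (if x = z then \<infinity> else ereal (T * (V x + gap x)))"
proof -
  have g: "entire_J (\<nu> + 1) t0 > 0" using entire_J_Suc_pos[of \<nu> t0 t0] \<nu> t0 pos by auto
  have m: "mass > 0" using g t0 k by (simp add: mass_def)
  have "(4 * pi / k\<^sup>2) powr (\<nu> + 1) * ((k\<^sup>2 / (4 * pi)) powr \<nu> / 4) = pi / k\<^sup>2"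
  proof -
    have "(4 * pi / k\<^sup>2) powr \<nu> * (k\<^sup>2 / (4 * pi)) powr \<nu> = (4 * pi / k\<^sup>2 * (k\<^sup>2 / (4 * pi))) powr \<nu>"
      by (rule powr_mult[symmetric])
    also have "4 * pi / k\<^sup>2 * (k\<^sup>2 / (4 * pi)) = 1" using k by simp
    finally have "(4 * pi / k\<^sup>2) powr \<nu> * (k\<^sup>2 / (4 * pi)) powr \<nu> = 1" by simp
    moreover have "(4 * pi / k\<^sup>2) powr (\<nu> + 1) = (4 * pi / k\<^sup>2) powr \<nu> * (4 * pi / k\<^sup>2)"
      using k by (simp add: powr_add)
    ultimately have "(4 * pi / k\<^sup>2) powr (\<nu> + 1) * ((k\<^sup>2 / (4 * pi)) powr \<nu> / 4) = 1 * (4 * pi / k\<^sup>2) / 4"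
      by (simp add: field_simps)
    then show ?thesis by simp
  qed
  then have c: "mass * ((k\<^sup>2 / (4 * pi)) powr \<nu> / 4) = pi / k\<^sup>2 * (t0 powr (\<nu> + 1) * entire_J (\<nu> + 1) t0)"
  proof -
    assume e: "(4 * pi / k\<^sup>2) powr (\<nu> + 1) * ((k\<^sup>2 / (4 * pi)) powr \<nu> / 4) = pi / k\<^sup>2"
    have "mass * ((k\<^sup>2 / (4 * pi)) powr \<nu> / 4)
        = (4 * pi / k\<^sup>2) powr (\<nu> + 1) * ((k\<^sup>2 / (4 * pi)) powr \<nu> / 4) * (t0 powr (\<nu> + 1) * entire_J (\<nu> + 1) t0)"
      unfolding mass_def by (simp only: mult_ac)
    then show ?thesis unfolding e .
  qed
  have "V x + gap x = - (mass * ((k\<^sup>2 / (4 * pi)) powr \<nu> / 4)) * radial_Y \<nu> (tt x)"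
  proof -
    have "V x + gap x = (amplitude * entire_J \<nu> (tt x) - 1 + excess \<nu> t0 (tt x)) / k\<^sup>2"
      using excess_touch(1)[OF t0 \<nu>] by (auto simp: V_def profile_def gap_def add_divide_distrib)
    also have "amplitude * entire_J \<nu> (tt x) - 1 + excess \<nu> t0 (tt x) = - pi * t0 powr (\<nu> + 1) * entire_J (\<nu> + 1) t0 * radial_Y \<nu> (tt x)"
      by (simp add: amplitude_def excess_def algebra_simps)
    finally show ?thesis unfolding c by simp
  qed
  then have "T * (V x + gap x) = - (T * mass * ((k\<^sup>2 / (4 * pi)) powr \<nu> / 4)) * radial_Y \<nu> (tt x)"
    by simp
  then show ?thesis using potential_of_point_mass[OF k dim \<nu>, of "T * mass" z x] assms m
    by (simp add: tt_def)
qed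

text \<open>Where \<open>e\<close> and its derivative vanish, extending \<open>e\<close> by \<open>0\<close> preserves differentiability.\<close>

lemma glued_has_derivative:
  assumes "\<And>t. t > 0 \<Longrightarrow> (e has_real_derivative e' t) (at t)" "e t0 = 0"
    and "t \<noteq> t0 \<or> e' t0 = 0"
  shows "((\<lambda>t. if t \<le> t0 then 0 else e t) has_real_derivative (if t \<le> t0 then 0 else e' t)) (at t)"
proof -
  consider "t < t0" | "t > t0" | "t = t0" by linarith
  then show ?thesis
  proof cases
    case 1
    then have "((\<lambda>t. if t \<le> t0 then 0 else e t) has_real_derivative 0) (at t)"
      by (intro has_field_derivative_transform_within_open[OF DERIV_const, of "{..<t0}"]) auto
    then show ?thesis using 1 by simp
  next
    case 2
    then have "((\<lambda>t. if t \<le> t0 then 0 else e t) has_real_derivative e' t) (at t)"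
      using t0 by (intro has_field_derivative_transform_within_open[OF assms(1), of _ "{t0<..}"]) auto
    then show ?thesis using 2 by simp
  next
    case 3
    then have e': "e' t0 = 0" using assms(3) by simp
    have "((\<lambda>h. e h / (h - t0)) \<longlongrightarrow> 0) (at t0)"
      using assms(1)[OF t0] assms(2) e' by (simp add: has_field_derivative_iff)
    from tendsto_rabs_zero[OF this] have lim: "((\<lambda>h. \<bar>e h / (h - t0)\<bar>) \<longlongrightarrow> 0) (at t0)" .
    have "((\<lambda>h. (if h \<le> t0 then 0 else e h) / (h - t0)) \<longlongrightarrow> 0) (at t0)"
      by (rule Lim_null_comparison[OF _ lim]) (simp add: always_eventually)
    then show ?thesis using 3 by (simp add: has_field_derivative_iff)
  qed
qed

lemma profile_has_derivative: "(profile has_real_derivative profile' t) (at t)"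
proof -
  have "((\<lambda>t. if t \<le> t0 then 0 else excess \<nu> t0 t) has_real_derivative (if t \<le> t0 then 0 else excess' \<nu> t0 t)) (at t)"
    by (rule glued_has_derivative) (use excess_has_derivative \<nu> excess_touch[OF t0 \<nu>] in auto)
  then show ?thesis unfolding profile_def[abs_def]
    by (rule DERIV_cong[OF DERIV_cdivide[OF DERIV_add[OF DERIV_diff[OF DERIV_cmult[OF entire_J_has_derivative] DERIV_const]]]])
       (simp add: profile'_def)
qed

lemma profile'_has_derivative:
  assumes "t \<noteq> t0"
  shows "(profile' has_real_derivative profile'' t) (at t)"
proof -
  have "((\<lambda>t. if t \<le> t0 then 0 else excess' \<nu> t0 t) has_real_derivative (if t \<le> t0 then 0 else excess'' \<nu> t0 t)) (at t)"
    by (rule glued_has_derivative) (use excess'_has_derivative \<nu> excess_touch[OF t0 \<nu>] assms in auto)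
  then show ?thesis unfolding profile'_def[abs_def]
    by (rule DERIV_cong[OF DERIV_cdivide[OF DERIV_add[OF DERIV_cmult[OF entire_J_has_derivative]]]])
       (simp add: profile''_def add.commute)
qed

lemma excess''_continuous: "0 < a \<Longrightarrow> continuous_on {a..b} (excess'' \<nu> t0)"
proof -
  assume a: "0 < a"
  have "continuous_on {a..b} (excess \<nu> t0)" "continuous_on {a..b} (excess' \<nu> t0)"
    by (rule DERIV_continuous_on[OF excess_has_derivative] DERIV_continuous_on[OF excess'_has_derivative]; use a \<nu> in auto)+
  then show ?thesis unfolding excess''_def using a by (intro continuous_intros) auto
qed

lemma profile'_lipschitz: "\<exists>L. L-lipschitz_on {0..K} profile'"
proof -
  (* Enlarging the interval ensures that the two Lipschitz pieces meet at t0. *)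
  define K' where "K' = max K t0"
  have K': "K \<le> K'" "t0 \<le> K'" by (auto simp: K'_def)
  obtain L1 where L1: "L1-lipschitz_on {0..t0} (\<lambda>t. - amplitude * entire_J (\<nu> + 1) t / k\<^sup>2)"
  proof -
    have "\<exists>L. L-lipschitz_on {0..t0} (\<lambda>t. - amplitude * entire_J (\<nu> + 1) t / k\<^sup>2)"
    proof (rule C1_imp_lipschitz_on)
      show "((\<lambda>t. - amplitude * entire_J (\<nu> + 1) t / k\<^sup>2) has_real_derivative - amplitude * - entire_J (\<nu> + 1 + 1) t / k\<^sup>2)
         (at t within {0..t0})" for t
        by (intro DERIV_cdivide DERIV_cmult entire_J_has_derivative)
      show "continuous_on {0..t0} (\<lambda>t. - amplitude * - entire_J (\<nu> + 1 + 1) t / k\<^sup>2)"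
        using k by (intro continuous_intros) auto
    qed
    then show ?thesis using that by blast
  qed
  obtain L2 where L2: "L2-lipschitz_on {t0..K'} (\<lambda>t. (- amplitude * entire_J (\<nu> + 1) t + excess' \<nu> t0 t) / k\<^sup>2)"
  proof -
    have "\<exists>L. L-lipschitz_on {t0..K'} (\<lambda>t. (- amplitude * entire_J (\<nu> + 1) t + excess' \<nu> t0 t) / k\<^sup>2)"
    proof (rule C1_imp_lipschitz_on)
      show "((\<lambda>t. (- amplitude * entire_J (\<nu> + 1) t + excess' \<nu> t0 t) / k\<^sup>2) has_real_derivative
         (- amplitude * - entire_J (\<nu> + 1 + 1) t + excess'' \<nu> t0 t) / k\<^sup>2) (at t within {t0..K'})" if "t \<in> {t0..K'}" for t
        by (intro DERIV_cdivide DERIV_add DERIV_cmult entire_J_has_derivative excess'_has_derivative \<nu>) (use t0 that in auto)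
      show "continuous_on {t0..K'} (\<lambda>t. (- amplitude * - entire_J (\<nu> + 1 + 1) t + excess'' \<nu> t0 t) / k\<^sup>2)"
        using k by (intro continuous_intros excess''_continuous t0) auto
    qed
    then show ?thesis using that by blast
  qed
  define L where "L = max L1 L2"
  have "L-lipschitz_on {0..t0} profile'"
    by (rule lipschitz_on_transform[OF lipschitz_on_le[OF L1]]) (auto simp: L_def profile'_def)
  moreover have "L-lipschitz_on {t0..K'} profile'"
    by (rule lipschitz_on_transform[OF lipschitz_on_le[OF L2]]) (use excess_touch(2)[OF t0 \<nu>] in \<open>auto simp: L_def profile'_def\<close>)
  ultimately have "L-lipschitz_on {0..K'} (\<lambda>x. if x \<le> t0 then profile' x else profile' x)"
    by (rule lipschitz_on_concat) simp
  then have "L-lipschitz_on {0..K'} profile'" by simp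
  then have "L-lipschitz_on {0..K} profile'" by (rule lipschitz_on_subset) (use K' in auto)
  then show ?thesis by blast
qed

lemma profile''_measurable: "profile'' \<in> borel_measurable borel"
proof -
  have "continuous_on {t0<..} (excess'' \<nu> t0)"
    unfolding continuous_on_eq_continuous_within
  proof
    fix t assume t: "t \<in> {t0<..}"
    have "continuous_on {t0..t + 1} (excess'' \<nu> t0)" by (rule excess''_continuous[OF t0])
    then have "continuous (at t within {t0..t + 1}) (excess'' \<nu> t0)"
      using t by (simp add: continuous_on_eq_continuous_within)
    moreover have "at t within {t0..t + 1} = at t within {t0<..}"
      by (rule at_within_nhd[of _ "{t0<..<t + 1}"]) (use t in auto)
    ultimately show "continuous (at t within {t0<..}) (excess'' \<nu> t0)" by simp
  qed
  then have "(\<lambda>t. indicator {t0<..} t *\<^sub>R excess'' \<nu> t0 t) \<in> borel_measurable borel"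
    by (intro borel_measurable_continuous_on_indicator) auto
  moreover have "entire_J (\<nu> + 2) \<in> borel_measurable borel"
    by (rule borel_measurable_continuous_onI) (intro continuous_intros)
  ultimately have "(\<lambda>t. (amplitude * entire_J (\<nu> + 2) t + indicator {t0<..} t *\<^sub>R excess'' \<nu> t0 t) / k\<^sup>2) \<in> borel_measurable borel"
    by measurable
  moreover have "(\<lambda>t. (amplitude * entire_J (\<nu> + 2) t + indicator {t0<..} t *\<^sub>R excess'' \<nu> t0 t) / k\<^sup>2) = profile''"
    by (auto simp: profile''_def indicator_def)
  ultimately show ?thesis by simp
qed

lemma profile_equation:
  assumes "0 \<le> t"
  shows "t * profile'' t + (\<nu> + 1) * profile' t + profile t = (if t \<le> t0 then - 1 / k\<^sup>2 else 0)"
proof -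
  have J: "t * entire_J (\<nu> + 2) t = (\<nu> + 1) * entire_J (\<nu> + 1) t - entire_J \<nu> t"
    using entire_J_recurrence[of "\<nu> + 1" t] by (simp add: add.commute)
  have JA: "t * (amplitude * entire_J (\<nu> + 2) t) = amplitude * ((\<nu> + 1) * entire_J (\<nu> + 1) t - entire_J \<nu> t)"
    unfolding J[symmetric] by simp
  have comb: "t * (X / k\<^sup>2) + n * (Y / k\<^sup>2) + Z / k\<^sup>2 = (t * X + n * Y + Z) / k\<^sup>2" for n X Y Z :: real
    by (simp add: add_divide_distrib)
  show ?thesis
  proof (cases "t \<le> t0")
    case True
    have "t * profile'' t + (\<nu> + 1) * profile' t + profile t
       = (t * (amplitude * entire_J (\<nu> + 2) t) - (\<nu> + 1) * (amplitude * entire_J (\<nu> + 1) t) + (amplitude * entire_J \<nu> t - 1)) / k\<^sup>2"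
      using True by (simp add: profile_def profile'_def profile''_def add_divide_distrib diff_divide_distrib)
    also have "\<dots> = - 1 / k\<^sup>2" unfolding JA by (simp add: algebra_simps)
    finally show ?thesis using True by simp
  next
    case False
    have E: "t * excess'' \<nu> t0 t = 1 - excess \<nu> t0 t - (\<nu> + 1) * excess' \<nu> t0 t"
      using False t0 by (simp add: excess''_def)
    have "t * profile'' t + (\<nu> + 1) * profile' t + profile t
       = (t * (amplitude * entire_J (\<nu> + 2) t + excess'' \<nu> t0 t) + (\<nu> + 1) * (- amplitude * entire_J (\<nu> + 1) t + excess' \<nu> t0 t)
          + (amplitude * entire_J \<nu> t - 1 + excess \<nu> t0 t)) / k\<^sup>2"
      using False by (simp only: profile_def profile'_def profile''_def if_False comb)
    also have "\<dots> = (t * (amplitude * entire_J (\<nu> + 2) t) + t * excess'' \<nu> t0 t + (\<nu> + 1) * (- amplitude * entire_J (\<nu> + 1) t + excess' \<nu> t0 t)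
          + (amplitude * entire_J \<nu> t - 1 + excess \<nu> t0 t)) / k\<^sup>2"
      by (simp only: distrib_left)
    also have "\<dots> = 0" unfolding JA E by (simp add: algebra_simps)
    finally show ?thesis using False by simp
  qed
qed

lemma V_continuous: "continuous_on S V"
proof -
  have "continuous_on UNIV profile" by (rule DERIV_continuous_on[OF profile_has_derivative])
  then show ?thesis unfolding V_def by (rule continuous_on_compose2[OF _ tt_continuous]) auto
qed

text \<open>This is \<open>- (\<Delta> + k\<^sup>2) V = m|\<^sub>B\<close> in the sense of distributions: the gradient of \<open>V\<close> has no jump across the sphere, so
  Green's identity for \<open>V\<close> has no surface term.\<close>

lemma V_weak_equation:
  assumes \<phi>: "\<phi> \<in> test_functions"
  shows "(LINT x|lborel. V x * - (laplacian \<phi> x + k\<^sup>2 * \<phi> x)) = (LINT x|lborel. \<phi> x * indicator (ball z radius) x)"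
proof -
  define LV where "LV x = 4 * (k\<^sup>2 / 4) * (k\<^sup>2 / 4 * (norm (x - z))\<^sup>2) * profile'' (k\<^sup>2 / 4 * (norm (x - z))\<^sup>2)
     + 2 * (k\<^sup>2 / 4) * DIM('a) * profile' (k\<^sup>2 / 4 * (norm (x - z))\<^sup>2)" for x
  have \<sigma>: "k\<^sup>2 / 4 > 0" using k by simp
  have L1: "(LINT x|lborel. V x * laplacian \<phi> x) = (LINT x|lborel. \<phi> x * LV x)"
    unfolding V_def tt_def LV_def
    by (rule integral_radial_laplacian(1)[OF \<sigma>, where ?P1.0=profile' and ?P2.0=profile'' and ?t0.0=t0])
       (fact profile_has_derivative profile'_has_derivative profile'_lipschitz profile''_measurable \<phi>)+
  have L2: "integrable lborel (\<lambda>x. \<phi> x * LV x)"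
    unfolding LV_def
    by (rule integral_radial_laplacian(2)[OF \<sigma>, where P=profile and ?P1.0=profile' and ?P2.0=profile'' and ?t0.0=t0])
       (fact profile_has_derivative profile'_has_derivative profile'_lipschitz profile''_measurable \<phi>)+
  have LV: "LV x = k\<^sup>2 * (tt x * profile'' (tt x) + (\<nu> + 1) * profile' (tt x))" for x
    unfolding LV_def tt_def dim by (simp add: algebra_simps)
  have eq: "LV x + k\<^sup>2 * V x = - indicator {x. tt x \<le> t0} x" for x
  proof -
    have "LV x + k\<^sup>2 * V x = k\<^sup>2 * (tt x * profile'' (tt x) + (\<nu> + 1) * profile' (tt x) + profile (tt x))"
      unfolding LV V_def by (simp add: algebra_simps)
    then show ?thesis unfolding profile_equation[OF tt_nonneg] using k by (simp add: indicator_def)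
  qed
  note iV = integrable_continuous_mult_test_function[OF V_continuous]
  have i1: "integrable lborel (\<lambda>x. V x * laplacian \<phi> x)"
    by (intro iV test_functions_laplacian \<phi>)
  have "(LINT x|lborel. V x * - (laplacian \<phi> x + k\<^sup>2 * \<phi> x))
      = (LINT x|lborel. - (V x * laplacian \<phi> x) - k\<^sup>2 * (V x * \<phi> x))"
    by (simp add: algebra_simps)
  also have "\<dots> = - (LINT x|lborel. \<phi> x * LV x) - k\<^sup>2 * (LINT x|lborel. V x * \<phi> x)"
    using i1 iV[OF \<phi>] L1 by simp
  also have "\<dots> = (LINT x|lborel. - (\<phi> x * LV x) - k\<^sup>2 * (V x * \<phi> x))"
    using L2 iV[OF \<phi>] by simp
  also have "\<dots> = (LINT x|lborel. \<phi> x * indicator {x. tt x \<le> t0} x)"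
  proof (intro Bochner_Integration.integral_cong refl)
    fix x
    have "- (\<phi> x * LV x) - k\<^sup>2 * (V x * \<phi> x) = \<phi> x * - (LV x + k\<^sup>2 * V x)"
      by (simp add: algebra_simps)
    then show "- (\<phi> x * LV x) - k\<^sup>2 * (V x * \<phi> x) = \<phi> x * indicator {x. tt x \<le> t0} x"
      unfolding eq by simp
  qed
  also have "\<dots> = (LINT x|lborel. \<phi> x * indicator (ball z radius) x)"
  proof (rule integral_cong_AE)
    have [measurable]: "\<phi> \<in> borel_measurable borel"
      by (rule borel_measurable_continuous_onI[OF test_function_continuous[OF \<phi>]])
    have [measurable]: "tt \<in> borel_measurable borel"
      by (rule borel_measurable_continuous_onI[OF tt_continuous])
    show "(\<lambda>x. \<phi> x * indicator {x. tt x \<le> t0} x) \<in> borel_measurable lborel" by measurable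
    show "(\<lambda>x. \<phi> x * indicator (ball z radius) x) \<in> borel_measurable lborel"
      by (intro borel_measurable_times borel_measurable_indicator) auto
    show "AE x in lborel. \<phi> x * indicator {x. tt x \<le> t0} x = \<phi> x * indicator (ball z radius) x"
      using AE_not_in_sphere[of z radius]
    proof eventually_elim
      case (elim x)
      have "tt x \<noteq> t0"
      proof
        assume "tt x = t0"
        then have "t0 = (k * dist z x / 2)\<^sup>2"
          by (simp add: tt_def power_mult_distrib power_divide dist_norm norm_minus_commute)
        then have "sqrt t0 = k * dist z x / 2" using k by simp
        then have "dist z x = radius" using k by (simp add: radius_def field_simps)
        then show False using elim by simp
      qed
      then show ?case using mem_ball_radius[of x] by (auto simp: indicator_def)
    qed
  qed
  finally show ?thesis .
qed

lemma helmholtz_solution: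
  defines "f \<equiv> \<lambda>x. entire_J \<nu> (tt x)"
  obtains f1 f2 where
    "\<And>x b. b \<in> Basis \<Longrightarrow> ((\<lambda>h. f (x + h *\<^sub>R b)) has_real_derivative f1 b x) (at 0)"
    "\<And>x b. b \<in> Basis \<Longrightarrow> ((\<lambda>h. f1 b (x + h *\<^sub>R b)) has_real_derivative f2 b x) (at 0)"
    "\<And>x. (\<Sum>b\<in>Basis. f2 b x) + k\<^sup>2 * f x = 0"
proof -
  define f1 where "f1 b x = - entire_J (\<nu> + 1) (tt x) * (k\<^sup>2 / 2 * ((x - z) \<bullet> b))" for b x
  define f2 where "f2 b x = entire_J (\<nu> + 2) (tt x) * (k\<^sup>2 / 2 * ((x - z) \<bullet> b))\<^sup>2 - entire_J (\<nu> + 1) (tt x) * (k\<^sup>2 / 2)" for b x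
  have d: "((\<lambda>h. entire_J \<mu> (tt (x + h *\<^sub>R b))) has_real_derivative - entire_J (\<mu> + 1) (tt x) * (k\<^sup>2 / 2 * ((x - z) \<bullet> b))) (at 0)" for \<mu> x b
    using radial_line_derivative[of "entire_J \<mu>" "- entire_J (\<mu> + 1) (tt x)" "k\<^sup>2 / 4" x 0 b z] entire_J_has_derivative[of \<mu> "tt x" UNIV]
    by (simp add: tt_def)
  show ?thesis
  proof (rule that)
    fix x b :: 'a assume b: "b \<in> Basis"
    show "((\<lambda>h. f (x + h *\<^sub>R b)) has_real_derivative f1 b x) (at 0)"
      unfolding f_def f1_def by (rule d)
    have l: "((\<lambda>h. k\<^sup>2 / 2 * ((x + h *\<^sub>R b - z) \<bullet> b)) has_real_derivative k\<^sup>2 / 2) (at 0)"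
      using b by (auto intro!: derivative_eq_intros simp: inner_add_left inner_diff_left)
    have "((\<lambda>h. - entire_J (\<nu> + 1) (tt (x + h *\<^sub>R b))) has_real_derivative - (- entire_J (\<nu> + 1 + 1) (tt x) * (k\<^sup>2 / 2 * ((x - z) \<bullet> b)))) (at 0)"
      by (rule DERIV_minus[OF d])
    from DERIV_mult[OF this l] show "((\<lambda>h. f1 b (x + h *\<^sub>R b)) has_real_derivative f2 b x) (at 0)"
      unfolding f1_def f2_def by (rule DERIV_cong) (simp add: power2_eq_square add.commute mult_ac)
  next
    fix x
    have "(\<Sum>b\<in>Basis. f2 b x) = entire_J (\<nu> + 2) (tt x) * (k\<^sup>2 / 2)\<^sup>2 * (\<Sum>b\<in>Basis. ((x - z) \<bullet> b) * ((x - z) \<bullet> b)) - DIM('a) * (entire_J (\<nu> + 1) (tt x) * (k\<^sup>2 / 2))"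
      unfolding f2_def by (simp add: sum_subtractf sum_distrib_left power2_eq_square mult_ac)
    also have "(\<Sum>b\<in>Basis. ((x - z) \<bullet> b) * ((x - z) \<bullet> b)) = (norm (x - z))\<^sup>2"
      by (simp only: euclidean_inner[symmetric] dot_square_norm)
    also have "entire_J (\<nu> + 2) (tt x) * (k\<^sup>2 / 2)\<^sup>2 * (norm (x - z))\<^sup>2 - DIM('a) * (entire_J (\<nu> + 1) (tt x) * (k\<^sup>2 / 2))
       = k\<^sup>2 * (tt x * entire_J (\<nu> + 2) (tt x) - (\<nu> + 1) * entire_J (\<nu> + 1) (tt x))"
      unfolding dim by (simp add: tt_def power2_eq_square algebra_simps)
    also have "tt x * entire_J (\<nu> + 2) (tt x) - (\<nu> + 1) * entire_J (\<nu> + 1) (tt x) = - entire_J \<nu> (tt x)"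
      using entire_J_recurrence[of "\<nu> + 1" "tt x"] by (simp add: add.commute)
    finally show "(\<Sum>b\<in>Basis. f2 b x) + k\<^sup>2 * f x = 0" by (simp add: f_def)
  qed
qed

text \<open>The general bound for subsolutions on the concentric ball \<open>t < t1\<close>, with \<open>f = entire_J \<nu>\<close>. By continuity of the gap,
  \<open>W\<close> is at most slightly more than \<open>T\<close> times the gap at \<open>t1\<close> in a neighbourhood of its boundary; a limit
  then removes this slack.\<close>

lemma subsolution_bound:
  assumes W: "loc_integrable W" and T: "T > 0"
    and weak: "\<And>\<phi>. \<phi> \<in> test_functions \<Longrightarrow> (\<And>x. 0 \<le> \<phi> x) \<Longrightarrow> (\<And>x. \<phi> x \<noteq> 0 \<Longrightarrow> x \<in> ball z radius) \<Longrightarrow>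
        (LINT x|lborel. W x * (laplacian \<phi> x + k\<^sup>2 * \<phi> x)) \<ge> \<tau> * (LINT x|lborel. \<phi> x)"
    and le: "AE x in lborel. W x \<le> T * gap x"
    and t1: "tt x0 < t1" "t1 < t0"
    and low: "\<rho>0 > 0" "\<And>\<rho>. 0 < \<rho> \<Longrightarrow> \<rho> < \<rho>0 \<Longrightarrow>
        (LINT y|lborel. (W y - \<beta>) * indicator (ball x0 \<rho>) y) \<ge> 0"
  shows "\<beta> \<le> entire_J \<nu> (tt x0) / entire_J \<nu> t1 * ((T * excess \<nu> t0 t1 - \<tau>) / k\<^sup>2) + \<tau> / k\<^sup>2"
proof -
  obtain f1 f2 where f: "\<And>x b. b \<in> Basis \<Longrightarrow> ((\<lambda>h. entire_J \<nu> (tt (x + h *\<^sub>R b))) has_real_derivative f1 b x) (at 0)"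
    "\<And>x b. b \<in> Basis \<Longrightarrow> ((\<lambda>h. f1 b (x + h *\<^sub>R b)) has_real_derivative f2 b x) (at 0)"
    "\<And>x. (\<Sum>b\<in>Basis. f2 b x) + k\<^sup>2 * entire_J \<nu> (tt x) = 0"
      using helmholtz_solution by blast
  have t1p: "0 < t1" using t1 tt_nonneg[of x0] by linarith
  define s where "s = 2 * sqrt t1 / k"
  have s: "0 < s" "s < radius" using t1 t1p k by (auto simp: s_def radius_def divide_strict_right_mono)
  have tts: "tt x = k\<^sup>2 / 4 * (dist z x)\<^sup>2" for x by (simp add: tt_def dist_norm norm_minus_commute)
  have ss: "k\<^sup>2 / 4 * s\<^sup>2 = t1" using k t1p by (simp add: s_def power_divide power_mult_distrib)
  have sph: "tt x = t1" if "x \<in> sphere z s" for x using that ss by (simp add: tts)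
  have ball: "tt x \<le> t1" if "x \<in> cball z s" for x
  proof -
    have "(dist z x)\<^sup>2 \<le> s\<^sup>2" using that by (intro power_mono) auto
    then show ?thesis unfolding tts ss[symmetric] using k by (intro mult_left_mono) auto
  qed
  have x0: "x0 \<in> ball z s" using tt_less_iff[of t1 x0] t1p t1 by (simp add: s_def)
  have g1: "entire_J \<nu> t1 > 0" using pos t1p t1 by simp
  (* The boundary bound m has to be strict in order to hold on a whole neighbourhood of the sphere. *)
  have bound: "\<beta> \<le> entire_J \<nu> (tt x0) / entire_J \<nu> t1 * (m - \<tau> / k\<^sup>2) + \<tau> / k\<^sup>2" if m: "T * excess \<nu> t0 t1 / k\<^sup>2 < m" for m
  proof -
    have "isCont (\<lambda>d. T * excess \<nu> t0 (k\<^sup>2 / 4 * d\<^sup>2) / k\<^sup>2) s"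
    proof -
      have "isCont (excess \<nu> t0) (k\<^sup>2 / 4 * s\<^sup>2)" unfolding ss
        using excess_has_derivative[OF t1p \<nu>] by (rule DERIV_isCont)
      moreover have "isCont (\<lambda>d. k\<^sup>2 / 4 * d\<^sup>2) s" by (intro continuous_intros) auto
      ultimately have "isCont (\<lambda>d. excess \<nu> t0 (k\<^sup>2 / 4 * d\<^sup>2)) s"
        using isCont_o2[where f="\<lambda>d. k\<^sup>2 / 4 * d\<^sup>2" and g="excess \<nu> t0" and a=s]
          by blast
      then show ?thesis using k by (intro continuous_intros) auto
    qed
    then have "((\<lambda>d. T * excess \<nu> t0 (k\<^sup>2 / 4 * d\<^sup>2) / k\<^sup>2) \<longlongrightarrow> T * excess \<nu> t0 (k\<^sup>2 / 4 * s\<^sup>2) / k\<^sup>2) (nhds s)"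
      unfolding isCont_def by (subst (asm) tendsto_at_iff_tendsto_nhds)
    then have "((\<lambda>d. T * excess \<nu> t0 (k\<^sup>2 / 4 * d\<^sup>2) / k\<^sup>2) \<longlongrightarrow> T * excess \<nu> t0 t1 / k\<^sup>2) (nhds s)"
      unfolding ss .
    then have "\<forall>\<^sub>F d in nhds s. T * excess \<nu> t0 (k\<^sup>2 / 4 * d\<^sup>2) / k\<^sup>2 < m"
      using m by (rule order_tendstoD)
    then obtain \<rho>1 where \<rho>1: "\<rho>1 > 0" "\<And>d. \<bar>d - s\<bar> < \<rho>1 \<Longrightarrow> T * excess \<nu> t0 (k\<^sup>2 / 4 * d\<^sup>2) / k\<^sup>2 < m"
      unfolding eventually_nhds_metric by (auto simp: dist_real_def)
    define \<rho> where "\<rho> = min \<rho>1 (radius - s)"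
    have \<rho>: "\<rho> > 0" using \<rho>1 s by (simp add: \<rho>_def)
    have near: "AE y in lborel. \<bar>dist z y - s\<bar> < \<rho> \<longrightarrow> W y \<le> m"
      using le
    proof eventually_elim
      case (elim y)
      show ?case
      proof
        assume y: "\<bar>dist z y - s\<bar> < \<rho>"
        then have "\<bar>dist z y - s\<bar> < radius - s" by (simp add: \<rho>_def)
        then have "dist z y < radius" by linarith
        then have "y \<in> ball z radius" by simp
        then have "tt y < t0" by (simp only: mem_ball_radius)
        then have "T * gap y = T * excess \<nu> t0 (k\<^sup>2 / 4 * (dist z y)\<^sup>2) / k\<^sup>2"
          by (simp add: gap_def tts)
        also have "\<dots> < m" using \<rho>1(2) y by (simp add: \<rho>_def)
        finally show "W y \<le> m" using elim by simp
      qed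
    qed
    show ?thesis
    proof (rule weak_subsolution_upper_bound[OF W k s weak _ _ f _ g1 \<rho> near x0 low])
      show "continuous_on UNIV (\<lambda>x. entire_J \<nu> (tt x))" by (intro continuous_intros tt_continuous)
      show "entire_J \<nu> (tt x) > 0" if "x \<in> cball z s" for x
        using ball[OF that] t1 by (intro pos tt_nonneg) auto
      show "entire_J \<nu> (tt x) = entire_J \<nu> t1" if "x \<in> sphere z s" for x using sph[OF that] by simp
    qed auto
  qed
  define m0 where "m0 = T * excess \<nu> t0 t1 / k\<^sup>2"
  have "\<beta> \<le> entire_J \<nu> (tt x0) / entire_J \<nu> t1 * (m0 - \<tau> / k\<^sup>2) + \<tau> / k\<^sup>2"
  proof (rule tendsto_lowerbound)
    show "((\<lambda>m. entire_J \<nu> (tt x0) / entire_J \<nu> t1 * (m - \<tau> / k\<^sup>2) + \<tau> / k\<^sup>2) \<longlongrightarrow>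
       entire_J \<nu> (tt x0) / entire_J \<nu> t1 * (m0 - \<tau> / k\<^sup>2) + \<tau> / k\<^sup>2) (at_right m0)"
      by (intro tendsto_intros)
    show "\<forall>\<^sub>F m in at_right m0. \<beta> \<le> entire_J \<nu> (tt x0) / entire_J \<nu> t1 * (m - \<tau> / k\<^sup>2) + \<tau> / k\<^sup>2"
      unfolding eventually_at_filter using bound by (auto simp: m0_def intro!: always_eventually)
  qed simp
  then show ?thesis by (simp add: m0_def diff_divide_distrib)
qed

end

section \<open>Distributions of functions\<close>

lemma continuous_distribution:
  fixes F :: "'a::euclidean_space \<Rightarrow> real"
  assumes F: "continuous_on UNIV F"
  shows "distr_of_fun (\<lambda>x. ereal (F x)) \<in> distributions"
proof -
  let ?v = "distr_of_fun (\<lambda>x. ereal (F x))"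
  have v: "?v \<phi> = (LINT x|lborel. F x * \<phi> x)" if "\<phi> \<in> test_functions" for \<phi>
    using that by (simp add: distr_of_fun_def)
  note int = integrable_continuous_mult_test_function[OF F]
  have add: "?v (\<lambda>x. \<phi> x + \<psi> x) = ?v \<phi> + ?v \<psi>" if t: "\<phi> \<in> test_functions" "\<psi> \<in> test_functions" for \<phi> \<psi>
  proof -
    have "(\<lambda>x. \<phi> x + \<psi> x) \<in> test_functions"
      using test_functions_lincomb[OF t, of 1 1] by simp
    then show ?thesis using t int[OF t(1)] int[OF t(2)] by (simp add: v distrib_left)
  qed
  have scale: "?v (\<lambda>x. a * \<phi> x) = a * ?v \<phi>" if t: "\<phi> \<in> test_functions" for \<phi> a
  proof -
    have "(\<lambda>x. a * \<phi> x) \<in> test_functions" using test_functions_lincomb[OF t t, of a 0] by simp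
    moreover have "(LINT x|lborel. F x * (a * \<phi> x)) = (LINT x|lborel. a * (F x * \<phi> x))"
      by (simp add: mult_ac)
    ultimately show ?thesis using t by (simp add: v)
  qed
  have bound: "\<exists>C m. \<forall>\<phi>\<in>test_functions. {x. \<phi> x \<noteq> 0} \<subseteq> K \<longrightarrow> \<bar>?v \<phi>\<bar> \<le> C * test_seminorm m \<phi>" if K: "compact K" for K
  proof (intro exI ballI impI)
    fix \<phi> assume \<phi>: "\<phi> \<in> test_functions" and supp: "{x. \<phi> x \<noteq> 0} \<subseteq> K"
    have "{bs :: 'a list. set bs \<subseteq> Basis \<and> length bs \<le> 0} = {[]}" by auto
    then have sn: "test_seminorm 0 \<phi> = (SUP x. \<bar>\<phi> x\<bar>)"
      by (simp add: test_seminorm_def iter_partial_def)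
    obtain C M where "\<And>x. \<bar>\<phi> x\<bar> \<le> C" using test_function_bounded[OF \<phi>] by metis
    then have bdd: "bdd_above (range (\<lambda>x. \<bar>\<phi> x\<bar>))" by (auto simp: bdd_above_def)
    have le: "\<bar>\<phi> x\<bar> \<le> test_seminorm 0 \<phi>" for x
      unfolding sn by (rule cSUP_upper[OF _ bdd]) simp
    have iK: "integrable lborel (\<lambda>x. indicator K x *\<^sub>R \<bar>F x\<bar>)"
      by (intro borel_integrable_compact K continuous_on_rabs continuous_on_subset[OF F]) auto
    have "\<bar>?v \<phi>\<bar> \<le> (LINT x|lborel. \<bar>F x * \<phi> x\<bar>)"
      unfolding v[OF \<phi>] using integral_norm_bound[of lborel "\<lambda>x. F x * \<phi> x"] by simp
    also have "\<dots> \<le> (LINT x|lborel. (indicator K x *\<^sub>R \<bar>F x\<bar>) * test_seminorm 0 \<phi>)"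
    proof (rule integral_mono)
      show "integrable lborel (\<lambda>x. \<bar>F x * \<phi> x\<bar>)" using int[OF \<phi>] by simp
      show "integrable lborel (\<lambda>x. (indicator K x *\<^sub>R \<bar>F x\<bar>) * test_seminorm 0 \<phi>)"
        by (rule integrable_mult_left) (rule iK)
      show "\<bar>F x * \<phi> x\<bar> \<le> (indicator K x *\<^sub>R \<bar>F x\<bar>) * test_seminorm 0 \<phi>" for x
        using supp mult_left_mono[OF le[of x], of "\<bar>F x\<bar>"]
          by (cases "\<phi> x = 0") (auto simp: abs_mult indicator_def)
    qed
    also have "\<dots> = (LINT x|lborel. indicator K x *\<^sub>R \<bar>F x\<bar>) * test_seminorm 0 \<phi>"
      by (rule integral_mult_left_zero)
    finally show "\<bar>?v \<phi>\<bar> \<le> (LINT x|lborel. indicator K x *\<^sub>R \<bar>F x\<bar>) * test_seminorm 0 \<phi>" .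
  qed
  show ?thesis
    unfolding distributions_def using add scale bound by (auto simp: distr_of_fun_def)
qed

lemma ball_means_tendsto:
  fixes F :: "'a::euclidean_space \<Rightarrow> real"
  assumes F: "continuous_on UNIV F"
  shows "((\<lambda>r. (LINT y:ball x r|lborel. F y) / measure lborel (ball x r)) \<longlongrightarrow> F x) (at_right 0)"
proof (rule tendstoI)
  fix e :: real assume e: "e > 0"
  have "isCont F x" using F by (simp add: continuous_on_eq_continuous_at)
  then obtain \<delta> where \<delta>: "\<delta> > 0" "\<And>y. dist y x < \<delta> \<Longrightarrow> dist (F y) (F x) < e / 2"
    using e unfolding continuous_at_eps_delta by (metis half_gt_zero)
  show "\<forall>\<^sub>F r in at_right 0. dist ((LINT y:ball x r|lborel. F y) / measure lborel (ball x r)) (F x) < e"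
    using eventually_at_right_less[of 0] eventually_at_right_real[OF \<delta>(1)]
  proof eventually_elim
    case (elim r)
    have li: "loc_integrable F" "loc_integrable (\<lambda>y. F y - F x)" "loc_integrable (\<lambda>y::'a. e / 2)"
      by (intro loc_integrable_continuous continuous_intros F)+
    note i = this[THEN loc_integrable_ball[of _ x r]]
    let ?m = "measure lborel (ball x r)"
    have m: "?m > 0" using elim by (simp add: content_ball_pos)
    have fin: "emeasure lborel (ball x r) < \<infinity>" by (rule emeasure_lborel_ball_finite)
    have "(LINT y:ball x r|lborel. F y) - F x * ?m = (LINT y|lborel. F y * indicator (ball x r) y) - (LINT y|lborel. F x * indicator (ball x r) y)"
      unfolding set_lebesgue_integral_def by (simp add: mult.commute)
    also have "\<dots> = (LINT y|lborel. (F y - F x) * indicator (ball x r) y)"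
      using i(1) fin by (subst Bochner_Integration.integral_diff[symmetric]) (auto simp: left_diff_distrib)
    finally have eq: "(LINT y:ball x r|lborel. F y) - F x * ?m = (LINT y|lborel. (F y - F x) * indicator (ball x r) y)" .
    have "\<bar>(LINT y|lborel. (F y - F x) * indicator (ball x r) y)\<bar> \<le> (LINT y|lborel. \<bar>(F y - F x) * indicator (ball x r) y\<bar>)"
      using integral_norm_bound[of lborel "\<lambda>y. (F y - F x) * indicator (ball x r) y"] by simp
    also have "\<dots> \<le> (LINT y|lborel. e / 2 * indicator (ball x r) y)"
    proof (rule integral_mono)
      show "integrable lborel (\<lambda>y. \<bar>(F y - F x) * indicator (ball x r) y\<bar>)"
        using i(2) by (rule integrable_abs)
      show "integrable lborel (\<lambda>y. e / 2 * indicator (ball x r) y)" by (rule i(3))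
      show "\<bar>(F y - F x) * indicator (ball x r) y\<bar> \<le> e / 2 * indicator (ball x r) y" for y
        using \<delta>(2)[of y] elim
          by (cases "y \<in> ball x r") (auto simp: dist_real_def dist_commute abs_mult)
    qed
    also have "\<dots> = e / 2 * ?m" using fin by simp
    finally have "\<bar>(LINT y:ball x r|lborel. F y) - F x * ?m\<bar> \<le> e / 2 * ?m" unfolding eq .
    then have "\<bar>(LINT y:ball x r|lborel. F y) - F x * ?m\<bar> / ?m \<le> e / 2"
      using m by (simp add: divide_le_eq)
    moreover have "dist ((LINT y:ball x r|lborel. F y) / ?m) (F x) = \<bar>(LINT y:ball x r|lborel. F y) - F x * ?m\<bar> / ?m"
    proof -
      have "(LINT y:ball x r|lborel. F y) / ?m - F x = ((LINT y:ball x r|lborel. F y) - F x * ?m) / ?m"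
        using m by (simp add: diff_divide_distrib)
      then show ?thesis using m by (simp add: dist_real_def abs_divide)
    qed
    ultimately show ?case using e by linarith
  qed
qed

lemma usc_representative_continuous:
  fixes F :: "'a::euclidean_space \<Rightarrow> real"
  assumes F: "continuous_on UNIV F"
  shows "usc_representative (distr_of_fun (\<lambda>x. ereal (F x))) (\<lambda>x. ereal (F x))"
proof -
  have [measurable]: "F \<in> borel_measurable borel" by (rule borel_measurable_continuous_onI[OF F])
  have fin: "(\<integral>\<^sup>+x\<in>K. e2ennreal \<bar>ereal (F x)\<bar> \<partial>lborel) < \<infinity>" if K: "compact K" for K
  proof -
    have "integrable lborel (\<lambda>x. indicator K x *\<^sub>R F x)"
      by (intro borel_integrable_compact K continuous_on_subset[OF F]) auto
    then have "(\<integral>\<^sup>+x. ennreal (norm (indicator K x *\<^sub>R F x)) \<partial>lborel) < \<infinity>"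
      unfolding integrable_iff_bounded by blast
    also have "(\<lambda>x. ennreal (norm (indicator K x *\<^sub>R F x))) = (\<lambda>x. e2ennreal \<bar>ereal (F x)\<bar> * indicator K x)"
      by (auto simp: indicator_def)
    finally show ?thesis .
  qed
  have "open {x. ereal (F x) < a}" for a
  proof (cases a)
    case (real b)
    have "open {x. F x < b}" by (rule open_Collect_less[OF F continuous_on_const])
    then show ?thesis by (simp add: real)
  qed auto
  moreover have "((\<lambda>r. ereal ((LINT y:ball x r|lborel. F y) / measure lborel (ball x r))) \<longlongrightarrow> ereal (F x)) (at_right 0)" for x
    using ball_means_tendsto[OF F] by (rule tendsto_ereal)
  ultimately show ?thesis unfolding usc_representative_def locally_integrable_def using fin by auto
qed

text \<open>The order only compares values on nonnegative test functions. Every test function lies below a multiple of a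
  large bump and so is a difference of two nonnegative ones.\<close>

lemma distr_le_antisym:
  assumes v: "v \<in> distributions" and w: "w \<in> distributions" and le: "distr_le v w" "distr_le w v"
  shows "v = (w :: ('a::euclidean_space \<Rightarrow> real) \<Rightarrow> real)"
proof (rule extensionalityI)
  show "v \<in> extensional test_functions" "w \<in> extensional test_functions"
    using v w by (auto simp: distributions_def)
  have eq: "v \<phi> = w \<phi>" if "\<phi> \<in> test_functions" "\<And>x. 0 \<le> \<phi> x" for \<phi>
    using le that unfolding distr_le_def by (meson antisym)
  have sub: "u (\<lambda>x. \<psi> x - \<phi> x) = u \<psi> - u \<phi>"
    if u: "u \<in> distributions" and t: "\<psi> \<in> test_functions" "\<phi> \<in> test_functions" for u and \<phi> \<psi> :: "'a \<Rightarrow> real"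
  proof -
    have m: "(\<lambda>x. (-1) * \<phi> x) \<in> test_functions"
      using test_functions_lincomb[OF t(2) t(2), of "-1" 0] by simp
    have a: "\<And>\<phi> \<psi>. \<phi> \<in> test_functions \<Longrightarrow> \<psi> \<in> test_functions \<Longrightarrow> u (\<lambda>x. \<phi> x + \<psi> x) = u \<phi> + u \<psi>"
      and s: "\<And>\<phi> a. \<phi> \<in> test_functions \<Longrightarrow> u (\<lambda>x. a * \<phi> x) = a * u \<phi>"
      using u unfolding distributions_def by blast+
    have "u (\<lambda>x. \<psi> x + (-1) * \<phi> x) = u \<psi> + (-1) * u \<phi>"
      by (simp only: a[OF t(1) m] s[OF t(2)])
    then show ?thesis by simp
  qed
  fix \<phi> :: "'a \<Rightarrow> real" assume \<phi>: "\<phi> \<in> test_functions"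
  obtain C M where C: "\<And>x. \<bar>\<phi> x\<bar> \<le> C" "\<And>x. \<phi> x \<noteq> 0 \<Longrightarrow> norm x \<le> M"
    using \<phi> by (rule test_function_bounded) blast
  define e where "e = (\<bar>M\<bar> + 1)\<^sup>2"
  define \<eta> where "\<eta> = flat_exp 0 (e - M\<^sup>2)"
  have sq: "M\<^sup>2 < e" unfolding e_def
    using power_strict_mono[of "\<bar>M\<bar>" "\<bar>M\<bar> + 1" 2] by simp
  have \<eta>: "\<eta> > 0" using sq by (simp add: \<eta>_def flat_exp_def)
  have \<eta>le: "\<eta> \<le> bump 0 e x" if "norm x \<le> M" for x :: 'a
  proof -
    have "(norm x)\<^sup>2 \<le> M\<^sup>2" using that by (intro power_mono) auto
    then have "e - M\<^sup>2 \<le> e - (norm x)\<^sup>2" by simp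
    moreover have "1 / (e - (norm x)\<^sup>2) \<le> 1 / (e - M\<^sup>2)"
      using calculation sq by (intro divide_left_mono mult_pos_pos) auto
    ultimately show ?thesis using sq by (simp add: \<eta>_def bump_def flat_exp_def)
  qed
  define \<psi> where "\<psi> x = C / \<eta> * bump 0 e x" for x :: 'a
  have C0: "0 \<le> C" using C(1)[of 0] by simp
  have \<psi>: "\<psi> \<in> test_functions" unfolding \<psi>_def
    using test_functions_lincomb[OF bump_test_function bump_test_function, of "C / \<eta>" 0 e 0 0 e] by simp
  have \<psi>0: "0 \<le> \<psi> x" for x using C0 \<eta> by (simp add: \<psi>_def bump_nonneg)
  have ge: "0 \<le> \<psi> x - \<phi> x" for x
  proof (cases "\<phi> x = 0")
    case False
    have "\<phi> x \<le> C" using C(1)[of x] by linarith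
    also have "C = C / \<eta> * \<eta>" using \<eta> by simp
    also have "\<dots> \<le> \<psi> x"
      unfolding \<psi>_def using C0 \<eta> \<eta>le[OF C(2)[OF False]] by (intro mult_left_mono) auto
    finally show ?thesis by simp
  qed (use \<psi>0 in simp)
  have "(\<lambda>x. \<psi> x - \<phi> x) \<in> test_functions"
    using test_functions_lincomb[OF \<psi> \<phi>, of 1 "-1"] by simp
  then have "v (\<lambda>x. \<psi> x - \<phi> x) = w (\<lambda>x. \<psi> x - \<phi> x)" using ge by (rule eq)
  then show "v \<phi> = w \<phi>"
    using eq[OF \<psi> \<psi>0] sub[OF v \<psi> \<phi>] sub[OF w \<psi> \<phi>] by simp
qed

lemma locally_integrable_real:
  fixes u :: "'a::euclidean_space \<Rightarrow> ereal"
  assumes u: "locally_integrable u"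
  shows "loc_integrable (\<lambda>x. real_of_ereal (u x))" "AE x in lborel. \<bar>u x\<bar> \<noteq> \<infinity>"
proof -
  have [measurable]: "u \<in> borel_measurable borel" using u by (simp add: locally_integrable_def)
  have fin: "(\<integral>\<^sup>+x. e2ennreal \<bar>u x\<bar> * indicator (cball 0 R) x \<partial>lborel) < \<infinity>" for R
    using u by (simp add: locally_integrable_def)
  have "integrable lborel (\<lambda>y. indicator (cball 0 R) y * real_of_ereal (u y))" for R
  proof (rule integrableI_bounded)
    have "(\<integral>\<^sup>+x. ennreal (norm (indicator (cball 0 R) x * real_of_ereal (u x))) \<partial>lborel)
      \<le> (\<integral>\<^sup>+x. e2ennreal \<bar>u x\<bar> * indicator (cball 0 R) x \<partial>lborel)"
    proof (rule nn_integral_mono)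
      fix x
      show "ennreal (norm (indicator (cball 0 R) x * real_of_ereal (u x))) \<le> e2ennreal \<bar>u x\<bar> * indicator (cball 0 R) x"
        by (cases "u x") (auto simp: indicator_def)
    qed
    then show "(\<integral>\<^sup>+x. ennreal (norm (indicator (cball 0 R) x * real_of_ereal (u x))) \<partial>lborel) < \<infinity>"
      using fin[of R] by (rule le_less_trans)
    have "(\<lambda>x. real_of_ereal (u x)) \<in> borel_measurable borel" by measurable
    then show "(\<lambda>y. indicator (cball 0 R) y * real_of_ereal (u y)) \<in> borel_measurable lborel"
      by (intro borel_measurable_times borel_measurable_indicator) auto
  qed
  then show "loc_integrable (\<lambda>x. real_of_ereal (u x))" unfolding loc_integrable_def by simp
  have "AE x in lborel. \<forall>n::nat. e2ennreal \<bar>u x\<bar> * indicator (cball 0 (real n)) x \<noteq> \<infinity>"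
    unfolding AE_all_countable
  proof
    fix n :: nat
    have [measurable]: "cball 0 (real n) \<in> sets (borel :: 'a measure)" by simp
    show "AE x in lborel. e2ennreal \<bar>u x\<bar> * indicator (cball 0 (real n)) x \<noteq> \<infinity>"
    proof (rule nn_integral_PInf_AE)
      show "(\<lambda>x. e2ennreal \<bar>u x\<bar> * indicator (cball 0 (real n)) x) \<in> borel_measurable lborel"
        by measurable
    qed (use fin[of "real n"] in auto)
  qed
  then show "AE x in lborel. \<bar>u x\<bar> \<noteq> \<infinity>"
  proof eventually_elim
    case (elim x)
    obtain n :: nat where "norm x \<le> real n" using real_arch_simple by blast
    then have "e2ennreal \<bar>u x\<bar> \<noteq> \<infinity>" using elim[rule_format, of n] by simp
    then show ?case by (cases "u x") (auto simp: e2ennreal_infty)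
  qed
qed

section \<open>The class of a point mass\<close>

context subcritical_ball
begin

text \<open>\<open>W = u - T V\<close> satisfies the hypotheses of \<open>subsolution_bound\<close> with \<open>\<tau> = T - 1\<close>: the inequality for \<open>v\<close> gives \<open>- 1\<close>,
  the equation for \<open>V\<close> gives \<open>T\<close>, and \<open>u\<close> lies below the potential. Since \<open>u x0\<close> is the limit of means over balls and
  \<open>V\<close> is continuous, every \<open>\<beta> < u x0 - T V x0\<close> bounds the means of \<open>W\<close> over small balls from below.\<close>

lemma class_member_bound:
  assumes T: "T > 0" and v: "v \<in> balayage_class k (scale_measure (ennreal (T * mass)) (return borel z))"
  obtains u where "usc_representative v u"
    "\<And>x. x \<noteq> z \<Longrightarrow> u x \<le> ereal (T * (V x + gap x))"
    "\<And>x0 t1 \<beta>. tt x0 < t1 \<Longrightarrow> t1 < t0 \<Longrightarrow> ereal (\<beta> + T * V x0) < u x0 \<Longrightarrow>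
       \<beta> \<le> entire_J \<nu> (tt x0) / entire_J \<nu> t1 * ((T * excess \<nu> t0 t1 - (T - 1)) / k\<^sup>2) + (T - 1) / k\<^sup>2"
proof -
  let ?\<mu> = "scale_measure (ennreal (T * mass)) (return borel z)"
  obtain u where u: "usc_representative v u" "\<And>x. u x \<le> helmholtz_potential k ?\<mu> x"
    and vle: "distr_le (neg_helmholtz k v) (distr_of_fun (\<lambda>_. 1))"
    using v unfolding balayage_class_def by blast
  have upot: "u x \<le> ereal (T * (V x + gap x))" if "x \<noteq> z" for x
    using u(2)[of x] that by (simp add: potential_eq[OF T])
  have li: "locally_integrable u" and vu: "v = distr_of_fun u"
    and means: "\<And>x. ((\<lambda>r. ereal ((LINT y:ball x r|lborel. real_of_ereal (u y)) / measure lborel (ball x r))) \<longlongrightarrow> u x) (at_right 0)"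
    using u(1) unfolding usc_representative_def by blast+
  define ur where "ur x = real_of_ereal (u x)" for x
  have ur: "loc_integrable ur" unfolding ur_def by (rule locally_integrable_real(1)[OF li])
  define W where "W x = ur x - T * V x" for x
  have Vl: "loc_integrable (\<lambda>x. T * V x)"
    by (intro loc_integrable_continuous continuous_intros V_continuous)
  have W: "loc_integrable W" unfolding W_def by (rule loc_integrable_diff[OF ur Vl])
  have weak: "(LINT x|lborel. W x * (laplacian \<phi> x + k\<^sup>2 * \<phi> x)) \<ge> (T - 1) * (LINT x|lborel. \<phi> x)"
    if \<phi>: "\<phi> \<in> test_functions" "\<And>x. 0 \<le> \<phi> x" "\<And>x. \<phi> x \<noteq> 0 \<Longrightarrow> x \<in> ball z radius" for \<phi>
  proof -
    define \<psi> where "\<psi> x = - (laplacian \<phi> x + k\<^sup>2 * \<phi> x)" for x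
    have \<psi>: "\<psi> \<in> test_functions"
      unfolding \<psi>_def by (rule test_functions_helmholtz[OF \<phi>(1)])
    have "neg_helmholtz k v \<phi> \<le> distr_of_fun (\<lambda>_. 1) \<phi>"
      using vle \<phi> unfolding distr_le_def by blast
    moreover have "neg_helmholtz k v \<phi> = (LINT x|lborel. ur x * \<psi> x)"
      using \<phi>(1) \<psi> by (simp add: neg_helmholtz_def vu distr_of_fun_def ur_def \<psi>_def[abs_def])
    moreover have "distr_of_fun (\<lambda>_. 1) \<phi> = (LINT x|lborel. \<phi> x)"
      using \<phi>(1) by (simp add: distr_of_fun_def)
    ultimately have 1: "(LINT x|lborel. ur x * \<psi> x) \<le> (LINT x|lborel. \<phi> x)" by simp
    have "(LINT x|lborel. V x * \<psi> x) = (LINT x|lborel. \<phi> x * indicator (ball z radius) x)"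
      unfolding \<psi>_def by (rule V_weak_equation[OF \<phi>(1)])
    also have "\<dots> = (LINT x|lborel. \<phi> x)"
      using \<phi>(3) by (intro Bochner_Integration.integral_cong) (auto simp: indicator_def)
    finally have 2: "(LINT x|lborel. V x * \<psi> x) = (LINT x|lborel. \<phi> x)" .
    have "(LINT x|lborel. W x * (laplacian \<phi> x + k\<^sup>2 * \<phi> x)) = (LINT x|lborel. T * V x * \<psi> x - ur x * \<psi> x)"
      by (intro Bochner_Integration.integral_cong) (auto simp: W_def \<psi>_def algebra_simps)
    also have "\<dots> = (LINT x|lborel. T * V x * \<psi> x) - (LINT x|lborel. ur x * \<psi> x)"
      by (intro Bochner_Integration.integral_diff loc_integrable_mult_test_function Vl ur \<psi>)
    also have "(LINT x|lborel. T * V x * \<psi> x) = T * (LINT x|lborel. V x * \<psi> x)"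
      by (simp add: mult.assoc)
    finally show ?thesis using 1 unfolding 2 by (simp add: left_diff_distrib)
  qed
  have le: "AE x in lborel. W x \<le> T * gap x"
  proof -
    have "AE x in lborel. x \<noteq> z" using AE_not_in_sphere[of z 0] by simp
    with locally_integrable_real(2)[OF li] show ?thesis
    proof eventually_elim
      case (elim x)
      then have "ereal (ur x) \<le> ereal (T * (V x + gap x))" using upot[of x] by (simp add: ur_def ereal_real)
      then show ?case by (simp add: W_def algebra_simps)
    qed
  qed
  have bound: "\<beta> \<le> entire_J \<nu> (tt x0) / entire_J \<nu> t1 * ((T * excess \<nu> t0 t1 - (T - 1)) / k\<^sup>2) + (T - 1) / k\<^sup>2"
    if t: "tt x0 < t1" "t1 < t0" and \<beta>: "ereal (\<beta> + T * V x0) < u x0" for x0 t1 \<beta>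
  proof -
    obtain \<beta>1 where \<beta>1: "\<beta> + T * V x0 < \<beta>1" "ereal \<beta>1 < u x0"
      using ereal_dense2[OF \<beta>] by auto
    have "\<forall>\<^sub>F r in at_right 0. ereal \<beta>1 < ereal ((LINT y:ball x0 r|lborel. ur y) / measure lborel (ball x0 r))"
      using order_tendstoD(1)[OF means \<beta>1(2)] by (simp add: ur_def)
    moreover have "\<forall>\<^sub>F r in at_right 0. (LINT y:ball x0 r|lborel. \<beta> + T * V y) / measure lborel (ball x0 r) < \<beta>1"
      using \<beta>1(1) by (intro order_tendstoD(2)[OF ball_means_tendsto] continuous_intros V_continuous)
    ultimately have "\<forall>\<^sub>F r in at_right 0. (LINT y|lborel. (W y - \<beta>) * indicator (ball x0 r) y) \<ge> 0"
      using eventually_at_right_less[of 0]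
    proof eventually_elim
      case (elim r)
      have m: "measure lborel (ball x0 r) > 0" using elim by (simp add: content_ball_pos)
      have li2: "loc_integrable (\<lambda>y. \<beta> + T * V y)"
        by (intro loc_integrable_continuous continuous_intros V_continuous)
      have "(LINT y:ball x0 r|lborel. \<beta> + T * V y) / measure lborel (ball x0 r) < (LINT y:ball x0 r|lborel. ur y) / measure lborel (ball x0 r)"
        using elim by simp
      then have "(LINT y:ball x0 r|lborel. \<beta> + T * V y) \<le> (LINT y:ball x0 r|lborel. ur y)"
        using m by (auto simp: divide_less_cancel)
      then have "0 \<le> (LINT y|lborel. ur y * indicator (ball x0 r) y) - (LINT y|lborel. (\<beta> + T * V y) * indicator (ball x0 r) y)"
        unfolding set_lebesgue_integral_def by (simp add: mult.commute)
      also have "\<dots> = (LINT y|lborel. ur y * indicator (ball x0 r) y - (\<beta> + T * V y) * indicator (ball x0 r) y)"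
        by (intro Bochner_Integration.integral_diff[symmetric] loc_integrable_ball ur li2)
      also have "\<dots> = (LINT y|lborel. (W y - \<beta>) * indicator (ball x0 r) y)"
        by (intro Bochner_Integration.integral_cong) (auto simp: W_def algebra_simps)
      finally show ?case .
    qed
    then obtain \<rho>0 where "\<rho>0 > 0" "\<And>\<rho>. 0 < \<rho> \<Longrightarrow> \<rho> < \<rho>0 \<Longrightarrow> (LINT y|lborel. (W y - \<beta>) * indicator (ball x0 \<rho>) y) \<ge> 0"
      unfolding eventually_at_right_field by blast
    then show ?thesis by (intro subsolution_bound[OF W T weak le t]) auto
  qed
  show ?thesis using that[OF u(1) upot bound] by blast
qed

lemma V_in_class: "distr_of_fun (\<lambda>x. ereal (V x)) \<in> balayage_class k (scale_measure (ennreal mass) (return borel z))"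
  (is "?v \<in> balayage_class k ?\<mu>")
proof -
  have pot: "helmholtz_potential k ?\<mu> x = (if x = z then \<infinity> else ereal (V x + gap x))" for x
    using potential_eq[of 1] by simp
  have nh: "neg_helmholtz k ?v \<phi> = (LINT x|lborel. \<phi> x * indicator (ball z radius) x)" if \<phi>: "\<phi> \<in> test_functions" for \<phi>
    using \<phi> test_functions_helmholtz[OF \<phi>, of "k\<^sup>2"] V_weak_equation[OF \<phi>]
      by (simp add: neg_helmholtz_def distr_of_fun_def)
  have "distr_le (neg_helmholtz k ?v) (distr_of_fun (\<lambda>_. 1))"
    unfolding distr_le_def
  proof (intro ballI impI)
    fix \<phi> :: "'a \<Rightarrow> real" assume \<phi>: "\<phi> \<in> test_functions" "\<forall>x. 0 \<le> \<phi> x"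
    have c1: "loc_integrable \<phi>" by (intro loc_integrable_continuous test_function_continuous \<phi>)
    obtain M where M: "\<And>x. \<phi> x \<noteq> 0 \<Longrightarrow> norm x \<le> M"
      using \<phi>(1) unfolding test_functions_iff by blast
    have "neg_helmholtz k ?v \<phi> \<le> (LINT x|lborel. \<phi> x)"
      unfolding nh[OF \<phi>(1)]
    proof (rule integral_mono)
      show "integrable lborel (\<lambda>x. \<phi> x * indicator (ball z radius) x)"
        by (rule loc_integrable_ball[OF c1])
      show "integrable lborel \<phi>"
        by (rule integrable_continuous_compact_support[OF test_function_continuous[OF \<phi>(1)], of M]) (use M linorder_not_le in blast)
      show "\<phi> x * indicator (ball z radius) x \<le> \<phi> x" for x
        using \<phi>(2) by (simp add: indicator_def)
    qed
    then show "neg_helmholtz k ?v \<phi> \<le> distr_of_fun (\<lambda>_. 1) \<phi>"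
      using \<phi>(1) by (simp add: distr_of_fun_def)
  qed
  moreover have "\<forall>x. ereal (V x) \<le> helmholtz_potential k ?\<mu> x"
    using gap_nonneg by (simp add: pot)
  moreover have "bounded {x. ereal (V x) < helmholtz_potential k ?\<mu> x}"
  proof (rule bounded_subset[OF bounded_ball])
    show "{x. ereal (V x) < helmholtz_potential k ?\<mu> x} \<subseteq> ball z radius"
    proof
      fix x assume x: "x \<in> {x. ereal (V x) < helmholtz_potential k ?\<mu> x}"
      show "x \<in> ball z radius"
      proof (cases "x = z")
        case False
        then have "gap x \<noteq> 0" using x by (auto simp: pot)
        then show ?thesis unfolding mem_ball_radius by (auto simp: gap_def split: if_splits)
      qed (use radius_pos in simp)
    qed
  qed
  ultimately show ?thesis
    unfolding balayage_class_def
    using continuous_distribution[OF V_continuous] usc_representative_continuous[OF V_continuous] by blast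
qed

text \<open>For \<open>T = 1\<close> the bound of \<open>class_member_bound\<close> is a multiple of the quotient of \<open>excess\<close> by \<open>entire_J\<close> at \<open>t1\<close>, which
  tends to \<open>0\<close> as \<open>t1\<close> tends to \<open>t0\<close>. No \<open>\<beta> > 0\<close> survives, hence \<open>u \<le> V\<close> in the ball; outside, \<open>V\<close> is the potential.\<close>

lemma V_largest:
  assumes w: "w \<in> balayage_class k (scale_measure (ennreal mass) (return borel z))"
  shows "distr_le w (distr_of_fun (\<lambda>x. ereal (V x)))"
proof -
  have w1: "w \<in> balayage_class k (scale_measure (ennreal (1 * mass)) (return borel z))" using w by simp
  obtain u where u: "usc_representative w u" "\<And>x. x \<noteq> z \<Longrightarrow> u x \<le> ereal (1 * (V x + gap x))"
    and b: "\<And>x0 t1 \<beta>. tt x0 < t1 \<Longrightarrow> t1 < t0 \<Longrightarrow> ereal (\<beta> + 1 * V x0) < u x0 \<Longrightarrow>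
       \<beta> \<le> entire_J \<nu> (tt x0) / entire_J \<nu> t1 * ((1 * excess \<nu> t0 t1 - (1 - 1)) / k\<^sup>2) + (1 - 1) / k\<^sup>2"
    using class_member_bound[OF zero_less_one w1] by blast
  have uV: "u x \<le> ereal (V x)" for x
  proof (cases "tt x < t0")
    case False
    then have "x \<noteq> z" using t0 by (auto simp: tt_def)
    then show ?thesis using u(2)[of x] False by (simp add: gap_def)
  next
    case True
    show ?thesis
    proof (rule ccontr)
      assume "\<not> u x \<le> ereal (V x)"
      then have "ereal (V x) < u x" by simp
      from ereal_dense2[OF this] obtain \<gamma> where g: "ereal (V x) < ereal \<gamma>" "ereal \<gamma> < u x"
        by blast
      define \<beta> where "\<beta> = \<gamma> - V x"
      have \<beta>: "\<beta> > 0" "ereal (\<beta> + 1 * V x) < u x" using g by (auto simp: \<beta>_def)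
      have "((\<lambda>t. entire_J \<nu> (tt x) / k\<^sup>2 * (excess \<nu> t0 t / entire_J \<nu> t)) \<longlongrightarrow> entire_J \<nu> (tt x) / k\<^sup>2 * 0) (at_left t0)"
        by (intro tendsto_mult tendsto_const excess_quotient_tendsto \<nu> t0 pos)
      moreover have "\<forall>\<^sub>F t in at_left t0. \<beta> \<le> entire_J \<nu> (tt x) / k\<^sup>2 * (excess \<nu> t0 t / entire_J \<nu> t)"
        using eventually_at_left_real[OF True]
      proof eventually_elim
        case (elim t)
        then show ?case using b[of x t \<beta>] \<beta>(2) by (simp add: mult.commute)
      qed
      ultimately have "\<beta> \<le> entire_J \<nu> (tt x) / k\<^sup>2 * 0" by (intro tendsto_lowerbound) auto
      then show False using \<beta> by simp
    qed
  qed
  have li: "locally_integrable u" and wu: "w = distr_of_fun u"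
    using u(1) unfolding usc_representative_def by blast+
  have ur: "loc_integrable (\<lambda>x. real_of_ereal (u x))" by (rule locally_integrable_real(1)[OF li])
  show ?thesis unfolding distr_le_def
  proof (intro ballI impI)
    fix \<phi> :: "'a \<Rightarrow> real" assume \<phi>: "\<phi> \<in> test_functions" "\<forall>x. 0 \<le> \<phi> x"
    have "(LINT x|lborel. real_of_ereal (u x) * \<phi> x) \<le> (LINT x|lborel. V x * \<phi> x)"
    proof (rule integral_mono_AE[OF loc_integrable_mult_test_function[OF ur \<phi>(1)]
          integrable_continuous_mult_test_function[OF V_continuous \<phi>(1)]])
      show "AE x in lborel. real_of_ereal (u x) * \<phi> x \<le> V x * \<phi> x"
        using locally_integrable_real(2)[OF li]
      proof eventually_elim
        case (elim x)
        then have "ereal (real_of_ereal (u x)) \<le> ereal (V x)" using uV[of x] by (simp add: ereal_real)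
        then show ?case using \<phi>(2) by (intro mult_right_mono) auto
      qed
    qed
    then show "w \<phi> \<le> distr_of_fun (\<lambda>x. ereal (V x)) \<phi>"
      using \<phi>(1) by (simp add: wu distr_of_fun_def)
  qed
qed

lemma partial_balayage_eq:
  "partial_balayage k (scale_measure (ennreal mass) (return borel z)) = distr_of_measure (density lborel (indicator (ball z radius)))"
proof -
  let ?\<mu> = "scale_measure (ennreal mass) (return borel z)" and ?v = "distr_of_fun (\<lambda>x. ereal (V x))"
  have bp: "balayage_potential k ?\<mu> = ?v"
    unfolding balayage_potential_def
  proof (rule the_equality)
    show "?v \<in> balayage_class k ?\<mu> \<and> (\<forall>w\<in>balayage_class k ?\<mu>. distr_le w ?v)"
      using V_in_class V_largest by blast
    fix v assume v: "v \<in> balayage_class k ?\<mu> \<and> (\<forall>w\<in>balayage_class k ?\<mu>. distr_le w v)"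
    show "v = ?v"
    proof (rule distr_le_antisym)
      show "v \<in> distributions" using v unfolding balayage_class_def by blast
      show "?v \<in> distributions" by (rule continuous_distribution[OF V_continuous])
      show "distr_le v ?v" using v V_largest by blast
      show "distr_le ?v v" using v V_in_class by blast
    qed
  qed
  show ?thesis
  proof (rule ext)
    fix \<phi> :: "'a \<Rightarrow> real"
    show "partial_balayage k ?\<mu> \<phi> = distr_of_measure (density lborel (indicator (ball z radius))) \<phi>"
    proof (cases "\<phi> \<in> test_functions")
      case True
      have [measurable]: "\<phi> \<in> borel_measurable borel"
        by (rule borel_measurable_continuous_onI[OF test_function_continuous[OF True]])
      have "partial_balayage k ?\<mu> \<phi> = (LINT x|lborel. \<phi> x * indicator (ball z radius) x)"
        unfolding partial_balayage_def bp
        using True test_functions_helmholtz[OF True, of "k\<^sup>2"] V_weak_equation[OF True]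
          by (simp add: neg_helmholtz_def distr_of_fun_def)
      also have "\<dots> = (LINT x|density lborel (\<lambda>x. ennreal (indicator (ball z radius) x)). \<phi> x)"
        by (subst integral_real_density) (auto simp: mult.commute intro!: borel_measurable_indicator)
      also have "(\<lambda>x. ennreal (indicator (ball z radius) x)) = indicator (ball z radius)"
        by (auto simp: indicator_def)
      finally show ?thesis using True by (simp add: distr_of_measure_def)
    next
      case False
      then show ?thesis by (simp add: partial_balayage_def neg_helmholtz_def distr_of_measure_def)
    qed
  qed
qed

text \<open>At the critical radius \<open>entire_J \<nu> t1 \<rightarrow> 0\<close> as \<open>t1 \<rightarrow> t0\<close>, and for \<open>T > 1\<close> the term \<open>- (T - 1) / entire_J \<nu> t1\<close> drives the
  bound of \<open>class_member_bound\<close> to \<open>-\<infinity>\<close>. A representative would be infinite on the whole ball.\<close>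

lemma class_empty_beyond_critical:
  assumes crit: "entire_J \<nu> t0 = 0" and T: "T > 1"
  shows "balayage_class k (scale_measure (ennreal (T * mass)) (return borel z)) = {}"
proof (rule ccontr)
  assume "balayage_class k (scale_measure (ennreal (T * mass)) (return borel z)) \<noteq> {}"
  then obtain v where v: "v \<in> balayage_class k (scale_measure (ennreal (T * mass)) (return borel z))"
    by blast
  have T0: "T > 0" using T by simp
  obtain u where u: "usc_representative v u" and "\<And>x. x \<noteq> z \<Longrightarrow> u x \<le> ereal (T * (V x + gap x))"
    and b: "\<And>x0 t1 \<beta>. tt x0 < t1 \<Longrightarrow> t1 < t0 \<Longrightarrow> ereal (\<beta> + T * V x0) < u x0 \<Longrightarrow>
       \<beta> \<le> entire_J \<nu> (tt x0) / entire_J \<nu> t1 * ((T * excess \<nu> t0 t1 - (T - 1)) / k\<^sup>2) + (T - 1) / k\<^sup>2"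
    by (rule class_member_bound[OF T0 v]) (rule that)
  have inf: "\<not> \<bar>u x\<bar> \<noteq> \<infinity>" if x: "x \<in> ball z radius" for x
  proof
    assume fin: "\<bar>u x\<bar> \<noteq> \<infinity>"
    then obtain ux where ux: "u x = ereal ux" by (cases "u x") auto
    (* Any number below u x - T * V x serves. *)
    define \<beta> where "\<beta> = ux - T * V x - 1"
    have \<beta>: "ereal (\<beta> + T * V x) < u x" by (simp add: \<beta>_def ux)
    have tx: "tt x < t0" using x by (simp only: mem_ball_radius)
    have gx: "entire_J \<nu> (tt x) > 0" using tx by (intro pos tt_nonneg)
    define q where "q t = T * (excess \<nu> t0 t / entire_J \<nu> t) - (T - 1) / entire_J \<nu> t" for t
    have low: "(\<beta> - (T - 1) / k\<^sup>2) * k\<^sup>2 / entire_J \<nu> (tt x) \<le> q t" if t: "t \<in> {tt x<..<t0}" for t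
    proof -
      have "\<beta> \<le> entire_J \<nu> (tt x) / entire_J \<nu> t * ((T * excess \<nu> t0 t - (T - 1)) / k\<^sup>2) + (T - 1) / k\<^sup>2"
        using t by (intro b \<beta>) auto
      also have "entire_J \<nu> (tt x) / entire_J \<nu> t * ((T * excess \<nu> t0 t - (T - 1)) / k\<^sup>2) = entire_J \<nu> (tt x) * q t / k\<^sup>2"
        by (simp add: q_def diff_divide_distrib right_diff_distrib)
      finally have "\<beta> - (T - 1) / k\<^sup>2 \<le> entire_J \<nu> (tt x) * q t / k\<^sup>2" by simp
      then have "(\<beta> - (T - 1) / k\<^sup>2) * k\<^sup>2 \<le> q t * entire_J \<nu> (tt x)"
        using k by (simp add: pos_le_divide_eq mult.commute)
      then show ?thesis using gx by (simp add: pos_divide_le_eq)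
    qed
    have inv: "filterlim (\<lambda>t. inverse (entire_J \<nu> t)) at_top (at_left t0)"
    proof (rule filterlim_inverse_at_top)
      have "continuous_on UNIV (entire_J \<nu>)" by (intro continuous_intros)
      then have "(entire_J \<nu> \<longlongrightarrow> entire_J \<nu> t0) (at t0)"
        by (simp add: continuous_on_def)
      then have "(entire_J \<nu> \<longlongrightarrow> entire_J \<nu> t0) (at_left t0)"
        by (rule tendsto_within_subset) simp
      then show "(entire_J \<nu> \<longlongrightarrow> 0) (at_left t0)" unfolding crit .
      show "\<forall>\<^sub>F t in at_left t0. 0 < entire_J \<nu> t"
        using eventually_at_left_real[OF t0]
      proof eventually_elim
        case (elim t)
        then show ?case by (intro pos) auto
      qed
    qed
    have "filterlim (\<lambda>t. (T - 1) * inverse (entire_J \<nu> t)) at_top (at_left t0)"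
      by (rule filterlim_tendsto_pos_mult_at_top[OF tendsto_const _ inv]) (use T in simp)
    then have "filterlim (\<lambda>t. (T - 1) / entire_J \<nu> t) at_top (at_left t0)"
      by (simp only: divide_inverse)
    moreover have "((\<lambda>t. - (T * (excess \<nu> t0 t / entire_J \<nu> t))) \<longlongrightarrow> - (T * 0)) (at_left t0)"
      by (intro tendsto_minus tendsto_mult tendsto_const excess_quotient_tendsto \<nu> t0 pos)
    ultimately have "filterlim (\<lambda>t. - (T * (excess \<nu> t0 t / entire_J \<nu> t)) + (T - 1) / entire_J \<nu> t) at_top (at_left t0)"
      by (intro filterlim_tendsto_add_at_top)
    then have "\<forall>\<^sub>F t in at_left t0. - ((\<beta> - (T - 1) / k\<^sup>2) * k\<^sup>2 / entire_J \<nu> (tt x))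
        < - (T * (excess \<nu> t0 t / entire_J \<nu> t)) + (T - 1) / entire_J \<nu> t"
      unfolding filterlim_at_top_dense by blast
    then have "\<forall>\<^sub>F t in at_left t0. False"
      using eventually_at_left_real[OF tx]
    proof eventually_elim
      case (elim t)
      then show False using low[of t] unfolding q_def by linarith
    qed
    then show False by simp
  qed
  have "locally_integrable u" using u unfolding usc_representative_def by blast
  from locally_integrable_real(2)[OF this] have "AE x in lborel. x \<notin> ball z radius"
  proof eventually_elim
    case (elim x)
    show ?case
    proof
      assume "x \<in> ball z radius"
      then have "\<not> \<bar>u x\<bar> \<noteq> \<infinity>" by (rule inf)
      with elim show False by contradiction
    qed
  qed
  then have "emeasure lborel (ball z radius) = 0" by (subst (asm) AE_iff_measurable[of "ball z radius"]) auto
  then show False using content_ball_pos[OF radius_pos, of z] by (simp add: measure_def)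
qed

end

section \<open>Partial balayage of a point mass\<close>

theorem proposition1p3:
  fixes k c :: real and z :: "'a::euclidean_space"
  assumes "2 \<le> DIM('a)" and "0 < k" and "0 < c"
  shows
    "(balayage_class k (scale_measure (ennreal c) (return borel z)) \<noteq> {} \<longleftrightarrow>
        0 < c \<and> c \<le> c_ball DIM('a) k (R_crit DIM('a) k)) \<and>
     (0 < c \<and> c \<le> c_ball DIM('a) k (R_crit DIM('a) k) \<longrightarrow>
        (\<exists>!r. r \<in> {0..R_crit DIM('a) k} \<and> c = c_ball DIM('a) k r) \<and>
        (\<forall>r. r \<in> {0..R_crit DIM('a) k} \<and> c = c_ball DIM('a) k r \<longrightarrow>
           partial_balayage k (scale_measure (ennreal c) (return borel z)) =
             distr_of_measure (density lborel (indicator (ball z r)))))"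
proof -
  define \<nu> where "\<nu> = (real DIM('a) - 2) / 2"
  have \<nu>: "0 \<le> \<nu>" and dim: "real DIM('a) = 2 * \<nu> + 2"
    using assms(1) by (auto simp: \<nu>_def field_simps)
  have k: "k > 0" and c: "c > 0" using assms by auto
  obtain T where T: "T > 0" "entire_J \<nu> T = 0" "\<And>t. 0 \<le> t \<Longrightarrow> t < T \<Longrightarrow> entire_J \<nu> t > 0"
    using entire_J_first_zero[of \<nu>] \<nu> by auto
  define R where "R = R_crit DIM('a) k"
  have "bessel_J_zero1 \<nu> = 2 * sqrt T" using T by (rule bessel_J_zero1_eq)
  then have R: "R = 2 * sqrt T / k" by (simp only: R_def R_crit_def \<nu>_def[symmetric])
  have Rpos: "R > 0" using R T k by simp
  define time where "time r = k\<^sup>2 * r\<^sup>2 / 4" for r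
  have time_R: "time R = T" using T k by (simp add: time_def R power_divide power_mult_distrib)
  have time_mono: "time r < time s" if "0 \<le> r" "r < s" for r s
    using that k power_strict_mono[of r s 2] by (simp add: time_def)
  define G where "G t = t powr (\<nu> + 1) * entire_J (\<nu> + 1) t" for t
  have Gmono: "G s < G t" if "0 \<le> s" "s < t" "t \<le> T" for s t
  proof (rule DERIV_pos_imp_increasing_open[OF that(2)])
    fix x assume x: "s < x" "x < t"
    have x0: "x > 0" using x that by simp
    then have "x powr \<nu> * entire_J \<nu> x > 0" using x that T(3)[of x] by simp
    then show "\<exists>y. (G has_real_derivative y) (at x) \<and> 0 < y"
      unfolding G_def[abs_def] using entire_J_power_has_derivative[OF x0, of \<nu>] by blast
  next
    show "continuous_on {s..t} G" unfolding G_def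
      by (intro continuous_intros continuous_on_powr') (use \<nu> that in auto)
  qed
  have cb: "c_ball DIM('a) k r = (4 * pi / k\<^sup>2) powr (\<nu> + 1) * G (time r)" if "0 \<le> r" for r
    unfolding G_def time_def by (rule c_ball_eq_entire_J[OF k that dim])
  have cb0: "c_ball DIM('a) k 0 = 0" using cb[of 0] by (simp add: G_def time_def)
  have cmono: "c_ball DIM('a) k r < c_ball DIM('a) k s" if "0 \<le> r" "r < s" "s \<le> R" for r s
  proof -
    have "time s \<le> T" using time_mono[of s R] that time_R by (cases "s = R") auto
    then have "G (time r) < G (time s)" using that by (intro Gmono time_mono) (auto simp: time_def)
    then show ?thesis using that k by (simp add: cb)
  qed
  have cR: "c_ball DIM('a) k R > 0" using cmono[of 0 R] cb0 Rpos by simp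
  have ball: "subcritical_ball TYPE('a) k \<nu> (time r)" if "0 < r" "r \<le> R" for r
  proof
    show "0 < k" by (rule k)
    show "real DIM('a) = 2 * \<nu> + 2" by (rule dim)
    show "0 \<le> \<nu>" by (rule \<nu>)
    show "0 < time r" using time_mono[of 0 r] that by (simp add: time_def)
    have "time r \<le> T" using time_mono[of r R] that time_R by (cases "r = R") auto
    then show "entire_J \<nu> s > 0" if "0 \<le> s" "s < time r" for s using T(3)[of s] that by simp
  qed
  have mass: "subcritical_ball.mass k \<nu> (time r) = c_ball DIM('a) k r"
    and radius: "subcritical_ball.radius k (time r) = r" if r: "0 < r" "r \<le> R" for r
  proof -
    interpret subcritical_ball k \<nu> "time r" z by (rule ball[OF r])
    show "mass = c_ball DIM('a) k r" using cb[of r] r by (simp add: mass_def G_def)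
    have "sqrt (time r) = k * r / 2" using k r by (simp add: time_def real_sqrt_divide real_sqrt_mult)
    then show "radius = r" using k by (simp add: radius_def field_simps)
  qed
  have ex: "\<exists>r. 0 < r \<and> r \<le> R \<and> c = c_ball DIM('a) k r" if cle: "c \<le> c_ball DIM('a) k R"
  proof -
    have "continuous_on {0..R} (\<lambda>r. (4 * pi / k\<^sup>2) powr (\<nu> + 1) * G (time r))"
      unfolding G_def time_def by (intro continuous_intros continuous_on_powr') (use \<nu> k in auto)
    then have "continuous_on {0..R} (c_ball DIM('a) k)" by (rule continuous_on_eq) (simp add: cb)
    then obtain r where r: "0 \<le> r" "r \<le> R" "c_ball DIM('a) k r = c"
      using IVT'[of "c_ball DIM('a) k" 0 c R] cb0 c cle Rpos by auto
    moreover have "r \<noteq> 0" using r(3) cb0 c by auto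
    ultimately show ?thesis by (intro exI[of _ r]) auto
  qed
  have unique: "r = s" if "r \<in> {0..R}" "s \<in> {0..R}" "c_ball DIM('a) k r = c_ball DIM('a) k s" for r s
    using that cmono[of r s] cmono[of s r] by (cases r s rule: linorder_cases) auto
  have member: "balayage_class k (scale_measure (ennreal c) (return borel z)) \<noteq> {}" if le: "c \<le> c_ball DIM('a) k R"
  proof -
    obtain r where r: "0 < r" "r \<le> R" "c = c_ball DIM('a) k r" using ex[OF le] by blast
    interpret subcritical_ball k \<nu> "time r" z by (rule ball[OF r(1,2)])
    show ?thesis using V_in_class unfolding mass[OF r(1,2)] r(3) by blast
  qed
  have empty: "balayage_class k (scale_measure (ennreal c) (return borel z)) = {}" if "\<not> c \<le> c_ball DIM('a) k R"
  proof -
    interpret subcritical_ball k \<nu> "time R" z by (rule ball) (use Rpos in auto)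
    have "c / c_ball DIM('a) k R > 1" using that cR by simp
    moreover have "entire_J \<nu> (time R) = 0" using T(2) time_R by simp
    moreover have "c / c_ball DIM('a) k R * mass = c" using cR Rpos by (simp add: mass)
    ultimately show ?thesis using class_empty_beyond_critical[of "c / c_ball DIM('a) k R"] by simp
  qed
  have balayage: "partial_balayage k (scale_measure (ennreal c) (return borel z)) =
      distr_of_measure (density lborel (indicator (ball z r)))"
    if r: "r \<in> {0..R}" "c = c_ball DIM('a) k r" for r
  proof -
    have "r \<noteq> 0" using r(2) cb0 c by auto
    then have r': "0 < r" "r \<le> R" using r(1) by auto
    interpret subcritical_ball k \<nu> "time r" z by (rule ball[OF r'])
    show ?thesis using partial_balayage_eq unfolding mass[OF r'] radius[OF r'] r(2) .
  qed
  have "\<exists>!r. r \<in> {0..R} \<and> c = c_ball DIM('a) k r" if "c \<le> c_ball DIM('a) k R"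
    using ex[OF that] unique by (metis atLeastAtMost_iff less_imp_le)
  then show ?thesis unfolding R_def[symmetric] using c member empty balayage by blast
qed

end
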